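(* Let $\{a_{m,n}\}_{m,n\in\mathbb{Z}_+}$ be a family of complex numbers and define $$s_{m,n}=\frac{1}{2^m(2i)^n}\sum_{k=0}^m\sum_{j=0}^n(-1)^{n-j}\binom{m}{k}\binom{n}{j}a_{k+j,\,m-k+n-j},\qquad m,n\in\mathbb{Z}_+,\qquad S=\{s_{m,n}\}_{m,n\in\mathbb{Z}_+}.$$ Suppose that the following conditions hold: (i) $\sum_{m,n,m',n'\in\mathbb{Z}_+}\alpha_{m,n}\overline{\alpha_{m',n'}}\,s_{m+m',n+n'}\ge0$ for all complex coefficients $\alpha_{m,n}$, all but finitely many of which are zero; (ii) for an arbitrarily chosen and fixed model space $\mathcal{H}$ with a family $\{h_{m,n}\}_{m,n\in\mathbb{Z}_+}$ satisfying $(h_{m,n},h_{m',n'})_{\mathcal{H}_0}=s_{m+m',n+n'}$, and fixed auxiliary choices as described in the context, those of the equations (E1)–(E10) of the context all of whose vectors belong to $\{h_{m,0,0;n,0,0}:\ m,n\in\mathbb{Z}_+\}$ are satisfied with $h_{m,0,0;n,0,0}:=h_{m,n}$, and $\mathbf{G}\neq\emptyset$, where $\mathbf{G}$ is the set produced by the algorithm described in the context; (iii) $\displaystyle a_{m,n}=\sum_{r=0}^m\sum_{l=0}^n\binom{m}{r}\binom{n}{l}(-1)^{n-l}\,i^{\,m-r+n-l}\,s_{r+l,\,m-r+n-l}$ for all $m,n\in\mathbb{Z}_+$. Let $\Psi$ be the set of all non-negative Borel measures $\sigma$ on $\mathbb{C}$ with $\int_{\mathbb{C}}z^m\overline{z}^n\,d\sigma=a_{m,n}$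 for all $m,n\in\mathbb{Z}_+$, and let $\Phi$ be the set of all non-negative Borel measures $\mu$ on $\mathbb{R}^2$ with $\int_{\mathbb{R}^2}x_1^mx_2^n\,d\mu=s_{m,n}$ for all $m,n\in\mathbb{Z}_+$. For $\mu\in\Phi$ let $\sigma_\mu$ be the measure $\mu$ viewed as a measure on $\mathbb{C}$ via the identification $(x_1,x_2)\leftrightarrow z=x_1+ix_2$. Then $$\Psi=\{\sigma_\mu:\ \mu\in\Phi\}.$$ Consequently, all elements of $\Psi$ are described as follows: to each $(v_1,v_2,\dots)\in\mathbf{G}$ associate the family $\{h_{m,k,l;n,r,t}\}_{(m,k,l;n,r,t)\in\Omega}$ defined by $h_{m,0,0;n,0,0}=h_{m,n}$ ($m,n\in\mathbb{Z}_+$) and $h_{w(q)}:=v_q$ ($q\in\mathbb{N}$); this family belongs to $X(\mathcal{H})$, and, with $\varphi$ the function from condition 4) in the definition of $X(\mathcal{H})$, the unique non-negative Borel measure $\mu$ on $\mathbb{R}^2$ satisfying $$\int_{\mathbb{R}^2}x_1^m(x_1+i)^k(x_1-i)^l\,x_2^n(x_2+i)^r(x_2-i)^t\,d\mu=\varphi(m,k,l;n,r,t),\qquad (m,k,l;n,r,t)\in\Omega,$$ belongs to $\Phi$, so that $\sigma_\mu\in\Psi$; and every element of $\Psi$ is obtained in this way.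
   Context: **Conventions.** $\mathbb{N}$ is the set of positive integers, $\mathbb{Z}_+$ the non-negative integers. Hilbert spaces are complex and separable, with scalar product linear in the first argument. A solution of a moment problem is a non-negative Borel measure for which all the integrals exist and have the prescribed values. The two-dimensional moment problem with moments $S=\{s_{m,n}\}$ is: find a non-negative Borel measure $\mu$ on $\mathbb{R}^2$ with $\int_{\mathbb{R}^2}x_1^mx_2^n\,d\mu=s_{m,n}$ for all $m,n\in\mathbb{Z}_+$. **Index sets.** $\Omega=\{(m,k,l;n,r,t):\ m,n\in\mathbb{Z}_+,\ k,l,r,t\in\mathbb{Z}\}$, $\Omega_0=\{(m,k,l;n,r,t)\in\Omega:\ k=l=r=t=0\}$, $\Omega'=\Omega\setminus\Omega_0$. Fix an arbitrary bijection $w:\mathbb{N}\to\Omega'$. **Model space.** For $\{s_{m,n}\}$ satisfying the positivity condition (i), there are a Hilbert space $\mathcal{H}_0$ and a family $\{h_{m,n}\}_{m,n\in\mathbb{Z}_+}$ with closed linear span $\mathcal{H}_0$ such that $(h_{m,n},h_{m',n'})_{\mathcal{H}_0}=s_{m+m',n+n'}$. A model space is $\mathcal{H}=\mathcal{H}_0\oplus\big(\bigoplus_{j=1}^\infty\mathcal{H}_j\big)$ with arbitrary one-dimensional Hilbert spaces $\mathcal{H}_j$; $e_j\in\mathcal{H}_j$ are arbitrary fixed unit vectors. $\{g_n\}_{n\ge1}$ is the orthonormal basis of $\mathcal{H}_0$ obtained by Gram–Schmidt orthogonalization from $\{h_{m,n}\}$ arranged in a single sequence (if $\dim\mathcal{H}_0<\infty$,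 the index $n$ of $g_n$ below runs only over $1,\dots,\dim\mathcal{H}_0$). **The set $X(\mathcal{H})$.** It consists of all families $\{h_{m,k,l;n,r,t}\}_{(m,k,l;n,r,t)\in\Omega}$ in $\mathcal{H}$ such that: 1) $h_{m,0,0;n,0,0}=h_{m,n}$ for $m,n\in\mathbb{Z}_+$; 2) for some $\Lambda\subset\mathbb{N}$, $h_{w(q)}\in\mathcal{H}_0\oplus\big(\bigoplus_{j\in\Lambda,\,j\le q}\mathcal{H}_j\big)$ and $(h_{w(q)},e_q)\ge0$ for all $q\in\mathbb{N}$; 3) for all $(m,k,l;n,r,t)\in\Omega$: $h_{m+1,k,l;n,r,t}+ih_{m,k,l;n,r,t}=h_{m,k+1,l;n,r,t}$, $h_{m+1,k,l;n,r,t}-ih_{m,k,l;n,r,t}=h_{m,k,l+1;n,r,t}$, $h_{m,k,l;n+1,r,t}+ih_{m,k,l;n,r,t}=h_{m,k,l;n,r+1,t}$, $h_{m,k,l;n+1,r,t}-ih_{m,k,l;n,r,t}=h_{m,k,l;n,r,t+1}$; 4) there is a function $\varphi:\Omega\to\mathbb{C}$ with $(h_{m,k,l;n,r,t},h_{m',k',l';n',r',t'})_{\mathcal{H}}=\varphi(m+m',k+l',l+k';n+n',r+t',t+r')$ for all pairs of indices in $\Omega$. **Equations.** For a family $\{h_{m,k,l;n,r,t}\}$ in $\mathcal{H}$ consider, for all indices in $\Omega$: (E1) $(h_{m+1,k,l;n,r,t}+ih_{m,k,l;n,r,t},h_{a,b,c;d,e,f})=(h_{m,k+1,l;n,r,t},h_{a,b,c;d,e,f})$;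 (E2) $(h_{m+1,k,l;n,r,t}-ih_{m,k,l;n,r,t},h_{a,b,c;d,e,f})=(h_{m,k,l+1;n,r,t},h_{a,b,c;d,e,f})$; (E3) $(h_{m,k,l;n+1,r,t}+ih_{m,k,l;n,r,t},h_{a,b,c;d,e,f})=(h_{m,k,l;n,r+1,t},h_{a,b,c;d,e,f})$; (E4) $(h_{m,k,l;n+1,r,t}-ih_{m,k,l;n,r,t},h_{a,b,c;d,e,f})=(h_{m,k,l;n,r,t+1},h_{a,b,c;d,e,f})$; (E5) $(h_{m,k,l;n,r,t},h_{m',k',l';n',r',t'})=(h_{\widetilde m,k,l;n,r,t},h_{\widetilde m',k',l';n',r',t'})$ if $m+m'=\widetilde m+\widetilde m'$; (E6) $(h_{m,k,l;n,r,t},h_{m',k',l';n',r',t'})=(h_{m,\widetilde k,l;n,r,t},h_{m',k',\widetilde l';n',r',t'})$ if $k+l'=\widetilde k+\widetilde l'$; (E7) $(h_{m,k,l;n,r,t},h_{m',k',l';n',r',t'})=(h_{m,k,\widetilde l;n,r,t},h_{m',\widetilde k',l';n',r',t'})$ if $l+k'=\widetilde l+\widetilde k'$; (E8) $(h_{m,k,l;n,r,t},h_{m',k',l';n',r',t'})=(h_{m,k,l;\widetilde n,r,t},h_{m',k',l';\widetilde n',r',t'})$ if $n+n'=\widetilde n+\widetilde n'$; (E9) $(h_{m,k,l;n,r,t},h_{m',k',l';n',r',t'})=(h_{m,k,l;n,\widetilde r,t},h_{m',k',l';n',r',\widetilde t'})$ if $r+t'=\widetilde r+\widetilde t'$; (E10)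 $(h_{m,k,l;n,r,t},h_{m',k',l';n',r',t'})=(h_{m,k,l;n,r,\widetilde t},h_{m',k',l';n',\widetilde r',t'})$ if $t+r'=\widetilde t+\widetilde r'$. **Constants.** For each $j\in\mathbb{N}$, with $w(j)=(m,k,l;n,r,t)$, $M_j=M_j(S)>0$ is a fixed constant depending only on the prescribed moments such that $\int_{\mathbb{R}^2}x_1^{2m}(x_1^2+1)^{k+l}x_2^{2n}(x_2^2+1)^{r+t}\,d\mu\le M_j$ for every solution $\mu$ of the two-dimensional moment problem with moments $S$. **Algorithm.** Step 0: set $h_{m,0,0;n,0,0}=h_{m,n}$, and check those equations (E1)–(E10) that involve only these vectors (if they fail, stop: no solution). Step $q$ ($q\ge1$): seek $h_{w(q)}=\sum_n\alpha_{q;n}g_n+\sum_{j=1}^{q}\beta_{q;j}e_j$ with complex coefficients. Given $(h_{w(1)},\dots,h_{w(q-1)})\in G_{q-1}$ (no such parameters when $q=1$), let $L_q$ be the set of those equations (E1)–(E10) that involve $h_{w(q)}$ and otherwise only the vectors $h_{m,0,0;n,0,0}$ and $h_{w(1)},\dots,h_{w(q-1)}$. Writing $d_q$ for $(h_{w(q)},h_{w(q)})$, the equations in $L_q$ are regarded as equations in the unknowns $\alpha_{q;n}$ (all $n$), $\beta_{q;j}$ ($1\le j\le q-1$) and $d_q$ (the coefficient $\beta_{q;q}$ enters only through $d_q$). Let $S_q$ be the set of all $(\alpha_{q;n},\ \text{all }n;\ \beta_{q;j},\ 1\le j\le q-1;\ d_q;\ h_{w(1)},\dots,h_{w(q-1)})$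 such that $(h_{w(1)},\dots,h_{w(q-1)})\in G_{q-1}$ and the equations $L_q$ with these parameters are satisfied. Let $\widehat S_q$ be the subset of $S_q$ given by $\sum_n|\alpha_{q;n}|^2+\sum_{j=1}^{q-1}|\beta_{q;j}|^2\le d_q$ and $d_q\le M_q$. Let $G_q$ be the set of all tuples $$\Big(h_{w(1)},\dots,h_{w(q-1)},\ \sum_n\alpha_{q;n}g_n+\sum_{j=1}^{q-1}\beta_{q;j}e_j+\Big(d_q-\sum_n|\alpha_{q;n}|^2-\sum_{j=1}^{q-1}|\beta_{q;j}|^2\Big)^{1/2}e_q\Big)$$ with $(\alpha_{q;n};\beta_{q;j};d_q;h_{w(1)},\dots,h_{w(q-1)})\in\widehat S_q$ (possibly $G_q=\emptyset$). Final step: let $\mathbf{H}$ be the space of sequences $\mathbf{h}=(h_1,h_2,\dots)$ in $\mathcal{H}$ with $\|\mathbf{h}\|_{\mathbf{H}}=\sup_{q}M_q^{-1/2}\|h_q\|_{\mathcal{H}}<\infty$. Let $\mathbf{G}_q\subset\mathbf{H}$ be the set of all sequences $(h_1,\dots,h_q,v_{q+1},v_{q+2},\dots)$ with $(h_1,\dots,h_q)\in G_q$ and $v_j\in\mathcal{H}$, $\|v_j\|_{\mathcal{H}}\le\sqrt{M_j}$ for $j>q$ ($\mathbf{G}_q=\emptyset$ if $G_q=\emptyset$). Put $\mathbf{G}=\bigcap_{q=1}^\infty\mathbf{G}_q$. *)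

theory Defs
  imports "HOL-Analysis.Analysis" "HOL-Library.Complex_Order"
begin

text \<open>
  Sequences that are indexed by the positive integers in the mathematical source are indexed by
  \<^typ>\<open>nat\<close> here, with the index shifted by one: \<open>e j\<close>, \<open>w j\<close>, \<open>M j\<close> and the \<open>j\<close>-th entry
  of a sequence of vectors stand for the objects with number \<open>j + 1\<close>. In particular, step
  \<open>q + 1\<close> of the algorithm determines the vector with index \<open>w q\<close> and leads from \<open>G q\<close>
  (tuples of length \<open>q\<close>) to \<open>G (Suc q)\<close>. The numbering of the sets \<open>G q\<close> is not shifted.
  Inequalities between complex numbers are those of \<^theory>\<open>HOL-Library.Complex_Order\<close>:
  \<open>0 \<le> z\<close> says that \<open>z\<close> is real and nonnegative.
\<close>

section \<open>Complex Hilbert spaces\<close>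

text \<open>The scalar product is linear in the first argument. Separability is not part of the class;
  it follows for model spaces, which are closed linear spans of countable sets.\<close>

class complex_hilbert_space = real_inner + complete_space +
  fixes scaleC :: "complex \<Rightarrow> 'a \<Rightarrow> 'a" (infixr "*\<^sub>C" 75)
    and cinner :: "'a \<Rightarrow> 'a \<Rightarrow> complex"
  assumes scaleC_add_right: "c *\<^sub>C (x + y) = c *\<^sub>C x + c *\<^sub>C y"
    and scaleC_add_left: "(c + d) *\<^sub>C x = c *\<^sub>C x + d *\<^sub>C x"
    and scaleC_scaleC: "c *\<^sub>C d *\<^sub>C x = (c * d) *\<^sub>C x"
    and scaleR_scaleC: "r *\<^sub>R x = of_real r *\<^sub>C x"
    and cinner_commute: "cinner x y = cnj (cinner y x)"
    and cinner_add_left: "cinner (x + y) z = cinner x z + cinner y z"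
    and cinner_scaleC_left: "cinner (c *\<^sub>C x) y = c * cinner x y"
    and inner_cinner: "inner x y = Re (cinner x y)"

global_interpretation cvec: vector_space "scaleC :: complex \<Rightarrow> 'a \<Rightarrow> 'a::complex_hilbert_space"
proof
  fix x :: 'a
  have "1 *\<^sub>C x = 1 *\<^sub>R x"
    by (simp only: scaleR_scaleC of_real_1)
  then show "1 *\<^sub>C x = x"
    by simp
qed (simp_all add: scaleC_add_right scaleC_add_left scaleC_scaleC)

abbreviation cspan :: "'a::complex_hilbert_space set \<Rightarrow> 'a set"
  where "cspan \<equiv> cvec.span"

text \<open>Gram-Schmidt orthogonalization of a possibly linearly dependent sequence. Since
  \<^term>\<open>sgn 0 = 0\<close>, \<open>gs x n = 0\<close> exactly when \<open>x n\<close> depends linearly on its predecessors; these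
  entries are discarded afterwards. The resulting basis consists of the vectors \<open>gs_basis x n\<close>
  with \<open>n \<in> gs_index x\<close>, where \<open>gs_index x\<close> is \<^term>\<open>UNIV :: nat set\<close> or \<open>{..<dim}\<close>.\<close>

fun gs :: "(nat \<Rightarrow> 'a::complex_hilbert_space) \<Rightarrow> nat \<Rightarrow> 'a" where
  "gs x n = sgn (x n - (\<Sum>k<n. cinner (x n) (gs x k) *\<^sub>C gs x k))"

declare gs.simps [simp del]

definition gs_basis :: "(nat \<Rightarrow> 'a::complex_hilbert_space) \<Rightarrow> nat \<Rightarrow> 'a" where
  "gs_basis x n = gs x (enumerate {k. gs x k \<noteq> 0} n)"

definition gs_index :: "(nat \<Rightarrow> 'a::complex_hilbert_space) \<Rightarrow> nat set" where
  "gs_index x = {n. finite {k. gs x k \<noteq> 0} \<longrightarrow> n < card {k. gs x k \<noteq> 0}}"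

section \<open>Moment problems\<close>

definition real_solutions :: "(nat \<Rightarrow> nat \<Rightarrow> complex) \<Rightarrow> (real \<times> real) measure set" where
  "real_solutions s = {\<mu>. sets \<mu> = sets borel \<and>
     (\<forall>m n. has_bochner_integral \<mu> (\<lambda>(x1, x2). complex_of_real (x1 ^ m * x2 ^ n)) (s m n))}"

definition complex_solutions :: "(nat \<Rightarrow> nat \<Rightarrow> complex) \<Rightarrow> complex measure set" where
  "complex_solutions a = {\<sigma>. sets \<sigma> = sets borel \<and>
     (\<forall>m n. has_bochner_integral \<sigma> (\<lambda>z. z ^ m * cnj z ^ n) (a m n))}"

definition to_complex_measure :: "(real \<times> real) measure \<Rightarrow> complex measure" where
  "to_complex_measure \<mu> = distr \<mu> borel (\<lambda>(x1, x2). Complex x1 x2)"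

text \<open>The tuple \<open>(m, k, l, n, r, t)\<close> stands for \<open>(m,k,l;n,r,t)\<close>, so that the index set \<open>\<Omega>\<close> is
  the whole type.\<close>

type_synonym index = "nat \<times> int \<times> int \<times> nat \<times> int \<times> int"

definition Omega0 :: "index set" where
  "Omega0 = {(m, k, l, n, r, t). k = 0 \<and> l = 0 \<and> r = 0 \<and> t = 0}"

definition rational_solutions :: "(index \<Rightarrow> complex) \<Rightarrow> (real \<times> real) measure set" where
  "rational_solutions \<phi> = {\<mu>. sets \<mu> = sets borel \<and>
     (\<forall>m k l n r t. has_bochner_integral \<mu>
        (\<lambda>(x1, x2).
           of_real x1 ^ m * (of_real x1 + \<i>) powi k * (of_real x1 - \<i>) powi l *
           (of_real x2 ^ n * (of_real x2 + \<i>) powi r * (of_real x2 - \<i>) powi t))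
        (\<phi> (m, k, l, n, r, t)))}"

definition moment_bounds :: "(nat \<Rightarrow> nat \<Rightarrow> complex) \<Rightarrow> (nat \<Rightarrow> index) \<Rightarrow> (nat \<Rightarrow> real) \<Rightarrow> bool" where
  "moment_bounds s w M \<longleftrightarrow> (\<forall>j. M j > 0 \<and> (\<forall>\<mu>\<in>real_solutions s.
     case w j of (m, k, l, n, r, t) \<Rightarrow>
       (\<integral>\<^sup>+(x1, x2). ennreal (x1 ^ (2 * m) * (x1\<^sup>2 + 1) powi (k + l) *
                          x2 ^ (2 * n) * (x2\<^sup>2 + 1) powi (r + t)) \<partial>\<mu>) \<le> ennreal (M j)))"

section \<open>Model spaces and the set X\<close>

text \<open>The model space is the whole type \<open>'h\<close>, written as an internal orthogonal sum:
  \<open>H\<^sub>0\<close> is the closed linear span of the \<open>h m n\<close>, and \<open>H\<^sub>j\<close> is the line spanned by \<open>e j\<close>.\<close>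

definition model_space ::
  "(nat \<Rightarrow> nat \<Rightarrow> complex) \<Rightarrow> (nat \<Rightarrow> nat \<Rightarrow> 'h::complex_hilbert_space) \<Rightarrow> (nat \<Rightarrow> 'h) \<Rightarrow> bool"
where
  "model_space s h e \<longleftrightarrow>
     (\<forall>m n m' n'. cinner (h m n) (h m' n') = s (m + m') (n + n')) \<and>
     (\<forall>i j. cinner (e i) (e j) = (if i = j then 1 else 0)) \<and>
     (\<forall>m n j. cinner (h m n) (e j) = 0) \<and>
     closure (cspan (range (\<lambda>(m, n). h m n) \<union> range e)) = UNIV"

definition H0 :: "(nat \<Rightarrow> nat \<Rightarrow> 'h::complex_hilbert_space) \<Rightarrow> 'h set" where
  "H0 h = closure (cspan (range (\<lambda>(m, n). h m n)))"

definition gram_function :: "(index \<Rightarrow> 'h::complex_hilbert_space) \<Rightarrow> (index \<Rightarrow> complex) \<Rightarrow> bool"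
where
  "gram_function f \<phi> \<longleftrightarrow> (\<forall>m k l n r t m' k' l' n' r' t'.
     cinner (f (m, k, l, n, r, t)) (f (m', k', l', n', r', t')) =
     \<phi> (m + m', k + l', l + k', n + n', r + t', t + r'))"

definition X_set ::
  "(nat \<Rightarrow> nat \<Rightarrow> 'h::complex_hilbert_space) \<Rightarrow> (nat \<Rightarrow> 'h) \<Rightarrow> (nat \<Rightarrow> index) \<Rightarrow> (index \<Rightarrow> 'h) set"
where
  "X_set h e w = {f.
     (\<forall>m n. f (m, 0, 0, n, 0, 0) = h m n) \<and>
     (\<exists>\<Lambda>. \<forall>q. f (w q) \<in> {x + y | x y. x \<in> H0 h \<and> y \<in> cspan (e ` {j\<in>\<Lambda>. j \<le> q})} \<and>
              0 \<le> cinner (f (w q)) (e q)) \<and>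
     (\<forall>m k l n r t.
        f (m + 1, k, l, n, r, t) + \<i> *\<^sub>C f (m, k, l, n, r, t) = f (m, k + 1, l, n, r, t) \<and>
        f (m + 1, k, l, n, r, t) - \<i> *\<^sub>C f (m, k, l, n, r, t) = f (m, k, l + 1, n, r, t) \<and>
        f (m, k, l, n + 1, r, t) + \<i> *\<^sub>C f (m, k, l, n, r, t) = f (m, k, l, n, r + 1, t) \<and>
        f (m, k, l, n + 1, r, t) - \<i> *\<^sub>C f (m, k, l, n, r, t) = f (m, k, l, n, r, t + 1)) \<and>
     (\<exists>\<phi>. gram_function f \<phi>)}"

text \<open>The family with \<open>h\<^sub>m\<^sub>,\<^sub>0\<^sub>,\<^sub>0\<^sub>;\<^sub>n\<^sub>,\<^sub>0\<^sub>,\<^sub>0 = h m n\<close> whose vector with index \<open>w q\<close> is \<open>v q\<close>.\<close>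

definition family ::
  "(nat \<Rightarrow> nat \<Rightarrow> 'h) \<Rightarrow> (nat \<Rightarrow> index) \<Rightarrow> (nat \<Rightarrow> 'h) \<Rightarrow> index \<Rightarrow> 'h"
where
  "family h w v = (\<lambda>(m, k, l, n, r, t).
     if (m, k, l, n, r, t) \<in> Omega0 then h m n else v (inv w (m, k, l, n, r, t)))"

section \<open>The equations\<close>

text \<open>To speak about the vectors involved in an equation, and to replace one scalar product by an
  unknown, the equations (E1)--(E10) are kept as syntactic objects: a pair of formal linear
  combinations of symbols \<open>(x, y)\<close> standing for the scalar product of the vectors with indices
  \<open>x\<close> and \<open>y\<close>. In (E1)--(E4) the left-hand side is expanded by linearity in the first argument.\<close>

type_synonym ip_expr = "(complex \<times> index \<times> index) list"
type_synonym equation = "ip_expr \<times> ip_expr"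

definition ip_value :: "(index \<Rightarrow> index \<Rightarrow> complex) \<Rightarrow> ip_expr \<Rightarrow> complex" where
  "ip_value p xs = (\<Sum>(c, x, y)\<leftarrow>xs. c * p x y)"

definition eq_holds :: "(index \<Rightarrow> index \<Rightarrow> complex) \<Rightarrow> equation \<Rightarrow> bool" where
  "eq_holds p E \<longleftrightarrow> ip_value p (fst E) = ip_value p (snd E)"

definition involved :: "equation \<Rightarrow> index set" where
  "involved E = (\<Union>(c, x, y)\<in>set (fst E) \<union> set (snd E). {x, y})"

definition ip_eq :: "index \<Rightarrow> index \<Rightarrow> index \<Rightarrow> index \<Rightarrow> equation" where
  "ip_eq x y x' y' = ([(1, x, y)], [(1, x', y')])"

inductive_set equations :: "equation set" where
  E1: "([(1, (m + 1, k, l, n, r, t), y), (\<i>, (m, k, l, n, r, t), y)],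
        [(1, (m, k + 1, l, n, r, t), y)]) \<in> equations"
| E2: "([(1, (m + 1, k, l, n, r, t), y), (-\<i>, (m, k, l, n, r, t), y)],
        [(1, (m, k, l + 1, n, r, t), y)]) \<in> equations"
| E3: "([(1, (m, k, l, n + 1, r, t), y), (\<i>, (m, k, l, n, r, t), y)],
        [(1, (m, k, l, n, r + 1, t), y)]) \<in> equations"
| E4: "([(1, (m, k, l, n + 1, r, t), y), (-\<i>, (m, k, l, n, r, t), y)],
        [(1, (m, k, l, n, r, t + 1), y)]) \<in> equations"
| E5: "m + m' = m1 + m1' \<Longrightarrow>
       ip_eq (m, k, l, n, r, t) (m', k', l', n', r', t')
             (m1, k, l, n, r, t) (m1', k', l', n', r', t') \<in> equations"
| E6: "k + l' = k1 + l1' \<Longrightarrow>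
       ip_eq (m, k, l, n, r, t) (m', k', l', n', r', t')
             (m, k1, l, n, r, t) (m', k', l1', n', r', t') \<in> equations"
| E7: "l + k' = l1 + k1' \<Longrightarrow>
       ip_eq (m, k, l, n, r, t) (m', k', l', n', r', t')
             (m, k, l1, n, r, t) (m', k1', l', n', r', t') \<in> equations"
| E8: "n + n' = n1 + n1' \<Longrightarrow>
       ip_eq (m, k, l, n, r, t) (m', k', l', n', r', t')
             (m, k, l, n1, r, t) (m', k', l', n1', r', t') \<in> equations"
| E9: "r + t' = r1 + t1' \<Longrightarrow>
       ip_eq (m, k, l, n, r, t) (m', k', l', n', r', t')
             (m, k, l, n, r1, t) (m', k', l', n', r', t1') \<in> equations"
| E10: "t + r' = t1 + r1' \<Longrightarrow>
       ip_eq (m, k, l, n, r, t) (m', k', l', n', r', t')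
             (m, k, l, n, r, t1) (m', k', l', n', r1', t') \<in> equations"

section \<open>The algorithm\<close>

definition step_zero_holds :: "(nat \<Rightarrow> nat \<Rightarrow> 'h::complex_hilbert_space) \<Rightarrow> bool" where
  "step_zero_holds h \<longleftrightarrow> (\<forall>E\<in>equations. involved E \<subseteq> Omega0 \<longrightarrow>
     eq_holds (\<lambda>(m, k, l, n, r, t) (m', k', l', n', r', t'). cinner (h m n) (h m' n')) E)"

text \<open>The parameter \<open>u\<close> arranges the vectors \<open>h m n\<close> in a single sequence.\<close>

definition sequence_of ::
  "(nat \<Rightarrow> nat \<Rightarrow> 'h) \<Rightarrow> (nat \<Rightarrow> nat \<times> nat) \<Rightarrow> nat \<Rightarrow> 'h"
where
  "sequence_of h u i = h (fst (u i)) (snd (u i))"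

definition partial_vector ::
  "(nat \<Rightarrow> nat \<Rightarrow> 'h::complex_hilbert_space) \<Rightarrow> (nat \<Rightarrow> 'h) \<Rightarrow> (nat \<Rightarrow> nat \<times> nat) \<Rightarrow> nat \<Rightarrow>
   (nat \<Rightarrow> complex) \<Rightarrow> (nat \<Rightarrow> complex) \<Rightarrow> 'h"
where
  "partial_vector h e u q \<alpha> \<beta> =
     (\<Sum>\<^sub>\<infinity>n\<in>gs_index (sequence_of h u). \<alpha> n *\<^sub>C gs_basis (sequence_of h u) n) +
     (\<Sum>j<q. \<beta> j *\<^sub>C e j)"

definition coeff_sum ::
  "(nat \<Rightarrow> nat \<Rightarrow> 'h::complex_hilbert_space) \<Rightarrow> (nat \<Rightarrow> nat \<times> nat) \<Rightarrow> nat \<Rightarrow>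
   (nat \<Rightarrow> complex) \<Rightarrow> (nat \<Rightarrow> complex) \<Rightarrow> real"
where
  "coeff_sum h u q \<alpha> \<beta> =
     (\<Sum>\<^sub>\<infinity>n\<in>gs_index (sequence_of h u). (cmod (\<alpha> n))\<^sup>2) + (\<Sum>j<q. (cmod (\<beta> j))\<^sup>2)"

text \<open>The scalar products entering the equations for the vector \<open>z\<close> with index \<open>w q\<close>, the
  previous vectors being \<open>hs\<close>: the product of that vector with itself is the unknown \<open>d\<close>. All
  other vectors are orthogonal to \<open>e q\<close>, so their products with the sought vector
  \<open>z + \<beta>\<^sub>q e\<^sub>q\<close> do not depend on \<open>\<beta>\<^sub>q\<close> and are those with \<open>z\<close>.\<close>

definition step_products ::
  "(nat \<Rightarrow> nat \<Rightarrow> 'h::complex_hilbert_space) \<Rightarrow> (nat \<Rightarrow> index) \<Rightarrow> nat \<Rightarrow> 'h list \<Rightarrow> 'h \<Rightarrow> real \<Rightarrow>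
   index \<Rightarrow> index \<Rightarrow> complex"
where
  "step_products h w q hs z d x y =
     (if x = w q \<and> y = w q then of_real d
      else cinner (family h w (\<lambda>p. if p < q then hs ! p else z) x)
                  (family h w (\<lambda>p. if p < q then hs ! p else z) y))"

definition step_equations :: "(nat \<Rightarrow> index) \<Rightarrow> nat \<Rightarrow> equation set" where
  "step_equations w q =
     {E\<in>equations. w q \<in> involved E \<and> involved E \<subseteq> Omega0 \<union> w ` {..q}}"

text \<open>The set \<open>Gp\<close> is the set of tuples produced by the previous step. Coefficient families are
  extensional functions, that is, they carry no information outside their index sets.
  Square-summability makes the series in \<^const>\<open>partial_vector\<close> converge.\<close>

definition S_set ::
  "(nat \<Rightarrow> nat \<Rightarrow> 'h::complex_hilbert_space) \<Rightarrow> (nat \<Rightarrow> 'h) \<Rightarrow> (nat \<Rightarrow> index) \<Rightarrow> (nat \<Rightarrow> nat \<times> nat) \<Rightarrow>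
   nat \<Rightarrow> 'h list set \<Rightarrow> ((nat \<Rightarrow> complex) \<times> (nat \<Rightarrow> complex) \<times> real \<times> 'h list) set"
where
  "S_set h e w u q Gp = {(\<alpha>, \<beta>, d, hs).
     \<alpha> \<in> extensional (gs_index (sequence_of h u)) \<and>
     (\<lambda>n. (cmod (\<alpha> n))\<^sup>2) summable_on gs_index (sequence_of h u) \<and>
     \<beta> \<in> extensional {..<q} \<and>
     hs \<in> Gp \<and>
     (\<forall>E\<in>step_equations w q. eq_holds (step_products h w q hs (partial_vector h e u q \<alpha> \<beta>) d) E)}"

definition S_hat ::
  "(nat \<Rightarrow> nat \<Rightarrow> 'h::complex_hilbert_space) \<Rightarrow> (nat \<Rightarrow> 'h) \<Rightarrow> (nat \<Rightarrow> index) \<Rightarrow> (nat \<Rightarrow> nat \<times> nat) \<Rightarrow>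
   (nat \<Rightarrow> real) \<Rightarrow> nat \<Rightarrow> 'h list set \<Rightarrow>
   ((nat \<Rightarrow> complex) \<times> (nat \<Rightarrow> complex) \<times> real \<times> 'h list) set"
where
  "S_hat h e w u M q Gp =
     {(\<alpha>, \<beta>, d, hs) \<in> S_set h e w u q Gp. coeff_sum h u q \<alpha> \<beta> \<le> d \<and> d \<le> M q}"

primrec G_set ::
  "(nat \<Rightarrow> nat \<Rightarrow> 'h::complex_hilbert_space) \<Rightarrow> (nat \<Rightarrow> 'h) \<Rightarrow> (nat \<Rightarrow> index) \<Rightarrow> (nat \<Rightarrow> nat \<times> nat) \<Rightarrow>
   (nat \<Rightarrow> real) \<Rightarrow> nat \<Rightarrow> 'h list set"
where
  "G_set h e w u M 0 = {[]}"
| "G_set h e w u M (Suc q) =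
     {hs @ [partial_vector h e u q \<alpha> \<beta> +
            complex_of_real (sqrt (d - coeff_sum h u q \<alpha> \<beta>)) *\<^sub>C e q] | \<alpha> \<beta> d hs.
        (\<alpha>, \<beta>, d, hs) \<in> S_hat h e w u M q (G_set h e w u M q)}"

definition bold_H :: "(nat \<Rightarrow> real) \<Rightarrow> (nat \<Rightarrow> 'h::complex_hilbert_space) set" where
  "bold_H M = {v. bdd_above (range (\<lambda>q. norm (v q) / sqrt (M q)))}"

definition bold_Gq ::
  "(nat \<Rightarrow> nat \<Rightarrow> 'h::complex_hilbert_space) \<Rightarrow> (nat \<Rightarrow> 'h) \<Rightarrow> (nat \<Rightarrow> index) \<Rightarrow> (nat \<Rightarrow> nat \<times> nat) \<Rightarrow>
   (nat \<Rightarrow> real) \<Rightarrow> nat \<Rightarrow> (nat \<Rightarrow> 'h) set"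
where
  "bold_Gq h e w u M q =
     {v\<in>bold_H M. map v [0..<q] \<in> G_set h e w u M q \<and> (\<forall>j\<ge>q. norm (v j) \<le> sqrt (M j))}"

definition bold_G ::
  "(nat \<Rightarrow> nat \<Rightarrow> 'h::complex_hilbert_space) \<Rightarrow> (nat \<Rightarrow> 'h) \<Rightarrow> (nat \<Rightarrow> index) \<Rightarrow> (nat \<Rightarrow> nat \<times> nat) \<Rightarrow>
   (nat \<Rightarrow> real) \<Rightarrow> (nat \<Rightarrow> 'h) set"
where
  "bold_G h e w u M = (\<Inter>q\<in>{1..}. bold_Gq h e w u M q)"

end

theory Submission
  imports Defs "HOL-Probability.Helly_Selection" "HOL-Library.Real_Mod"
begin

text \<open>
  The family of a point of \<open>bold_G\<close> solves all the equations, so its Gram matrix has the form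
  \<open>\<phi>(x + y*)\<close> and multiplication by \<open>x1\<close> and \<open>x2\<close> becomes index shifting. The Cayley transforms
  \<open>(x - \<i>) / (x + \<i>)\<close> turn each vector of the family into a positive definite function on
  \<open>\<int> \<times> \<int>\<close>, which Herglotz' theorem represents by a measure on the torus. The measure
  belonging to the base vector \<open>(x1 + \<i>)^K (x2 + \<i>)^J\<close> is, up to an explicit
  density vanishing exactly on \<open>z1 = 1\<close> or \<open>z2 = 1\<close>, the measure of the next such base vector.
  Hence none of these measures charges the points at infinity, and pulling the first of them back to
  the plane gives all rational moments. Conversely, for a solution \<open>\<mu>\<close> the rational functions span a
  subspace of \<open>L2(\<mu>)\<close> that is mapped isometrically and step by step into the model
  space: the component along the earlier vectors is determined, and the remaining distance is the
  coefficient of the new basis vector.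
\<close>

section \<open>Complex Hilbert spaces\<close>

text \<open>Polynomial moments alone need not determine a measure. Negative exponents remedy this:
  among the functions with \<open>m = n = 0\<close>, \<open>l = - k\<close>, \<open>t = - r\<close>
  are all products of powers of the two Cayley transforms, and the integrals of these bounded
  functions fix a finite measure. Herglotz' theorem asks only for a positive definite Gram matrix,
  so commuting self-adjoint extensions of the two multiplications never enter. Each base vector gets
  its own measure from a compactness argument; only uniqueness on the torus makes these measures
  comparable. Many base vectors are needed because the one with exponents \<open>K\<close>,
  \<open>J\<close> reaches just the functions with \<open>k + l = 2 * K\<close> and
  \<open>r + t = 2 * J\<close>; all other exponents follow by descent from (x + i) - (x - i) = 2i.
  In the converse direction no projection is formed in L2 itself: the Gram-Schmidt vectors are
  finite combinations of earlier vectors, so they correspond to explicit functions, and the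
  projection is carried over coefficient by coefficient.\<close>

lemma cinner_scaleC_right: "cinner x (c *\<^sub>C y) = cnj c * cinner x (y::'a::complex_hilbert_space)"
  by (metis cinner_commute cinner_scaleC_left complex_cnj_mult)

lemma cinner_add_right: "cinner x (y + z) = cinner x y + cinner x (z::'a::complex_hilbert_space)"
  by (metis cinner_commute cinner_add_left complex_cnj_add)

lemma scaleC_zero_left [simp]: "0 *\<^sub>C x = (0::'a::complex_hilbert_space)"
  by (rule cvec.scale_zero_left)

lemma scaleC_zero_right [simp]: "c *\<^sub>C (0::'a::complex_hilbert_space) = 0"
  by (rule cvec.scale_zero_right)

lemma scaleC_one [simp]: "1 *\<^sub>C x = (x::'a::complex_hilbert_space)"
  by (rule cvec.scale_one)

lemma cinner_zero_left [simp]: "cinner 0 (y::'a::complex_hilbert_space) = 0"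
  using cinner_scaleC_left[of 0 0 y] by simp

lemma cinner_zero_right [simp]: "cinner (x::'a::complex_hilbert_space) 0 = 0"
  using cinner_scaleC_right[of x 0 0] by simp

lemma cinner_minus_left: "cinner (- x) (y::'a::complex_hilbert_space) = - cinner x y"
  using cinner_add_left[of "-x" x y] by (simp add: eq_neg_iff_add_eq_0)

lemma cinner_diff_left: "cinner (x - z) (y::'a::complex_hilbert_space) = cinner x y - cinner z y"
  using cinner_add_left[of x "-z" y] by (simp add: cinner_minus_left)

lemma cinner_sum_left: "cinner (\<Sum>i\<in>A. f i) (y::'a::complex_hilbert_space) = (\<Sum>i\<in>A. cinner (f i) y)"
  by (induction A rule: infinite_finite_induct) (auto simp: cinner_add_left)

lemma cinner_sum_right: "cinner y (\<Sum>i\<in>A. f i :: 'a::complex_hilbert_space) = (\<Sum>i\<in>A. cinner y (f i))"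
  by (induction A rule: infinite_finite_induct) (auto simp: cinner_add_right)

lemma cinner_self: "cinner x x = of_real ((norm (x::'a::complex_hilbert_space))\<^sup>2)"
proof (rule complex_eqI)
  show "Re (cinner x x) = Re (of_real ((norm x)\<^sup>2))"
    by (simp add: inner_cinner [symmetric] dot_square_norm)
  show "Im (cinner x x) = Im (of_real ((norm x)\<^sup>2))"
    using arg_cong[OF cinner_commute[of x x], of Im] by simp
qed

lemma cinner_self_eq_0 [simp]: "cinner x x = 0 \<longleftrightarrow> x = (0::'a::complex_hilbert_space)"
  by (simp add: cinner_self)

text \<open>The class links the norm to \<open>cinner\<close> only through real parts, so
  homogeneity for complex scalars is read off from \<open>cinner_self\<close>.\<close>

lemma norm_scaleC: "norm (c *\<^sub>C x) = cmod c * norm (x::'a::complex_hilbert_space)"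
proof -
  have "complex_of_real ((norm (c *\<^sub>C x))\<^sup>2) = (c * cnj c) * of_real ((norm x)\<^sup>2)"
    unfolding cinner_self [symmetric] by (simp add: cinner_scaleC_left cinner_scaleC_right)
  then have "complex_of_real ((norm (c *\<^sub>C x))\<^sup>2) = of_real ((cmod c * norm x)\<^sup>2)"
    unfolding complex_norm_square [symmetric] by (simp add: power_mult_distrib)
  then have "(norm (c *\<^sub>C x))\<^sup>2 = (cmod c * norm x)\<^sup>2"
    by (simp only: of_real_eq_iff)
  then show ?thesis
    by (simp add: power2_eq_iff_nonneg)
qed

text \<open>Rotating \<open>x\<close> by a unimodular \<open>c\<close> makes the product real and
  nonnegative, which leaves the real Cauchy-Schwarz inequality.\<close>

lemma cmod_cinner_le: "cmod (cinner x y) \<le> norm x * norm (y::'a::complex_hilbert_space)"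
proof (cases "cinner x y = 0")
  case False
  define c where "c = cnj (cinner x y) / cmod (cinner x y)"
  have c: "cmod c = 1"
    using False by (simp add: c_def norm_divide)
  have "cnj (cinner x y) * cinner x y = of_real (cmod (cinner x y)) * of_real (cmod (cinner x y))"
    using complex_norm_square[of "cinner x y"] by (simp add: power2_eq_square mult.commute)
  then have "cinner (c *\<^sub>C x) y = of_real (cmod (cinner x y))"
    using False by (simp add: c_def cinner_scaleC_left)
  then have "cmod (cinner x y) = inner (c *\<^sub>C x) y"
    by (simp add: inner_cinner)
  also have "\<dots> \<le> norm (c *\<^sub>C x) * norm y"
    by (rule norm_cauchy_schwarz)
  finally show ?thesis by (simp add: norm_scaleC c)
qed simp

lemma bounded_linear_cinner_left: "bounded_linear (\<lambda>x. cinner x (y::'a::complex_hilbert_space))"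
proof (rule bounded_linear_intro)
  show "cinner (r *\<^sub>R x) y = r *\<^sub>R cinner x y" for r x
    by (simp add: scaleR_scaleC cinner_scaleC_left scaleR_conv_of_real)
  show "norm (cinner x y) \<le> norm x * norm y" for x
    by (rule cmod_cinner_le)
qed (simp add: cinner_add_left)

text \<open>Conjugate-linearity is still real linearity, which is all that
  \<open>bounded_linear\<close> asks.\<close>

lemma bounded_linear_cinner_right: "bounded_linear (\<lambda>y. cinner (x::'a::complex_hilbert_space) y)"
proof (rule bounded_linear_intro)
  show "cinner x (r *\<^sub>R y) = r *\<^sub>R cinner x y" for r y
    by (simp add: scaleR_scaleC cinner_scaleC_right scaleR_conv_of_real)
  show "norm (cinner x y) \<le> norm y * norm x" for y
    using cmod_cinner_le[of x y] by (simp add: mult.commute)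
qed (simp_all add: cinner_add_right)

lemma bounded_linear_scaleC: "bounded_linear (\<lambda>x. c *\<^sub>C (x::'a::complex_hilbert_space))"
  by (rule bounded_linear_intro[of _ "cmod c"])
    (simp_all add: scaleC_add_right scaleR_scaleC scaleC_scaleC norm_scaleC mult.commute)

section \<open>A space-filling curve on the torus\<close>

text \<open>Schoenberg's curve maps \<open>[0, 1]\<close> continuously onto the unit square: at a ternary
  number with digits \<open>2 c j\<close> the function \<open>bump (3 ^ k * t)\<close> reads off the digit \<open>c k\<close>. Measures
  on the torus lift along it to measures on the line, where Helly's selection theorem is available.\<close>

definition bump :: "real \<Rightarrow> real" where
  "bump t = max 0 (min 1 (3 * arccos (cos (pi * t)) / pi - 1))"

lemma continuous_on_bump [continuous_intros]:
  fixes f :: "'a::t2_space \<Rightarrow> real"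
  shows "continuous_on A f \<Longrightarrow> continuous_on A (\<lambda>x. bump (f x))"
  unfolding bump_def by (intro continuous_intros) auto

lemma bump_nonneg: "0 \<le> bump t" and bump_le_1: "bump t \<le> 1"
  by (auto simp: bump_def)

text \<open>\<open>arccos (cos (pi * t)) / pi\<close> is the distance from \<open>t\<close> to the
  nearest even integer, and \<open>bump\<close> depends on nothing else. It is a trapezoidal wave of
  period 2.\<close>

lemma bump_plus_even: "bump (2 * of_int k + t) = bump t"
proof -
  have "pi * (2 * of_int k + t) = pi * t + of_int k * (2 * pi)"
    by (simp add: algebra_simps)
  then show ?thesis
    unfolding bump_def
    using cos_int_2pin[of k] sin_int_2pin[of k] by (simp add: cos_add mult.commute)
qed

lemma bump_unit_interval:
  assumes "0 \<le> t" "t \<le> 1"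
  shows "bump t = max 0 (min 1 (3 * t - 1))"
proof -
  have "arccos (cos (pi * t)) = pi * t"
    using assms by (intro arccos_cos) (auto simp: mult_le_cancel_left1)
  then show ?thesis by (simp add: bump_def)
qed

definition ternary :: "(nat \<Rightarrow> nat) \<Rightarrow> real" where
  "ternary c = (\<Sum>j. 2 * c j / 3 ^ Suc j)"

lemma ternary_summable:
  assumes "\<And>j. c j \<le> 1"
  shows "summable (\<lambda>j. 2 * real (c j) / 3 ^ Suc j)"
proof (rule summable_comparison_test')
  show "summable (\<lambda>j. 2/3 * (1/3) ^ j :: real)"
    by (intro summable_mult summable_geometric) auto
  show "norm (2 * real (c n) / 3 ^ Suc n) \<le> 2/3 * (1/3) ^ n" for n
    using assms[of n] by (auto simp: field_simps power_divide)
qed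

lemma ternary_Suc:
  assumes "\<And>j. c j \<le> 1"
  shows "ternary c = 2 * c 0 / 3 + ternary (\<lambda>j. c (Suc j)) / 3"
  using suminf_split_head[OF ternary_summable[of c, OF assms]]
    suminf_divide[OF ternary_summable[of "\<lambda>j. c (Suc j)"], of 3] assms
  by (simp add: ternary_def)

lemma ternary_bounds:
  assumes "\<And>j. c j \<le> 1"
  shows "0 \<le> ternary c" "ternary c \<le> 1"
proof -
  show "0 \<le> ternary c"
    unfolding ternary_def by (intro suminf_nonneg ternary_summable assms) auto
  have "ternary c \<le> (\<Sum>j. 2/3 * (1/3) ^ j)"
    unfolding ternary_def
  proof (intro suminf_le ternary_summable assms summable_mult summable_geometric)
    show "2 * real (c n) / 3 ^ Suc n \<le> 2/3 * (1/3) ^ n" for n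
      using assms[of n] by (auto simp: field_simps power_divide)
  qed auto
  also have "\<dots> = 1"
    by (subst suminf_mult) (auto simp: suminf_geometric intro!: summable_geometric)
  finally show "ternary c \<le> 1" .
qed

text \<open>A leading digit 0 puts \<open>ternary c\<close> into [0, 1/3], where \<open>bump\<close>
  is 0, a leading digit 2 into [2/3, 1], where it is 1. Multiplication by 3 shifts the
  digits.\<close>

lemma bump_ternary:
  assumes "\<And>j. c j \<le> 1"
  shows "bump (3 ^ k * ternary c) = c k"
  using assms
proof (induction k arbitrary: c)
  case 0
  have "c 0 = 0 \<or> c 0 = 1"
    using 0[of 0] by auto
  then show ?case
    using ternary_bounds[of c, OF 0] ternary_bounds[of "\<lambda>j. c (Suc j)", OF 0]
      ternary_Suc[of c, OF 0]
    by (auto simp: bump_unit_interval max_def min_def)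
next
  case (Suc k)
  \<comment> \<open>The digit shifted in front of the ternary point contributes an even integer,
    which the period absorbs.\<close>
  have "3 ^ Suc k * ternary c = 2 * of_int (int (c 0 * 3 ^ k)) + 3 ^ k * ternary (\<lambda>j. c (Suc j))"
    by (subst ternary_Suc[of c, OF Suc.prems]) (simp add: field_simps)
  then have "bump (3 ^ Suc k * ternary c) = bump (3 ^ k * ternary (\<lambda>j. c (Suc j)))"
    by (simp only: bump_plus_even)
  also have "\<dots> = c (Suc k)"
    by (rule Suc.IH) (rule Suc.prems)
  finally show ?case .
qed

text \<open>The digits are the increments \<open>F (Suc n) - 2 * F n\<close> of the truncations
  \<open>F n / 2 ^ n\<close>, so the series telescopes; \<open>x < 1\<close> gives
  \<open>F 0 = 0\<close>.\<close>

lemma binary_expansion: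
  fixes x :: real
  assumes "0 \<le> x" "x < 1"
  obtains c :: "nat \<Rightarrow> nat" where "\<And>j. c j \<le> 1" "(\<lambda>j. c j / 2 ^ Suc j) sums x"
proof -
  define F where "F n = \<lfloor>2 ^ n * x\<rfloor>" for n :: nat
  have F2: "F (Suc n) = 2 * F n \<or> F (Suc n) = 2 * F n + 1" for n
  proof -
    have "of_int (F n) \<le> 2 ^ n * x" "2 ^ n * x < of_int (F n) + 1"
      by (auto simp: F_def)
    then have "of_int (2 * F n) \<le> 2 ^ Suc n * x" "2 ^ Suc n * x < of_int (2 * F n + 2)"
      by auto
    then have "2 * F n \<le> F (Suc n)" "F (Suc n) < 2 * F n + 2"
      unfolding F_def by linarith+
    then show ?thesis by linarith
  qed
  define c where "c n = nat (F (Suc n) - 2 * F n)" for n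
  have 1: "c n \<le> 1" for n
    using F2[of n] by (auto simp: c_def)
  have lim: "(\<lambda>n. of_int (F n) / 2 ^ n) \<longlonglongrightarrow> x"
  proof (rule tendsto_sandwich)
    have "x - (1/2) ^ n \<le> of_int (F n) / 2 ^ n" for n
    proof -
      have "2 ^ n * x - 1 \<le> of_int (F n)"
        by (simp add: F_def)
      then have "(2 ^ n * x - 1) / 2 ^ n \<le> of_int (F n) / 2 ^ n"
        by (intro divide_right_mono) auto
      then show ?thesis by (simp add: diff_divide_distrib power_divide)
    qed
    then show "eventually (\<lambda>n. x - (1/2) ^ n \<le> of_int (F n) / 2 ^ n) sequentially"
      by simp
    have "of_int (F n) / 2 ^ n \<le> x" for n
      by (simp add: F_def field_simps)
    then show "eventually (\<lambda>n. of_int (F n) / 2 ^ n \<le> x) sequentially"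
      by simp
    have "(\<lambda>n. x - (1/2) ^ n) \<longlonglongrightarrow> x - 0"
      by (intro tendsto_diff tendsto_const LIMSEQ_power_zero) auto
    then show "(\<lambda>n. x - (1/2) ^ n) \<longlonglongrightarrow> x" by simp
  qed auto
  have "(\<lambda>n. of_int (F (Suc n)) / 2 ^ Suc n - of_int (F n) / 2 ^ n) sums (x - of_int (F 0) / 2 ^ 0)"
    by (rule telescope_sums[OF lim])
  moreover have "of_int (F (Suc n)) / 2 ^ Suc n - of_int (F n) / 2 ^ n = c n / 2 ^ Suc n" for n
    using F2[of n] by (auto simp: c_def field_simps)
  moreover have "F 0 = 0"
    using assms by (auto simp: F_def floor_eq_iff)
  ultimately have "(\<lambda>n. c n / 2 ^ Suc n) sums x"
    by simp
  with 1 that show ?thesis by blast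
qed

definition schoenberg :: "nat \<Rightarrow> real \<Rightarrow> real" where
  "schoenberg i t = (\<Sum>k. bump (3 ^ (2 * k + i) * t) / 2 ^ Suc k)"

lemma continuous_on_schoenberg: "continuous_on UNIV (schoenberg i)"
proof -
  have "uniform_limit UNIV (\<lambda>n t. \<Sum>k<n. bump (3 ^ (2 * k + i) * t) / 2 ^ Suc k)
          (\<lambda>t. \<Sum>k. bump (3 ^ (2 * k + i) * t) / 2 ^ Suc k) sequentially"
  proof (rule Weierstrass_m_test)
    show "norm (bump (3 ^ (2 * k + i) * t) / 2 ^ Suc k) \<le> (1/2) ^ Suc k" for k t
      using bump_nonneg[of "3 ^ (2 * k + i) * t"] bump_le_1[of "3 ^ (2 * k + i) * t"]
      by (simp add: field_simps power_divide)
    show "summable (\<lambda>k. (1/2) ^ Suc k :: real)"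
      by (subst summable_Suc_iff) (auto intro!: summable_geometric)
  qed
  then have "continuous_on UNIV (\<lambda>t. \<Sum>k. bump (3 ^ (2 * k + i) * t) / 2 ^ Suc k)"
    by (rule uniform_limit_theorem[rotated])
      (auto intro!: always_eventually continuous_intros)
  then show ?thesis
    by (simp add: schoenberg_def [abs_def])
qed

text \<open>The binary digits of \<open>x\<close> and \<open>y\<close> are interleaved into one
  ternary number; coordinate 0 reads the even places, coordinate 1 the odd ones.\<close>

lemma schoenberg_surj:
  assumes "0 \<le> x" "x < 1" "0 \<le> y" "y < 1"
  obtains t where "0 \<le> t" "t \<le> 1" "schoenberg 0 t = x" "schoenberg 1 t = y"
proof -
  obtain a where a: "\<And>j. a j \<le> (1::nat)" "(\<lambda>j. a j / 2 ^ Suc j) sums x"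
    using binary_expansion assms(1,2) by blast
  obtain b where b: "\<And>j. b j \<le> (1::nat)" "(\<lambda>j. b j / 2 ^ Suc j) sums y"
    using binary_expansion assms(3,4) by blast
  define c where "c j = (if even j then a (j div 2) else b (j div 2))" for j :: nat
  have c: "c j \<le> 1" for j
    using a(1) b(1) by (auto simp: c_def)
  have "schoenberg 0 (ternary c) = x"
    using a(2) unfolding schoenberg_def by (simp add: bump_ternary[OF c] c_def sums_iff)
  moreover have "schoenberg 1 (ternary c) = y"
  proof -
    have "c (2 * k + 1) = b k" for k
      by (simp add: c_def)
    then show ?thesis
      using b(2) unfolding schoenberg_def bump_ternary[OF c] by (simp only: sums_iff)
  qed
  ultimately show ?thesis
    using that ternary_bounds[of c, OF c] by blast
qed

definition torus_curve :: "real \<Rightarrow> complex \<times> complex" where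
  "torus_curve t = (cis (2 * pi * schoenberg 0 t), cis (2 * pi * schoenberg 1 t))"

lemma continuous_on_torus_curve: "continuous_on UNIV torus_curve"
proof -
  have *: "continuous_on UNIV (\<lambda>t. schoenberg i t)" for i
    using continuous_on_schoenberg[of i] by simp
  show ?thesis
    unfolding torus_curve_def [abs_def] cis_conv_exp by (intro continuous_intros *)
qed

lemma sum_roots_of_unity:
  fixes n :: int
  assumes "\<bar>n\<bar> < int L"
  shows "(\<Sum>j<L. cis (2 * pi * real j / real L) powi n) = (if n = 0 then of_nat L else 0)"
proof (cases "n = 0")
  case False
  have L: "L > 0"
    using assms by auto
  define z where "z = cis (2 * pi * n / L)"
  have "z \<noteq> 1"
  proof
    assume "z = 1"
    then obtain k :: int where "2 * pi * n / L = of_int k * (2 * pi)"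
      unfolding z_def cis_eq_1_iff by blast
    then have "real_of_int n = of_int (k * int L)"
      using L by (simp add: field_simps)
    then have "n = k * int L"
      by (simp only: of_int_eq_iff)
    then have "k = 0"
      using assms L by (auto simp: abs_mult)
    then show False
      using False \<open>n = k * int L\<close> by simp
  qed
  have "cis (2 * pi * real j / real L) powi n = z ^ j" for j
    by (simp add: z_def cis_power_int Complex.DeMoivre field_simps)
  then have "(\<Sum>j<L. cis (2 * pi * real j / real L) powi n) = (\<Sum>j<L. z ^ j)"
    by simp
  also have "\<dots> = (z ^ L - 1) / (z - 1)"
    using \<open>z \<noteq> 1\<close> by (rule geometric_sum)
  also have "z ^ L = 1"
    using L by (simp add: z_def Complex.DeMoivre)
  finally show ?thesis
    using False by simp
qed simp

lemma torus_curve_surj: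
  assumes "0 \<le> x" "x < 1" "0 \<le> y" "y < 1"
  obtains t where "0 \<le> t" "t \<le> 1" "torus_curve t = (cis (2 * pi * x), cis (2 * pi * y))"
  using schoenberg_surj[OF assms] by (metis torus_curve_def)

text \<open>Counting the pairs with \<open>p - p' = a\<close> gives the triangular Fejer weights;
  truncated subtraction covers the case that the modulus of \<open>a\<close> exceeds
  \<open>N\<close>.\<close>

lemma sum_fejer:
  fixes a :: int and N :: nat
  shows "(\<Sum>p<N. \<Sum>p'<N. if a - int p + int p' = 0 then 1 else 0 :: complex) = of_nat (N - nat \<bar>a\<bar>)"
proof -
  have "(\<Sum>p<N. \<Sum>p'<N. if a - int p + int p' = 0 then 1 else 0 :: complex)
      = (\<Sum>p<N. if 0 \<le> int p - a \<and> int p - a < int N then 1 else 0)"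
  proof (intro sum.cong refl)
    fix p :: nat
    have "(\<Sum>p'<N. if a - int p + int p' = 0 then 1 else 0 :: complex)
        = (\<Sum>p'<N. if p' = nat (int p - a) then (if 0 \<le> int p - a then 1 else 0) else 0)"
      by (intro sum.cong) auto
    then show "(\<Sum>p'<N. if a - int p + int p' = 0 then 1 else 0 :: complex)
        = (if 0 \<le> int p - a \<and> int p - a < int N then 1 else 0)"
      by (auto simp: nat_less_iff)
  qed
  also have "\<dots> = of_nat (card {p\<in>{..<N}. 0 \<le> int p - a \<and> int p - a < int N})"
    by (subst sum.If_cases) (auto simp: Int_def)
  also have "{p\<in>{..<N}. 0 \<le> int p - a \<and> int p - a < int N} =
      {nat (max 0 a) ..< nat (int N + min 0 a)}"
    by auto
  also have "card \<dots> = N - nat \<bar>a\<bar>"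
    by (auto simp: max_def min_def)
  finally show ?thesis .
qed

section \<open>Herglotz' theorem on the torus\<close>

lemma borel_measurable_power_int [measurable (raw)]:
  fixes f :: "'a \<Rightarrow> complex"
  assumes [measurable]: "f \<in> borel_measurable M"
  shows "(\<lambda>x. f x powi n) \<in> borel_measurable M"
  unfolding power_int_def by measurable

lemma fst_borel_measurable [measurable]:
  "(fst :: 'a::topological_space \<times> 'b::topological_space \<Rightarrow> 'a) \<in> borel_measurable borel"
  by (intro borel_measurable_continuous_onI continuous_intros)

lemma snd_borel_measurable [measurable]:
  "(snd :: 'a::topological_space \<times> 'b::topological_space \<Rightarrow> 'b) \<in> borel_measurable borel"
  by (intro borel_measurable_continuous_onI continuous_intros)

lemma sum_grid:
  fixes f :: "'a \<Rightarrow> complex"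
  shows "(\<Sum>(j, k)\<in>A \<times> B. x * (f j * g k)) = x * (sum f A * sum g B)"
  unfolding sum_product sum.cartesian_product by (simp add: sum_distrib_left case_prod_unfold)

text \<open>The squared norms \<open>W\<close> are Fejer means of \<open>c\<close>, sampled at the roots of unity of order \<open>2 N\<close>;
  this order is large enough for the discrete orthogonality relations to be exact.\<close>

lemma fejer_grid:
  fixes U :: "int \<Rightarrow> int \<Rightarrow> 'h::complex_hilbert_space" and c :: "int \<Rightarrow> int \<Rightarrow> complex"
  assumes U: "\<And>p q p' q'. cinner (U p q) (U p' q') = c (p - p') (q - q')"
    and L: "L = 2 * N"
    and W: "W = (\<lambda>(j, k). (norm (\<Sum>(p, q)\<in>{..<N} \<times> {..<N}.
        (cis (2 * pi * real j / real L) powi (- int p) * cis (2 * pi *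
            real k / real L) powi (- int q)) *\<^sub>C U (int p) (int q)))\<^sup>2)"
    and a: "\<bar>a\<bar> \<le> int N" and b: "\<bar>b\<bar> \<le> int N"
  shows "(\<Sum>(j, k)\<in>{..<L} \<times> {..<L}. of_real (W (j, k)) *
      (cis (2 * pi * real j / real L) powi a * cis (2 * pi * real k / real L) powi b)) =
     of_nat L ^ 2 * (of_nat (N - nat \<bar>a\<bar>) * of_nat (N - nat \<bar>b\<bar>)) * c a b"
proof -
  define z where "z j = cis (2 * pi * real j / real L)" for j :: nat
  have z0: "z j \<noteq> 0" for j
    by (simp add: z_def)
  have cz: "cnj (z j powi n) = z j powi (- n)" for j n
    by (simp add: z_def cis_power_int cis_cnj)
  have zs: "(\<Sum>j<L. z j powi n) = (if n = 0 then of_nat L else 0)" if "\<bar>n\<bar> < int L" for n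
    unfolding z_def using that by (rule sum_roots_of_unity)
  have Wexp: "of_real (W (j, k)) = (\<Sum>(p, q)\<in>{..<N} \<times> {..<N}. \<Sum>(p', q')\<in>{..<N} \<times> {..<N}.
      z j powi (int p' - int p) * z k powi (int q' - int q) * c (int p - int p') (int q - int q'))"
    for j k
  proof -
    have "of_real (W (j, k)) = (\<Sum>x\<in>{..<N} \<times> {..<N}. \<Sum>y\<in>{..<N} \<times> {..<N}.
      cinner ((z j powi (- int (fst x)) * z k powi (- int (snd x))) *\<^sub>C U (int (fst x))
          (int (snd x)))
        ((z j powi (- int (fst y)) * z k powi (- int (snd y))) *\<^sub>C U (int (fst y)) (int (snd y))))"
      unfolding W case_prod_conv cinner_self [symmetric] z_def [symmetric] case_prod_unfold
      by (subst cinner_sum_left, subst cinner_sum_right) (simp only: fst_conv snd_conv)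
    also have "\<dots> = (\<Sum>x\<in>{..<N} \<times> {..<N}. \<Sum>y\<in>{..<N} \<times> {..<N}.
      z j powi (int (fst y) - int (fst x)) * z k powi (int (snd y) - int (snd x)) *
      c (int (fst x) - int (fst y)) (int (snd x) - int (snd y)))"
    proof (intro sum.cong refl)
      fix x y :: "nat \<times> nat"
      show "cinner ((z j powi (- int (fst x)) * z k powi (- int (snd x))) *\<^sub>C U (int (fst x))
          (int (snd x)))
        ((z j powi (- int (fst y)) * z k powi (- int (snd y))) *\<^sub>C U (int (fst y)) (int (snd y))) =
        z j powi (int (fst y) - int (fst x)) * z k powi (int (snd y) - int (snd x)) *
        c (int (fst x) - int (fst y)) (int (snd x) - int (snd y))"
        unfolding cinner_scaleC_left cinner_scaleC_right U complex_cnj_mult cz minus_minus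
        using power_int_add[OF disjI1, OF z0, of j "int (fst y)" "- int (fst x)"]
          power_int_add[OF disjI1, OF z0, of k "int (snd y)" "- int (snd x)"]
        by (simp only: diff_conv_add_uminus mult_ac)
    qed
    finally show ?thesis
      by (simp only: case_prod_unfold)
  qed
  have "(\<Sum>(j, k)\<in>{..<L} \<times> {..<L}. of_real (W (j, k)) * (z j powi a * z k powi b))
     = (\<Sum>(j, k)\<in>{..<L} \<times> {..<L}. \<Sum>(p, q)\<in>{..<N} \<times> {..<N}. \<Sum>(p', q')\<in>{..<N} \<times> {..<N}.
         c (int p - int p') (int q - int q') * (z j powi (a - int p + int p') *
             z k powi (b - int q + int q')))"
    unfolding Wexp
    by (simp add: case_prod_unfold sum_distrib_left sum_distrib_right power_int_diff power_int_add
        z0 field_simps)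
  also have "\<dots> = (\<Sum>(p, q)\<in>{..<N} \<times> {..<N}. \<Sum>(p', q')\<in>{..<N} \<times> {..<N}. \<Sum>(j, k)\<in>{..<L} \<times> {..<L}.
         c (int p - int p') (int q - int q') * (z j powi (a - int p + int p') *
             z k powi (b - int q + int q')))"
    unfolding case_prod_unfold
    by (subst sum.swap) (intro sum.cong refl sum.swap)
  also have "\<dots> = (\<Sum>(p, q)\<in>{..<N} \<times> {..<N}. \<Sum>(p', q')\<in>{..<N} \<times> {..<N}.
         c a b * of_nat L ^ 2 * ((if a - int p + int p' = 0 then 1 else 0) * (if b - int q +
             int q' = 0 then 1 else 0)))"
  proof -
    have "(\<Sum>(j, k)\<in>{..<L} \<times> {..<L}.
         c (int p - int p') (int q - int q') * (z j powi (a - int p + int p') *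
             z k powi (b - int q + int q')))
      = c a b * of_nat L ^ 2 * ((if a - int p + int p' = 0 then 1 else 0) * (if b - int q +
          int q' = 0 then 1 else 0))"
      if "p < N" "q < N" "p' < N" "q' < N" for p q p' q'
    proof -
      have "(\<Sum>(j, k)\<in>{..<L} \<times> {..<L}.
         c (int p - int p') (int q - int q') * (z j powi (a - int p + int p') *
             z k powi (b - int q + int q')))
        = c (int p - int p') (int q - int q') * ((\<Sum>j<L. z j powi (a - int p + int p')) *
            (\<Sum>k<L. z k powi (b - int q + int q')))"
        by (rule sum_grid)
      \<comment> \<open>The exponent has modulus at most \<open>N + (N - 1)\<close>, which is less
        than \<open>L\<close>.\<close>
      also have "(\<Sum>j<L. z j powi (a - int p + int p')) = (if a - int p + int p' =
          0 then of_nat L else 0)"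
        using that a L by (intro zs) auto
      also have "(\<Sum>k<L. z k powi (b - int q + int q')) = (if b - int q + int q' =
          0 then of_nat L else 0)"
        using that b L by (intro zs) auto
      finally show ?thesis
        by (cases "int p - int p' = a"; cases "int q - int q' = b") (auto simp: power2_eq_square)
    qed
    note * = this
    show ?thesis
      by (rule sum.cong[OF refl], clarify, rule sum.cong[OF refl], clarify, rule *) simp_all
  qed
  also have "\<dots> = c a b * of_nat L ^ 2 * ((\<Sum>p<N. \<Sum>p'<N. if a - int p + int p' = 0 then 1 else 0) *
      (\<Sum>q<N. \<Sum>q'<N. if b - int q + int q' = 0 then 1 else 0))"
    by (simp only: sum_grid)
  finally show ?thesis
    unfolding sum_fejer z_def by (simp add: mult_ac)
qed

text \<open>Fejer means of \<open>c\<close> are nonnegative, so on ever finer grids they define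
  probability measures whose Fourier coefficients tend to \<open>c a b / \<kappa>\<close>. Lifted
  along the curve into [0, 1] they are tight, and a weak limit is pushed forward to the torus.
  Division by \<open>\<kappa>\<close> makes them probability measures; the constant density at the
  end undoes it.\<close>

theorem herglotz_torus:
  fixes U :: "int \<Rightarrow> int \<Rightarrow> 'h::complex_hilbert_space" and c :: "int \<Rightarrow> int \<Rightarrow> complex"
  assumes U: "\<And>p q p' q'. cinner (U p q) (U p' q') = c (p - p') (q - q')"
  obtains \<nu> :: "(complex \<times> complex) measure" where "sets \<nu> = sets borel"
    "AE z in \<nu>. cmod (fst z) = 1 \<and> cmod (snd z) = 1"
    "\<And>a b. has_bochner_integral \<nu> (\<lambda>z. fst z powi a * snd z powi b) (c a b)"
proof (cases "U 0 0 = 0")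
  case True
  then have "c a b = 0" for a b
    using U[of a b 0 0] by simp
  moreover have "(\<lambda>z::complex \<times> complex. fst z powi a *
      snd z powi b) \<in> borel_measurable borel" for a b
    by measurable
  ultimately have "has_bochner_integral (null_measure borel)
      (\<lambda>z::complex \<times> complex. fst z powi a * snd z powi b) (c a b)" for a b
    by simp
  moreover have "AE z in null_measure borel. cmod (fst z) = 1 \<and> cmod (snd z) = 1"
    by (rule AE_I'[of UNIV]) (auto simp: null_sets_def)
  ultimately show ?thesis
    by (intro that[of "null_measure borel"]) auto
next
  case False
  define \<kappa> where "\<kappa> = (norm (U 0 0))\<^sup>2"
  have \<kappa>: "\<kappa> > 0" "c 0 0 = of_real \<kappa>"
    using False U[of 0 0 0 0] by (auto simp: \<kappa>_def cinner_self)
  define z where "z L j = cis (2 * pi * real j / real L)" for L j :: nat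
  define W where "W N = (\<lambda>(j, k). (norm (\<Sum>(p, q)\<in>{..<N} \<times> {..<N}.
        (z (2*N) j powi (- int p) * z (2*N) k powi (- int q))
            *\<^sub>C U (int p) (int q)))\<^sup>2)" for N :: nat
  \<comment> \<open>\<open>(2 * N) ^ 2\<close> is the number of grid points and \<open>N ^ 2\<close>
    the Fejer weight at frequency 0; together with \<open>\<kappa>\<close>, which is
    \<open>c 0 0\<close>, they make the total mass 1.\<close>
  define wt where "wt N x = W N x / (real (2 * N) ^ 2 * real N ^ 2 * \<kappa>)" for N and x :: "nat \<times> nat"
  define P where "P N = {..<2*N} \<times> {..<2*N}" for N :: nat
  have P: "finite (P N)" for N
    by (simp add: P_def)
  have wt: "wt N x \<ge> 0" for N x
    using \<kappa> by (auto simp: wt_def W_def case_prod_unfold)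
  have "\<exists>t. 0 \<le> t \<and> t \<le> 1 \<and> torus_curve t = (z L j, z L k)" if "j < L" "k < L" for j k L
    using torus_curve_surj[of "j / L" "k / L"] that by (auto simp: z_def)
  note curve = this
  \<comment> \<open>Any curve parameter of a grid point will do; no regularity of the choice is
    needed.\<close>
  define \<tau> where "\<tau> L j k = (SOME t. 0 \<le> t \<and> t \<le> 1 \<and> torus_curve t = (z L j, z L k))" for L j k
  have \<tau>: "0 \<le> \<tau> L j k \<and> \<tau> L j k \<le> 1 \<and> torus_curve (\<tau> L j k) = (z L j, z L k)"
    if "j < L" "k < L" for j k L
    unfolding \<tau>_def by (rule someI_ex[OF curve[OF that]])
  define \<mu> where "\<mu> n = distr (point_measure (P (Suc n)) (wt (Suc n))) borel (\<lambda>(j, k). \<tau> (2 *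
      Suc n) j k)" for n
  have int_\<mu>: "integral\<^sup>L (\<mu> n) F = (\<Sum>(j, k)\<in>P (Suc n). of_real (wt (Suc n) (j, k)) * F (\<tau> (2 *
      Suc n) j k))"
    if "F \<in> borel_measurable borel" for F :: "real \<Rightarrow> complex" and n
    unfolding \<mu>_def
    by (subst integral_distr)
      (use that wt P in \<open>auto simp: lebesgue_integral_point_measure_finite case_prod_unfold
          scaleR_conv_of_real\<close>)
  define E where "E a b t = fst (torus_curve t) powi a * snd (torus_curve t) powi b" for a b t
  have meas_curve: "torus_curve \<in> borel_measurable borel"
    using continuous_on_torus_curve by (rule borel_measurable_continuous_onI)
  have E_meas: "E a b \<in> borel_measurable borel" for a b
    unfolding E_def [abs_def] using meas_curve by measurable
  have grid: "(\<Sum>(j, k)\<in>P N. of_real (wt N (j, k)) * (z (2*N) j powi a * z (2*N) k powi b))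
     = of_nat (N - nat \<bar>a\<bar>) / of_nat N * (of_nat (N - nat \<bar>b\<bar>) / of_nat N) * c a b / of_real \<kappa>"
    if "\<bar>a\<bar> \<le> int N" "\<bar>b\<bar> \<le> int N" "N > 0" for N a b
  proof -
    have "(\<Sum>(j, k)\<in>P N. of_real (wt N (j, k)) * (z (2*N) j powi a * z (2*N) k powi b))
      = (\<Sum>(j, k)\<in>{..<2*N} \<times> {..<2*N}. of_real (W N (j, k)) * (z (2*N) j powi a * z (2*N) k powi b))
        / of_real (real (2 * N) ^ 2 * real N ^ 2 * \<kappa>)"
      by (simp add: P_def wt_def sum_divide_distrib case_prod_unfold)
    also have "\<dots> = (of_nat (2 * N) ^ 2 * (of_nat (N - nat \<bar>a\<bar>) * of_nat (N - nat \<bar>b\<bar>)) * c a b)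
        / of_real (real (2 * N) ^ 2 * real N ^ 2 * \<kappa>)"
      unfolding z_def
      by (subst fejer_grid[where U = U and c = c and N = N, OF U refl])
        (use that in \<open>auto simp: W_def z_def\<close>)
    also have "\<dots> = of_nat (N - nat \<bar>a\<bar>) / of_nat N * (of_nat (N - nat \<bar>b\<bar>) / of_nat N) *
        c a b / of_real \<kappa>"
      using that \<kappa> by (simp add: power2_eq_square field_simps)
    finally show ?thesis .
  qed
  have total: "(\<Sum>x\<in>P (Suc n). wt (Suc n) x) = 1" for n
  proof -
    have "of_real (\<Sum>x\<in>P (Suc n). wt (Suc n) x) = (1 :: complex)"
      using grid[of 0 "Suc n" 0] \<kappa> by (simp add: case_prod_unfold del: of_nat_Suc)
    then show ?thesis by (simp only: of_real_eq_1_iff)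
  qed
  have dist: "real_distribution (\<mu> n)" for n
  proof -
    have "prob_space (point_measure (P (Suc n)) (wt (Suc n)))"
      by (rule prob_spaceI)
        (simp add: space_point_measure emeasure_point_measure_finite P wt total)
    then show ?thesis
      unfolding \<mu>_def by (intro real_distribution.intro prob_space.prob_space_distr)
        (auto simp: real_distribution_axioms_def)
  qed
  have "measure (\<mu> n) {-1<..1} = 1" for n
  proof -
    interpret real_distribution "\<mu> n" by (rule dist)
    have "AE x in \<mu> n. x \<in> {-1<..1}"
      unfolding \<mu>_def
      by (subst AE_distr_iff) (use \<tau> in \<open>fastforce simp: AE_point_measure P_def\<close>)+
    then show ?thesis
      by (intro prob_eq_1[THEN iffD2]) auto
  qed
  note unit_mass = this
  have tight: "tight \<mu>"
    unfolding tight_def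
    by (intro conjI allI impI, simp add: dist, rule exI[of _ "-1"], rule exI[of _ 1])
      (simp add: unit_mass)
  obtain r M where r: "strict_mono (r :: nat \<Rightarrow> nat)" and M: "real_distribution M"
    and conv: "weak_conv_m (\<mu> \<circ> id \<circ> r) M"
    using tight_imp_convergent_subsubsequence[OF tight, of id] by (auto simp: strict_mono_id)
  interpret M: real_distribution M by (rule M)
  have E_int: "integral\<^sup>L M (E a b) = c a b / of_real \<kappa>" for a b
  proof -
    have "(\<lambda>n. integral\<^sup>L ((\<mu> \<circ> id \<circ> r) n) (E a b)) \<longlonglongrightarrow> integral\<^sup>L M (E a b)"
    proof (rule weak_conv_imp_integral_bdd_continuous_conv)
      \<comment> \<open>Negative powers are continuous here because the curve avoids 0 in both
        coordinates.\<close>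
      have "continuous_on UNIV (E a b)"
        unfolding E_def [abs_def] using continuous_on_torus_curve
        by (intro continuous_intros) (auto simp: torus_curve_def)
      then show "isCont (E a b) t" for t
        by (simp add: continuous_on_eq_continuous_at)
      show "norm (E a b t) \<le> 1" for t
        by (simp add: E_def torus_curve_def norm_mult norm_power_int)
    qed (use dist M conv in \<open>auto simp: o_def\<close>)
    moreover have "(\<lambda>n. integral\<^sup>L ((\<mu> \<circ> id \<circ> r) n) (E a b)) \<longlonglongrightarrow> c a b / of_real \<kappa>"
    proof -
      have frac: "(\<lambda>n. complex_of_nat (Suc n - nat \<bar>d\<bar>) / of_nat (Suc n)) \<longlonglongrightarrow> 1" for d :: int
      proof -
        have "(\<lambda>n. 1 - of_nat (nat \<bar>d\<bar>) * (1 / complex_of_nat (Suc n))) \<longlonglongrightarrow> 1 - of_nat (nat \<bar>d\<bar>) * 0"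
          by (intro tendsto_intros LIMSEQ_Suc lim_1_over_n)
        moreover have "eventually (\<lambda>n. 1 - of_nat (nat \<bar>d\<bar>) * (1 / complex_of_nat (Suc n)) =
            complex_of_nat (Suc n - nat \<bar>d\<bar>) / of_nat (Suc n)) sequentially"
          using eventually_ge_at_top[of "nat \<bar>d\<bar>"]
          by eventually_elim (simp add: of_nat_diff field_simps del: of_nat_Suc)
        ultimately show ?thesis
          by (simp add: tendsto_cong)
      qed
      have "(\<lambda>n. complex_of_nat (Suc n - nat \<bar>a\<bar>) / of_nat (Suc n) *
          (complex_of_nat (Suc n - nat \<bar>b\<bar>) / of_nat (Suc n)) * c a b / of_real \<kappa>)
        \<longlonglongrightarrow> 1 * 1 * c a b / of_real \<kappa>"
        using \<kappa> by (intro tendsto_intros frac) auto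
      moreover have "eventually (\<lambda>n. complex_of_nat (Suc n - nat \<bar>a\<bar>) / of_nat (Suc n) *
          (complex_of_nat (Suc n - nat \<bar>b\<bar>) / of_nat (Suc n)) * c a b / of_real \<kappa>
          = integral\<^sup>L (\<mu> n) (E a b)) sequentially"
        using eventually_ge_at_top[of "nat \<bar>a\<bar>"] eventually_ge_at_top[of "nat \<bar>b\<bar>"]
      proof eventually_elim
        case (elim n)
        have "integral\<^sup>L (\<mu> n) (E a b) = (\<Sum>(j, k)\<in>P (Suc n). of_real (wt (Suc n) (j, k)) *
            (z (2 * Suc n) j powi a * z (2 * Suc n) k powi b))"
          unfolding int_\<mu>[OF E_meas] E_def P_def
          by (intro sum.cong) (use \<tau> in auto)
        also have "\<dots> = of_nat (Suc n - nat \<bar>a\<bar>) / of_nat (Suc n) *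
            (of_nat (Suc n - nat \<bar>b\<bar>) / of_nat (Suc n)) * c a b / of_real \<kappa>"
          using elim by (intro grid) auto
        finally show ?case by simp
      qed
      ultimately have "(\<lambda>n. integral\<^sup>L (\<mu> n) (E a b)) \<longlonglongrightarrow> c a b / of_real \<kappa>"
        by (simp add: tendsto_cong)
      then show ?thesis
        using LIMSEQ_subseq_LIMSEQ[OF _ r] by (simp add: o_def)
    qed
    ultimately show ?thesis
      by (rule LIMSEQ_unique)
  qed
  have E_integrable: "integrable M (E a b)" for a b
    by (rule M.integrable_const_bound[of _ 1])
      (use E_meas in \<open>auto simp: E_def torus_curve_def norm_mult norm_power_int\<close>)
  show ?thesis
  proof (rule that[of "density (distr M borel torus_curve) (\<lambda>_. ennreal \<kappa>)"])
    show "AE z in density (distr M borel torus_curve) (\<lambda>_. ennreal \<kappa>). cmod (fst z) = 1 \<and>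
        cmod (snd z) = 1"
      using meas_curve by (subst AE_density) (auto simp: AE_distr_iff torus_curve_def)
    fix a b
    have "has_bochner_integral M (\<lambda>t. \<kappa> *\<^sub>R E a b t) (c a b)"
      using has_bochner_integral_scaleR_right[of \<kappa> M "E a b" "c a b / of_real \<kappa>"] \<kappa> E_int
          E_integrable
      by (simp add: has_bochner_integral_iff scaleR_conv_of_real)
    then show "has_bochner_integral (density (distr M borel torus_curve) (\<lambda>_. ennreal \<kappa>))
      (\<lambda>z. fst z powi a * snd z powi b) (c a b)"
      using meas_curve \<kappa>
      by (intro has_bochner_integral_density has_bochner_integral_distr) (auto simp: E_def)
  qed auto
qed

section \<open>Uniqueness of measures on the torus\<close>

text \<open>Closed sets form an intersection-stable generator, and the indicator of a nonempty
  closed set is the limit of the functions \<open>max 0 (1 - n * infdist x A)\<close>.\<close>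

lemma finite_measure_eqI_continuous:
  fixes M N :: "'a::metric_space measure"
  assumes sets: "sets M = sets borel" "sets N = sets borel"
    and fin: "finite_measure M" "finite_measure N"
    and eq: "\<And>f :: 'a \<Rightarrow> real. continuous_on UNIV f \<Longrightarrow> (\<And>x. 0 \<le> f x) \<Longrightarrow> (\<And>x. f x \<le> 1) \<Longrightarrow>
      integral\<^sup>L M f = integral\<^sup>L N f"
  shows "M = N"
proof (rule measure_eqI_generator_eq[where E = "Collect closed" and \<Omega> = UNIV and A = "\<lambda>_. UNIV"])
  interpret M: finite_measure M by (rule fin)
  interpret N: finite_measure N by (rule fin)
  show "Int_stable (Collect closed)"
    by (auto simp: Int_stable_def)
  fix A :: "'a set"
  assume "A \<in> Collect closed"
  then have A: "closed A" by simp
  show "emeasure M A = emeasure N A"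
  \<comment> \<open>The empty set is split off because \<open>infdist x {}\<close> is 0 by
    convention.\<close>
  proof (cases "A = {}")
    case False
    define f where "f n x = max 0 (1 - real n * infdist x A)" for n x
    have cont: "continuous_on UNIV (f n)" for n
      unfolding f_def [abs_def] by (intro continuous_intros)
    have bounds: "0 \<le> f n x" "f n x \<le> 1" for n x
      by (auto simp: f_def infdist_nonneg)
    have lim: "(\<lambda>n. f n x) \<longlonglongrightarrow> indicat_real A x" for x
    proof (cases "x \<in> A")
      case True
      then show ?thesis by (simp add: f_def)
    next
      case out: False
      then have pos: "infdist x A > 0"
        using A False in_closed_iff_infdist_zero[of A x] infdist_nonneg[of x A] by linarith
      obtain n0 where "1 / infdist x A < real n0"
        using reals_Archimedean2 by blast
      then have n0: "1 < real n0 * infdist x A"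
        using pos by (simp add: field_simps)
      have "f n x = 0" if "n \<ge> n0" for n
      proof -
        have "real n0 * infdist x A \<le> real n * infdist x A"
          using that pos by (intro mult_right_mono) auto
        then show ?thesis
          using n0 by (simp add: f_def)
      qed
      then have "eventually (\<lambda>n. f n x = 0) sequentially"
        by (auto simp: eventually_sequentially)
      then show ?thesis
        using out by (simp add: tendsto_eventually)
    qed
    have int: "(\<lambda>n. integral\<^sup>L L (f n)) \<longlonglongrightarrow> measure L A"
      if L: "sets L = sets borel" "finite_measure L" for L :: "'a measure"
    proof -
      interpret L: finite_measure L by (rule L)
      have [simp]: "borel_measurable L = borel_measurable borel"
        using measurable_cong_sets[OF L(1) refl] .
      have "(\<lambda>n. integral\<^sup>L L (f n)) \<longlonglongrightarrow> integral\<^sup>L L (indicat_real A)"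
        by (rule integral_dominated_convergence[where w = "\<lambda>_. 1"])
          (use lim bounds cont A in \<open>auto intro!: borel_measurable_continuous_onI\<close>)
      then show ?thesis
        using A L(1) sets_eq_imp_space_eq[OF L(1)] by simp
    qed
    have "integral\<^sup>L M (f n) = integral\<^sup>L N (f n)" for n
      by (rule eq[OF cont bounds])
    then have "measure M A = measure N A"
      using LIMSEQ_unique[OF int[OF sets(1) fin(1)]] int[OF sets(2) fin(2)] by simp
    then show ?thesis
      by (simp add: M.emeasure_eq_measure N.emeasure_eq_measure)
  qed simp
next
  show "sets M = sigma_sets UNIV (Collect closed)"
    by (simp add: sets borel_eq_closed)
  show "sets N = sigma_sets UNIV (Collect closed)"
    by (simp add: sets borel_eq_closed)
  show "emeasure M UNIV \<noteq> \<infinity>"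
    using finite_measure.emeasure_finite[OF fin(1)] by simp
qed auto

abbreviation torus :: "(complex \<times> complex) set" where
  "torus \<equiv> sphere 0 1 \<times> sphere 0 1"

text \<open>The rule \<open>cong\<close> identifies functions that agree on the torus. This makes real and imaginary
  parts of the coordinates trigonometric polynomials, so that every real polynomial is one and
  the Stone-Weierstrass theorem applies.\<close>

inductive trig_poly :: "(complex \<times> complex \<Rightarrow> complex) \<Rightarrow> bool" where
  monomial: "trig_poly (\<lambda>z. c * (fst z powi a * snd z powi b))"
| add: "trig_poly f \<Longrightarrow> trig_poly g \<Longrightarrow> trig_poly (\<lambda>z. f z + g z)"
| cong: "trig_poly f \<Longrightarrow> g \<in> borel_measurable borel \<Longrightarrow> (\<And>z. z \<in> torus \<Longrightarrow> g z = f z) \<Longrightarrow> trig_poly g"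

lemma trig_poly_measurable: "trig_poly f \<Longrightarrow> f \<in> borel_measurable borel"
  by (induction rule: trig_poly.induct) (auto intro: borel_measurable_power_int)

lemma trig_poly_mult_monomial:
  assumes "trig_poly f"
  shows "trig_poly (\<lambda>z. c * (fst z powi a * snd z powi b) * f z)"
  using assms
proof (induction rule: trig_poly.induct)
  case (monomial c' a' b')
  have "c * (fst z powi a * snd z powi b) * (c' * (fst z powi a' * snd z powi b'))
     = (c * c') * (fst z powi (a + a') * snd z powi (b + b'))" if "z \<in> torus" for z
    using that by (subst (1 2) power_int_add) (auto simp: mult_ac)
  then show ?case
    by (intro trig_poly.cong[OF trig_poly.monomial[of "c * c'" "a + a'" "b + b'"]])
      (auto intro: borel_measurable_power_int simp del: mult_eq_0_iff mult_cancel_left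
          mult_cancel_right)
next
  case (add f g)
  then show ?case
    using trig_poly.add[OF add.IH] by (simp add: distrib_left)
next
  case (cong f g)
  show ?case
    by (rule trig_poly.cong[OF cong.IH]) (use cong.hyps in \<open>auto intro: borel_measurable_power_int
        dest: trig_poly_measurable\<close>)
qed

lemma trig_poly_mult:
  assumes "trig_poly f" "trig_poly g"
  shows "trig_poly (\<lambda>z. f z * g z)"
  using assms
proof (induction rule: trig_poly.induct)
  case (monomial c a b)
  then show ?case by (rule trig_poly_mult_monomial)
next
  case (add f1 f2)
  then show ?case
    using trig_poly.add[OF add.IH] by (simp add: distrib_right)
next
  case (cong f g')
  show ?case
    by (rule trig_poly.cong[OF cong.IH[OF cong.prems]]) (use cong.hyps cong.prems in \<open>auto dest:
        trig_poly_measurable\<close>)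
qed

lemma trig_poly_const: "trig_poly (\<lambda>z. c)"
  using monomial[of c 0 0] by simp

text \<open>On the unit circle the inverse of \<open>w\<close> is its conjugate, so
  \<open>Re w\<close> and \<open>Im w\<close> are Laurent polynomials in \<open>w\<close>. A
  real-linear functional is a combination of the four real coordinates, and sums and products stay
  in the class.\<close>

lemma trig_poly_real_polynomial:
  assumes "real_polynomial_function f"
  shows "trig_poly (\<lambda>z. of_real (f z))"
  using assms
proof (induction rule: real_polynomial_function.induct)
  case (linear f)
  interpret f: bounded_linear f by (rule linear)
  have f: "f (x, y) = Re x * f (1, 0) + Im x * f (\<i>, 0) + (Re y * f (0, 1) + Im y * f (0,
      \<i>))" for x y
  proof -
    have "(x, y) = (Re x *\<^sub>R (1, 0) + Im x *\<^sub>R (\<i>, 0)) + (Re y *\<^sub>R (0, 1) + Im y *\<^sub>R (0, \<i>))"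
      by (simp add: complex_eq_iff)
    then show ?thesis
      using f.add f.scaleR by (metis real_scaleR_def)
  qed
  have Re: "of_real (Re w) = (w powi 1 + w powi (-1)) / 2"
    and Im: "of_real (Im w) = (w powi 1 - w powi (-1)) * (- \<i> / 2)" if "cmod w = 1" for w
  proof -
    have "inverse w = cnj w"
      using that by (metis divide_conv_cnj inverse_eq_divide mult_1)
    then show "of_real (Re w) = (w powi 1 + w powi (-1)) / 2"
      "of_real (Im w) = (w powi 1 - w powi (-1)) * (- \<i> / 2)"
      by (auto simp: complex_eq_iff power_int_minus)
  qed
  \<comment> \<open>The factor \<open>- \<i> / 2\<close> is 1 / (2i), from Im w = (w - 1/w) / (2i);
    the coefficients are collected monomial by monomial.\<close>
  define L where "L = (\<lambda>z :: complex \<times> complex.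
      ((of_real (f (1, 0)) / 2 + of_real (f (\<i>, 0)) * (- \<i> / 2)) * (fst z powi 1 * snd z powi 0) +
       (of_real (f (1, 0)) / 2 - of_real (f (\<i>, 0)) * (- \<i> / 2)) * (fst z powi (-1) *
           snd z powi 0)) +
      ((of_real (f (0, 1)) / 2 + of_real (f (0, \<i>)) * (- \<i> / 2)) * (fst z powi 0 * snd z powi 1) +
       (of_real (f (0, 1)) / 2 - of_real (f (0, \<i>)) * (- \<i> / 2)) * (fst z powi 0 *
           snd z powi (-1))))"
  have "trig_poly L"
    unfolding L_def by (intro trig_poly.add monomial)
  have *: "(X + X') / 2 * A + (X - X') * (- \<i> / 2) * B + ((Y + Y') / 2 * C + (Y - Y') *
      (- \<i> / 2) * D) =
      ((A / 2 + B * (- \<i> / 2)) * (X * 1) + (A / 2 - B * (- \<i> / 2)) * (X' * 1)) +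
      ((C / 2 + D * (- \<i> / 2)) * (1 * Y) + (C / 2 - D * (- \<i> / 2)) * (1 * Y'))"
    for A B C D X X' Y Y' :: complex
    by (simp add: field_simps)
  from \<open>trig_poly L\<close> show ?case
  proof (rule trig_poly.cong)
    show "(\<lambda>z. complex_of_real (f z)) \<in> borel_measurable borel"
      by (intro borel_measurable_continuous_onI continuous_intros linear_continuous_on linear)
    fix z assume "z \<in> torus"
    then obtain x y where z: "z = (x, y)" "cmod x = 1" "cmod y = 1"
      by (auto simp: mem_Times_iff prod_eq_iff)
    show "of_real (f z) = L z"
      unfolding z(1) f[of x y] L_def of_real_add of_real_mult Re[OF z(2)] Im[OF z(2)] Re[OF z(3)]
          Im[OF z(3)]
        fst_conv snd_conv power_int_0_right
      by (rule *)
  qed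
next
  case (const c)
  show ?case by (rule trig_poly_const)
next
  case (add f g)
  then show ?case
    using trig_poly.add by simp
next
  case (mult f g)
  then show ?case
    using trig_poly_mult by simp
qed

text \<open>Equal Fourier coefficients mean equal integrals of all trigonometric polynomials. By
  Stone-Weierstrass these approximate a continuous function uniformly on the torus, and its
  complement is null for both measures. The coefficient with \<open>a = b = 0\<close> makes the
  masses finite.\<close>

theorem torus_measure_unique:
  fixes M N :: "(complex \<times> complex) measure"
  assumes sets: "sets M = sets borel" "sets N = sets borel"
    and AE: "AE z in M. cmod (fst z) = 1 \<and> cmod (snd z) = 1" "AE z in N. cmod (fst z) = 1 \<and>
        cmod (snd z) = 1"
    and M: "\<And>a b. has_bochner_integral M (\<lambda>z. fst z powi a * snd z powi b) (c a b)"
    and N: "\<And>a b. has_bochner_integral N (\<lambda>z. fst z powi a * snd z powi b) (c a b)"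
  shows "M = N"
proof (rule finite_measure_eqI_continuous)
  have fin: "finite_measure L" if "\<And>a b. has_bochner_integral L (\<lambda>z. fst z powi a *
      snd z powi b) (c a b)"
    for L :: "(complex \<times> complex) measure"
  proof -
    have "integrable L (\<lambda>z. 1 :: complex)"
      using that[of 0 0] by (simp add: has_bochner_integral_iff)
    then show ?thesis
      by (auto intro!: finite_measureI simp: integrable_iff_bounded)
  qed
  show fM: "finite_measure M" and fN: "finite_measure N"
    using fin M N by blast+
  have poly: "\<exists>v. has_bochner_integral M f v \<and> has_bochner_integral N f v"
    if "trig_poly f" for f
    using that
  proof (induction rule: trig_poly.induct)
    case (monomial k a b)
    show ?case
      using M[of a b] N[of a b] has_bochner_integral_mult_right by blast
  next
    case (add f g)
    then show ?case
      using has_bochner_integral_add by blast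
  next
    case (cong f g)
    from cong.IH obtain v where v: "has_bochner_integral M f v" "has_bochner_integral N f v"
      by blast
    have "has_bochner_integral L g v"
      if "has_bochner_integral L f v" "sets L = sets borel"
        "AE z in L. cmod (fst z) = 1 \<and> cmod (snd z) = 1" for L
    proof -
      have "AE z in L. f z = g z"
        using that(3) by eventually_elim (use cong.hyps in \<open>auto simp: mem_Times_iff\<close>)
      moreover have "f \<in> borel_measurable L" "g \<in> borel_measurable L"
        using cong.hyps trig_poly_measurable that(2) by (auto cong: measurable_cong_sets)
      ultimately show ?thesis
        using that(1) has_bochner_integral_cong_AE by blast
    qed
    then show ?case
      using v sets AE by blast
  qed
  interpret M: finite_measure M by (rule fM)
  interpret N: finite_measure N by (rule fN)
  fix f :: "complex \<times> complex \<Rightarrow> real"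
  assume f: "continuous_on UNIV f" "\<And>x. 0 \<le> f x" "\<And>x. f x \<le> 1"
  have close: "\<bar>integral\<^sup>L L f - integral\<^sup>L L p\<bar> \<le> \<epsilon> * measure L UNIV"
    if "sets L = sets borel" "AE z in L. cmod (fst z) = 1 \<and> cmod (snd z) = 1" "finite_measure L"
      "integrable L p" "\<And>z. z \<in> torus \<Longrightarrow> \<bar>f z - p z\<bar> < \<epsilon>" "\<epsilon> > 0" for L p \<epsilon>
  proof -
    interpret L: finite_measure L by (rule that(3))
    have "f \<in> borel_measurable L"
      using borel_measurable_continuous_onI[OF f(1)] that(1) by (auto cong: measurable_cong_sets)
    then have "integrable L f"
      by (intro L.integrable_const_bound[of _ 1]) (use f in auto)
    then have "\<bar>integral\<^sup>L L f - integral\<^sup>L L p\<bar> = \<bar>integral\<^sup>L L (\<lambda>z. f z - p z)\<bar>"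
      using that by simp
    also have "\<dots> \<le> integral\<^sup>L L (\<lambda>z. \<bar>f z - p z\<bar>)"
      using integral_norm_bound[of L "\<lambda>z. f z - p z"] by simp
    also have "\<dots> \<le> integral\<^sup>L L (\<lambda>z. \<epsilon>)"
    proof (rule integral_mono_AE)
      show "AE z in L. \<bar>f z - p z\<bar> \<le> \<epsilon>"
        using that(2) by eventually_elim (use that(5) in \<open>fastforce simp: mem_Times_iff\<close>)
    qed (use \<open>integrable L f\<close> that in auto)
    also have "\<dots> = \<epsilon> * measure L UNIV"
      using sets_eq_imp_space_eq[OF that(1)] by simp
    finally show ?thesis .
  qed
  have "\<bar>integral\<^sup>L M f - integral\<^sup>L N f\<bar> \<le> \<epsilon> * (measure M UNIV +
      measure N UNIV)" if \<epsilon>: "\<epsilon> > 0" for \<epsilon>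
  proof -
    have "compact torus"
      by (intro compact_Times compact_sphere)
    then obtain p where p: "real_polynomial_function p" "\<And>z. z \<in> torus \<Longrightarrow> \<bar>f z - p z\<bar> < \<epsilon>"
      using Stone_Weierstrass_real_polynomial_function[OF _ continuous_on_subset[OF f(1)] \<epsilon>] by
          blast
    obtain v where v: "has_bochner_integral M (\<lambda>z. complex_of_real (p z)) v"
        "has_bochner_integral N (\<lambda>z. complex_of_real (p z)) v"
      using poly[OF trig_poly_real_polynomial[OF p(1)]] by blast
    have "has_bochner_integral M p (Re v)" "has_bochner_integral N p (Re v)"
      using v[THEN has_bochner_integral_Re] by simp_all
    then show ?thesis
      using close[OF sets(1) AE(1) fM _ p(2) \<epsilon>] close[OF sets(2) AE(2) fN _ p(2) \<epsilon>]
      by (auto simp: has_bochner_integral_iff distrib_left)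
  qed
  note bound = this
  show "integral\<^sup>L M f = integral\<^sup>L N f"
  proof (rule ccontr)
    let ?d = "\<bar>integral\<^sup>L M f - integral\<^sup>L N f\<bar>" and ?m = "measure M UNIV + measure N UNIV"
    assume "integral\<^sup>L M f \<noteq> integral\<^sup>L N f"
    then have d: "?d > 0" by simp
    have m: "?m \<ge> 0" by simp
    \<comment> \<open>This choice of the error makes the right-hand side strictly smaller than
      \<open>?d\<close>.\<close>
    have "?d \<le> ?d / (?m + 1) * ?m"
      by (rule bound, rule divide_pos_pos[OF d]) (use m in linarith)
    then show False
      using d m by (simp add: field_simps)
  qed
qed (use sets in auto)

section \<open>Rational moments and the Cayley transform\<close>

definition ratio :: "nat \<Rightarrow> int \<Rightarrow> int \<Rightarrow> real \<Rightarrow> complex" where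
  "ratio m k l x = of_real x ^ m * (of_real x + \<i>) powi k * (of_real x - \<i>) powi l"

definition chi :: "index \<Rightarrow> real \<times> real \<Rightarrow> complex" where
  "chi = (\<lambda>(m, k, l, n, r, t) (x1, x2). ratio m k l x1 * ratio n r t x2)"

lemma rational_solutions_altdef:
  "rational_solutions \<phi> = {\<mu>. sets \<mu> = sets borel \<and> (\<forall>x. has_bochner_integral \<mu> (chi x) (\<phi> x))}"
  by (simp add: rational_solutions_def chi_def ratio_def)

lemma real_plus_i_neq_0 [simp]: "complex_of_real x +
    \<i> \<noteq> 0" and real_minus_i_neq_0 [simp]: "complex_of_real x - \<i> \<noteq> 0"
  and i_plus_real_neq_0 [simp]: "\<i> + complex_of_real x \<noteq> 0"
  by (auto simp: complex_eq_iff)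

lemma ratio_Suc_plus: "ratio (Suc m) k l x + \<i> * ratio m k l x = ratio m (k + 1) l x"
  unfolding ratio_def power_int_add[OF disjI1, OF real_plus_i_neq_0] by (simp add: algebra_simps)

lemma ratio_Suc_minus: "ratio (Suc m) k l x - \<i> * ratio m k l x = ratio m k (l + 1) x"
  unfolding ratio_def power_int_add[OF disjI1, OF real_minus_i_neq_0] by (simp add: algebra_simps)

lemma ratio_measurable [measurable]: "ratio m k l \<in> borel_measurable borel"
  unfolding ratio_def [abs_def] by measurable

lemma chi_measurable [measurable]: "chi x \<in> borel_measurable borel"
proof -
  obtain m k l n r t where "x = (m, k, l, n, r, t)"
    by (cases x)
  then have "chi x = (\<lambda>p. ratio m k l (fst p) * ratio n r t (snd p))"
    by (auto simp: chi_def)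
  also have "\<dots> \<in> borel_measurable borel"
    by measurable
  finally show ?thesis .
qed

section \<open>The Cayley transform between line and circle\<close>

definition cayley :: "real \<Rightarrow> complex" where
  "cayley x = (of_real x - \<i>) / (of_real x + \<i>)"

text \<open>\<open>Re\<close> makes the inverse transform a total real function. Division by zero
  sends \<open>z = 1\<close>, the point at infinity, to 0; the representing measures do not charge
  that point.\<close>

definition inv_cayley :: "complex \<Rightarrow> real" where
  "inv_cayley z = Re (\<i> * (1 + z) / (1 - z))"

lemma cayley_measurable [measurable]: "cayley \<in> borel_measurable borel"
  unfolding cayley_def [abs_def] by measurable

lemma inv_cayley_measurable [measurable]: "inv_cayley \<in> borel_measurable borel"
  unfolding inv_cayley_def [abs_def] by measurable

lemma norm_cayley: "cmod (cayley x) = 1"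
proof -
  have "cmod (of_real x - \<i>) = cmod (of_real x + \<i>)"
    by (simp add: cmod_def)
  then show ?thesis
    by (simp add: cayley_def norm_divide)
qed

lemma inv_cayley_cayley: "inv_cayley (cayley x) = x"
proof -
  have "1 + cayley x = 2 * of_real x / (of_real x + \<i>)" "1 - cayley x = 2 * \<i> / (of_real x + \<i>)"
    by (simp_all add: cayley_def divide_simps)
  then show ?thesis
    by (simp add: inv_cayley_def)
qed

lemma of_real_inv_cayley:
  assumes "cmod z = 1" "z \<noteq> 1"
  shows "of_real (inv_cayley z) = \<i> * (1 + z) / (1 - z)"
proof -
  have cz: "cnj z = 1 / z"
    using assms by (metis divide_conv_cnj mult_1)
  have "z \<noteq> 0" using assms by auto
  have "cnj (\<i> * (1 + z) / (1 - z)) = \<i> * (1 + z) / (1 - z)"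
    using assms \<open>z \<noteq> 0\<close> by (simp add: cz divide_simps) (simp add: algebra_simps)
  then have "\<i> * (1 + z) / (1 - z) \<in> \<real>"
    by (simp only: Reals_cnj_iff)
  then show ?thesis
    by (simp add: inv_cayley_def of_real_Re)
qed

text \<open>On the unit circle this is \<open>1 / (x\<^sup>2 + 1)\<close> for \<open>x = inv_cayley z\<close>.\<close>

definition poisson :: "complex \<Rightarrow> real" where
  "poisson z = (cmod (1 - z))\<^sup>2 / 4"

lemma poisson_measurable [measurable]: "poisson \<in> borel_measurable borel"
  unfolding poisson_def [abs_def] by measurable

lemma poisson_nonneg [simp]: "0 \<le> poisson z"
  by (simp add: poisson_def)

lemma poisson_eq_0_iff [simp]: "poisson z = 0 \<longleftrightarrow> z = 1"
  by (auto simp: poisson_def)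

lemma of_real_poisson:
  assumes "cmod z = 1"
  shows "of_real (poisson z) = (2 - z - z powi (-1)) / 4"
proof -
  have cz: "cnj z = inverse z"
    using assms by (metis divide_conv_cnj inverse_eq_divide mult_1)
  have "z * inverse z = 1"
    using assms by (intro right_inverse) auto
  then have "(1 - z) * cnj (1 - z) = 2 - z - inverse z"
    by (simp add: cz algebra_simps)
  then have "of_real ((cmod (1 - z))\<^sup>2) = 2 - z - inverse z"
    by (simp only: complex_norm_square)
  then show ?thesis
    by (simp add: poisson_def power_int_minus)
qed

text \<open>For \<open>x = inv_cayley z\<close> one has x - i = z (x + i). Hence the ratio equals
  \<open>z powi a\<close> times the \<open>K\<close>-th power of (x + i)(x - i) = x^2 + 1, and
  \<open>poisson z\<close> is the reciprocal of that factor.\<close>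

lemma ratio_inv_cayley:
  assumes "cmod z = 1" "z \<noteq> 1"
  shows "of_real (poisson z ^ K) * ratio 0 (int K - a) (int K + a) (inv_cayley z) = z powi a"
proof -
  define x where "x = complex_of_real (inv_cayley z)"
  have x: "x + \<i> = 2 * \<i> / (1 - z)" "x - \<i> = z * (x + \<i>)"
    using assms by (simp_all add: x_def of_real_inv_cayley field_simps)
  have z: "z \<noteq> 0" "x + \<i> \<noteq> 0"
    using assms x by auto
  have "ratio 0 (int K - a) (int K + a) (inv_cayley z) = (x + \<i>) powi (int K - a) *
      (x - \<i>) powi (int K + a)"
    by (simp add: ratio_def x_def)
  also have "\<dots> = z powi a * (z * (x + \<i>) ^ 2) ^ K"
  proof -
    have "(x + \<i>) powi (int K - a) * (x - \<i>) powi (int K + a) =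
        z powi (int K + a) * ((x + \<i>) powi (int K - a) * (x + \<i>) powi (int K + a))"
      by (simp add: x(2) power_int_mult_distrib)
    also have "(x + \<i>) powi (int K - a) * (x + \<i>) powi (int K + a) = (x + \<i>) powi int (2 * K)"
      by (subst power_int_add [symmetric]) (use z in auto)
    finally show ?thesis
      by (simp only: power_int_add[OF disjI1, OF z(1)] power_int_of_nat power_mult
          power_mult_distrib)
        (simp add: mult_ac)
  qed
  finally have eq: "ratio 0 (int K - a) (int K + a) (inv_cayley z) = z powi a * (z * (x +
      \<i>) ^ 2) ^ K" .
  have "of_real (poisson z) * (z * (x + \<i>) ^ 2) = 1"
    using assms z(1) unfolding of_real_poisson[OF assms(1)] x(1)
    by (simp add: power_int_minus power2_eq_square divide_simps) (simp add: algebra_simps)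
  then have "of_real (poisson z ^ K) * (z * (x + \<i>) ^ 2) ^ K = 1"
    by (simp flip: power_mult_distrib)
  then show ?thesis
    by (simp add: eq mult.left_commute)
qed

definition torus_to_plane :: "complex \<times> complex \<Rightarrow> real \<times> real" where
  "torus_to_plane z = (inv_cayley (fst z), inv_cayley (snd z))"

definition plane_to_torus :: "real \<times> real \<Rightarrow> complex \<times> complex" where
  "plane_to_torus p = (cayley (fst p), cayley (snd p))"

lemma torus_to_plane_measurable [measurable]: "torus_to_plane \<in> borel_measurable borel"
  unfolding torus_to_plane_def [abs_def] by (intro borel_measurable_Pair) measurable

lemma plane_to_torus_measurable [measurable]: "plane_to_torus \<in> borel_measurable borel"
  unfolding plane_to_torus_def [abs_def] by (intro borel_measurable_Pair) measurable

text \<open>The values of \<open>\<phi>\<close> at the indices \<open>(0, -a, a, 0, -b, b)\<close>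
  are the Fourier coefficients of the image on the torus. The image determines the measure because
  \<open>torus_to_plane\<close> is a left inverse of \<open>plane_to_torus\<close>.\<close>

theorem rational_solutions_unique:
  assumes "\<mu> \<in> rational_solutions \<phi>" "\<mu>' \<in> rational_solutions \<phi>"
  shows "\<mu> = \<mu>'"
proof -
  have mom: "has_bochner_integral (distr M borel plane_to_torus) (\<lambda>z. fst z powi a *
      snd z powi b) (\<phi> (0, -a, a, 0, -b, b))"
    if "M \<in> rational_solutions \<phi>" for M a b
  proof (rule has_bochner_integral_distr)
    have [measurable_cong]: "sets M = sets borel"
      using that by (simp add: rational_solutions_def)
    show "plane_to_torus \<in> borel_measurable M"
      by measurable
    have "fst (plane_to_torus p) powi a * snd (plane_to_torus p) powi b = chi (0, -a, a, 0, -b,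
        b) p" for p
      by (cases p) (simp add: plane_to_torus_def chi_def ratio_def cayley_def divide_inverse
          power_int_mult_distrib power_int_inverse power_int_minus mult_ac)
    then show "has_bochner_integral M (\<lambda>p. fst (plane_to_torus p) powi a *
        snd (plane_to_torus p) powi b)
        (\<phi> (0, -a, a, 0, -b, b))"
      using that by (simp add: rational_solutions_altdef)
  qed measurable
  have AE: "AE z in distr M borel plane_to_torus. cmod (fst z) = 1 \<and> cmod (snd z) = 1"
    if "M \<in> rational_solutions \<phi>" for M
  proof -
    have [measurable_cong]: "sets M = sets borel"
      using that by (simp add: rational_solutions_def)
    show ?thesis
      by (subst AE_distr_iff) (auto simp: plane_to_torus_def norm_cayley)
  qed
  have inv: "distr (distr M borel plane_to_torus) borel torus_to_plane = M"
    if "M \<in> rational_solutions \<phi>" for M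
  proof -
    have sets [measurable_cong]: "sets M = sets borel"
      using that by (simp add: rational_solutions_def)
    have "torus_to_plane \<circ> plane_to_torus = (\<lambda>p. p)"
      by (auto simp: torus_to_plane_def plane_to_torus_def inv_cayley_cayley)
    moreover have "distr M borel (\<lambda>p. p) = M"
      by (rule distr_id2) (simp add: sets)
    ultimately show ?thesis
      by (subst distr_distr) simp_all
  qed
  have "distr \<mu> borel plane_to_torus = distr \<mu>' borel plane_to_torus"
    by (rule torus_measure_unique[OF _ _ AE AE mom mom]) (use assms in auto)
  then show ?thesis
    using inv assms by metis
qed

lemma has_bochner_integral_AE_eq:
  assumes "has_bochner_integral M f x" "AE z in M. f z = g z" "g \<in> borel_measurable M"
  shows "has_bochner_integral M g x"
  using has_bochner_integral_cong_AE[OF _ assms(3,2)] assms(1)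
    borel_measurable_has_bochner_integral[OF assms(1)] by blast

lemma chi_relations:
  "chi (Suc m, k, l, n, r, t) p + \<i> * chi (m, k, l, n, r, t) p = chi (m, k + 1, l, n, r, t) p"
  "chi (Suc m, k, l, n, r, t) p - \<i> * chi (m, k, l, n, r, t) p = chi (m, k, l + 1, n, r, t) p"
  "chi (m, k, l, Suc n, r, t) p + \<i> * chi (m, k, l, n, r, t) p = chi (m, k, l, n, r + 1, t) p"
  "chi (m, k, l, Suc n, r, t) p - \<i> * chi (m, k, l, n, r, t) p = chi (m, k, l, n, r, t + 1) p"
  by (cases p; simp only: chi_def case_prod_conv ratio_Suc_plus [symmetric] ratio_Suc_minus
      [symmetric]
      distrib_left distrib_right left_diff_distrib right_diff_distrib mult_ac)+

text \<open>From (x + i) - (x - i) = 2i: a function is expressed by two others with a larger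
  exponent sum, which drives the descent to arbitrary exponents.\<close>

lemma chi_differences:
  "(chi (m, k + 1, l, n, r, t) p - chi (m, k, l + 1, n, r, t) p) / (2 * \<i>) = chi (m, k, l, n, r,
      t) p"
  "(chi (m, k, l, n, r + 1, t) p - chi (m, k, l, n, r, t + 1) p) / (2 * \<i>) = chi (m, k, l, n, r,
      t) p"
  unfolding chi_relations [symmetric] by simp_all

text \<open>The zero index is neutral in the second slot, so the family determines
  \<open>\<phi>\<close>.\<close>

lemma gram_function_eq:
  assumes "gram_function f \<phi>"
  shows "\<phi> x = cinner (f x) (f (0, 0, 0, 0, 0, 0))"
proof -
  obtain m k l n r t where "x = (m, k, l, n, r, t)"
    by (cases x)
  then show ?thesis
    using assms[unfolded gram_function_def, rule_format, of m k l n r t 0 0 0 0 0 0] by simp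
qed

section \<open>Torus measures of a Gram function\<close>

definition rational_family :: "(index \<Rightarrow> 'h::complex_hilbert_space) \<Rightarrow> bool" where
  "rational_family f \<longleftrightarrow> (\<forall>m k l n r t.
        f (m + 1, k, l, n, r, t) + \<i> *\<^sub>C f (m, k, l, n, r, t) = f (m, k + 1, l, n, r, t) \<and>
        f (m + 1, k, l, n, r, t) - \<i> *\<^sub>C f (m, k, l, n, r, t) = f (m, k, l + 1, n, r, t) \<and>
        f (m, k, l, n + 1, r, t) + \<i> *\<^sub>C f (m, k, l, n, r, t) = f (m, k, l, n, r + 1, t) \<and>
        f (m, k, l, n + 1, r, t) - \<i> *\<^sub>C f (m, k, l, n, r, t) = f (m, k, l, n, r, t + 1))"

locale rational_gram =
  fixes f :: "index \<Rightarrow> 'h::complex_hilbert_space" and \<phi> :: "index \<Rightarrow> complex"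
  assumes gram: "gram_function f \<phi>" and fam: "rational_family f"
begin

lemma phi_relations:
  "\<phi> (Suc m, k, l, n, r, t) + \<i> * \<phi> (m, k, l, n, r, t) = \<phi> (m, k + 1, l, n, r, t)"
  "\<phi> (Suc m, k, l, n, r, t) - \<i> * \<phi> (m, k, l, n, r, t) = \<phi> (m, k, l + 1, n, r, t)"
  "\<phi> (m, k, l, Suc n, r, t) + \<i> * \<phi> (m, k, l, n, r, t) = \<phi> (m, k, l, n, r + 1, t)"
  "\<phi> (m, k, l, Suc n, r, t) - \<i> * \<phi> (m, k, l, n, r, t) = \<phi> (m, k, l, n, r, t + 1)"
proof -
  have *: "\<phi> x + c * \<phi> y = \<phi> z" if "f x + c *\<^sub>C f y = f z" for x y z c
    unfolding gram_function_eq[OF gram] that [symmetric] cinner_add_left cinner_scaleC_left ..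
  have **: "\<phi> x - c * \<phi> y = \<phi> z" if "f x - c *\<^sub>C f y = f z" for x y z c
    unfolding gram_function_eq[OF gram] that [symmetric] cinner_diff_left cinner_scaleC_left ..
  note rel = fam[unfolded rational_family_def, rule_format, of m k l n r t]
  show "\<phi> (Suc m, k, l, n, r, t) + \<i> * \<phi> (m, k, l, n, r, t) = \<phi> (m, k + 1, l, n, r, t)"
    "\<phi> (m, k, l, Suc n, r, t) + \<i> * \<phi> (m, k, l, n, r, t) = \<phi> (m, k, l, n, r + 1, t)"
    using rel by (intro *; simp)+
  show "\<phi> (Suc m, k, l, n, r, t) - \<i> * \<phi> (m, k, l, n, r, t) = \<phi> (m, k, l + 1, n, r, t)"
    "\<phi> (m, k, l, Suc n, r, t) - \<i> * \<phi> (m, k, l, n, r, t) = \<phi> (m, k, l, n, r, t + 1)"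
    using rel by (intro **; simp)+
qed

lemma phi_difference1:
  "\<phi> (m, k + 1, l, n, r, t) - \<phi> (m, k, l + 1, n, r, t) = 2 * \<i> * \<phi> (m, k, l, n, r, t)"
  unfolding phi_relations(1,2) [symmetric] by simp

lemma phi_difference2:
  "\<phi> (m, k, l, n, r + 1, t) - \<phi> (m, k, l, n, r, t + 1) = 2 * \<i> * \<phi> (m, k, l, n, r, t)"
  unfolding phi_relations(3,4) [symmetric] by simp

text \<open>The formal version of 2(x + i)(x - i) - (x - i)^2 - (x + i)^2 = -(2i)^2 = 4. On the
  torus it becomes multiplication by \<open>poisson\<close>.\<close>

lemma phi_laplace1:
  "2 * \<phi> (m, k + 1, l + 1, n, r, t) - \<phi> (m, k, l + 2, n, r, t) - \<phi> (m, k + 2, l, n, r, t) = 4 *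
      \<phi> (m, k, l, n, r, t)"
proof -
  have eq: "k + 1 + 1 = k + 2" "l + 1 + 1 = l + 2" by simp_all
  have *: "A - B = X \<Longrightarrow> B - C = Y \<Longrightarrow> 2 * B - C - A = Y - X" for A B C X Y :: complex
    by (elim subst) simp
  have "2 * \<phi> (m, k + 1, l + 1, n, r, t) - \<phi> (m, k, l + 2, n, r, t) - \<phi> (m, k + 2, l, n, r, t)
    = 2 * \<i> * \<phi> (m, k, l + 1, n, r, t) - 2 * \<i> * \<phi> (m, k + 1, l, n, r, t)"
    using phi_difference1[of m "k + 1" l n r t] phi_difference1[of m k "l + 1" n r t]
    unfolding eq by (rule *)
  also have "\<dots> = - 2 * \<i> * (\<phi> (m, k + 1, l, n, r, t) - \<phi> (m, k, l + 1, n, r, t))"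
    by (simp add: right_diff_distrib)
  also have "\<dots> = - 2 * \<i> * (2 * \<i> * \<phi> (m, k, l, n, r, t))"
    by (simp only: phi_difference1)
  finally show ?thesis by simp
qed

lemma phi_laplace2:
  "2 * \<phi> (m, k, l, n, r + 1, t + 1) - \<phi> (m, k, l, n, r, t + 2) - \<phi> (m, k, l, n, r + 2, t) = 4 *
      \<phi> (m, k, l, n, r, t)"
proof -
  have eq: "r + 1 + 1 = r + 2" "t + 1 + 1 = t + 2" by simp_all
  have *: "A - B = X \<Longrightarrow> B - C = Y \<Longrightarrow> 2 * B - C - A = Y - X" for A B C X Y :: complex
    by (elim subst) simp
  have "2 * \<phi> (m, k, l, n, r + 1, t + 1) - \<phi> (m, k, l, n, r, t + 2) - \<phi> (m, k, l, n, r + 2, t)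
    = 2 * \<i> * \<phi> (m, k, l, n, r, t + 1) - 2 * \<i> * \<phi> (m, k, l, n, r + 1, t)"
    using phi_difference2[of m k l n "r + 1" t] phi_difference2[of m k l n r "t + 1"]
    unfolding eq by (rule *)
  also have "\<dots> = - 2 * \<i> * (\<phi> (m, k, l, n, r + 1, t) - \<phi> (m, k, l, n, r, t + 1))"
    by (simp add: right_diff_distrib)
  also have "\<dots> = - 2 * \<i> * (2 * \<i> * \<phi> (m, k, l, n, r, t))"
    by (simp only: phi_difference2)
  finally show ?thesis by simp
qed

text \<open>The index belongs to the function (x1^2 + 1)^K (x2^2 + 1)^J cayley(x1)^a cayley(x2)^b.
  So \<open>\<nu>\<close> is meant to be the torus image of the measure sought, weighted with the
  density (x1^2 + 1)^K (x2^2 + 1)^J.\<close>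

definition represents :: "int \<Rightarrow> int \<Rightarrow> (complex \<times> complex) measure \<Rightarrow> bool" where
  "represents K J \<nu> \<longleftrightarrow> sets \<nu> = sets borel \<and> (AE z in \<nu>. cmod (fst z) = 1 \<and> cmod (snd z) = 1) \<and>
     (\<forall>a b. has_bochner_integral \<nu> (\<lambda>z. fst z powi a * snd z powi b) (\<phi> (0, K - a, K + a, 0,
         J - b, J + b)))"

text \<open>\<open>U p q\<close> plays the base vector (x1 + i)^K (x2 + i)^J times cayley(x1)^p
  cayley(x2)^q. Conjugation exchanges the exponents of x + i and x - i, so the Gram matrix depends
  on differences only, as Herglotz' theorem demands.\<close>

lemma represents_exists: "\<exists>\<nu>. represents K J \<nu>"
proof -
  define U where "U p q = f (0, K - p, p, 0, J - q, q)" for p q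
  have "cinner (U p q) (U p' q') = \<phi> (0, K - (p - p'), K + (p - p'), 0, J - (q - q'), J + (q - q'))"
    for p q p' q'
  proof -
    have "K - p + p' = K - (p - p')" "p + (K - p') = K + (p - p')"
      "J - q + q' = J - (q - q')" "q + (J - q') = J + (q - q')"
      by simp_all
    then show ?thesis
      unfolding U_def
      using gram[unfolded gram_function_def, rule_format,
          of 0 "K - p" p 0 "J - q" q 0 "K - p'" p' 0 "J - q'" q']
      by (simp only: add_0)
  qed
  note gram_U = this
  obtain \<nu> :: "(complex \<times> complex) measure" where "sets \<nu> = sets borel"
    "AE z in \<nu>. cmod (fst z) = 1 \<and> cmod (snd z) = 1"
    "\<And>a b. has_bochner_integral \<nu> (\<lambda>z. fst z powi a * snd z powi b) (\<phi> (0, K - a, K + a, 0, J - b,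
        J + b))"
    using herglotz_torus[of U "\<lambda>a b. \<phi> (0, K - a, K + a, 0, J - b, J + b)", OF gram_U] by blast
  then show ?thesis
    unfolding represents_def by blast
qed

lemma represents_unique: "represents K J \<nu> \<Longrightarrow> represents K J \<nu>' \<Longrightarrow> \<nu> = \<nu>'"
  unfolding represents_def
  by (rule torus_measure_unique[where c = "\<lambda>a b. \<phi> (0, K - a, K + a, 0, J - b, J + b)"]) auto

text \<open>On the circle \<open>4 * poisson z\<close> is 2 - z - 1/z. The density therefore
  combines three neighbouring Fourier coefficients, which \<open>phi_laplace1\<close> condenses to
  the coefficient for \<open>K\<close>.\<close>

lemma represents_density1:
  assumes "represents (K + 1) J \<nu>"
  shows "represents K J (density \<nu> (\<lambda>z. ennreal (poisson (fst z))))"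
proof -
  have sets: "sets \<nu> = sets borel"
    using assms by (simp add: represents_def)
  note ms = measurable_cong_sets[OF sets refl]
  have AE: "AE z in \<nu>. cmod (fst z) = 1 \<and> cmod (snd z) = 1"
    using assms by (simp add: represents_def)
  have mom: "has_bochner_integral \<nu> (\<lambda>z. fst z powi a * snd z powi b) (\<phi> (0, K + 1 - a, K + 1 + a,
      0, J - b, J + b))" for a b
    using assms by (simp add: represents_def)
  have "has_bochner_integral (density \<nu> (\<lambda>z. ennreal (poisson (fst z)))) (\<lambda>z. fst z powi a *
      snd z powi b) (\<phi> (0, K - a, K + a, 0, J - b, J + b))" for a b
  proof (rule has_bochner_integral_density)
    have "has_bochner_integral \<nu> (\<lambda>z. (2 * (fst z powi a * snd z powi b) - fst z powi (a + 1) *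
        snd z powi b - fst z powi (a - 1) * snd z powi b) / 4)
       ((2 * \<phi> (0, K + 1 - a, K + 1 + a, 0, J - b, J + b) - \<phi> (0, K + 1 - (a + 1), K + 1 + (a +
           1), 0, J - b, J + b) - \<phi> (0, K + 1 - (a - 1), K + 1 + (a - 1), 0, J - b, J + b)) / 4)"
      by (intro has_bochner_integral_divide_zero has_bochner_integral_diff
          has_bochner_integral_mult_right mom)
    also have "(2 * \<phi> (0, K + 1 - a, K + 1 + a, 0, J - b, J + b) - \<phi> (0, K + 1 - (a + 1), K + 1 +
        (a + 1), 0, J - b, J + b) - \<phi> (0, K + 1 - (a - 1), K + 1 + (a - 1), 0, J - b, J + b)) / 4
       = \<phi> (0, K - a, K + a, 0, J - b, J + b)"
    proof -
      have "K + 1 - a = (K - a) + 1" "K + 1 + a = (K + a) + 1" "K + 1 - (a + 1) = K - a"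
        "K + 1 + (a + 1) = (K + a) + 2" "K + 1 - (a - 1) = (K - a) + 2" "K + 1 + (a - 1) = K + a"
        by simp_all
      then show ?thesis
        by (simp only: phi_laplace1) simp
    qed
    finally have *: "has_bochner_integral \<nu> (\<lambda>z. (2 * (fst z powi a *
        snd z powi b) - fst z powi (a + 1) * snd z powi b - fst z powi (a - 1) * snd z powi b) / 4)
       (\<phi> (0, K - a, K + a, 0, J - b, J + b))" .
    have "AE z in \<nu>. (2 * (fst z powi a * snd z powi b) - fst z powi (a + 1) *
        snd z powi b - fst z powi (a - 1) * snd z powi b) / 4
        = poisson (fst z) *\<^sub>R (fst z powi a * snd z powi b)"
      using AE
    proof eventually_elim
      case (elim z)
      then have "fst z \<noteq> 0" by auto
      then show ?case
        unfolding scaleR_conv_of_real of_real_poisson[OF conjunct1[OF elim]]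
          diff_conv_add_uminus[of _ 1] power_int_add[OF disjI1, OF \<open>fst z \<noteq> 0\<close>] power_int_1_right
        by (simp add: left_diff_distrib right_diff_distrib mult_ac)
    qed
    then show "has_bochner_integral \<nu> (\<lambda>z. poisson (fst z) *\<^sub>R (fst z powi a * snd z powi b))
        (\<phi> (0, K - a, K + a, 0, J - b, J + b))"
      by (rule has_bochner_integral_AE_eq[OF *]) (unfold ms, measurable)
    show "(\<lambda>z. fst z powi a * snd z powi b) \<in> borel_measurable \<nu>"
      unfolding ms by measurable
    show "(\<lambda>z. poisson (fst z)) \<in> borel_measurable \<nu>"
      unfolding ms by measurable
  qed simp
  then show ?thesis
    using AE unfolding represents_def by (auto simp: AE_density ms sets elim: eventually_mono)
qed

lemma represents_density2:
  assumes "represents K (J + 1) \<nu>"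
  shows "represents K J (density \<nu> (\<lambda>z. ennreal (poisson (snd z))))"
proof -
  have sets: "sets \<nu> = sets borel"
    using assms by (simp add: represents_def)
  note ms = measurable_cong_sets[OF sets refl]
  have AE: "AE z in \<nu>. cmod (fst z) = 1 \<and> cmod (snd z) = 1"
    using assms by (simp add: represents_def)
  have mom: "has_bochner_integral \<nu> (\<lambda>z. fst z powi a * snd z powi b) (\<phi> (0, K - a, K + a, 0, J +
      1 - b, J + 1 + b))" for a b
    using assms by (simp add: represents_def)
  have "has_bochner_integral (density \<nu> (\<lambda>z. ennreal (poisson (snd z)))) (\<lambda>z. fst z powi a *
      snd z powi b) (\<phi> (0, K - a, K + a, 0, J - b, J + b))" for a b
  proof (rule has_bochner_integral_density)
    have "has_bochner_integral \<nu> (\<lambda>z. (2 * (fst z powi a * snd z powi b) - fst z powi a *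
        snd z powi (b + 1) - fst z powi a * snd z powi (b - 1)) / 4)
       ((2 * \<phi> (0, K - a, K + a, 0, J + 1 - b, J + 1 + b) - \<phi> (0, K - a, K + a, 0, J + 1 - (b +
           1), J + 1 + (b + 1)) - \<phi> (0, K - a, K + a, 0, J + 1 - (b - 1), J + 1 + (b - 1))) / 4)"
      by (intro has_bochner_integral_divide_zero has_bochner_integral_diff
          has_bochner_integral_mult_right mom)
    also have "(2 * \<phi> (0, K - a, K + a, 0, J + 1 - b, J + 1 + b) - \<phi> (0, K - a, K + a, 0, J +
        1 - (b + 1), J + 1 + (b + 1)) - \<phi> (0, K - a, K + a, 0, J + 1 - (b - 1), J + 1 + (b - 1)))
        / 4
       = \<phi> (0, K - a, K + a, 0, J - b, J + b)"
    proof -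
      have "J + 1 - b = (J - b) + 1" "J + 1 + b = (J + b) + 1" "J + 1 - (b + 1) = J - b"
        "J + 1 + (b + 1) = (J + b) + 2" "J + 1 - (b - 1) = (J - b) + 2" "J + 1 + (b - 1) = J + b"
        by simp_all
      then show ?thesis
        by (simp only: phi_laplace2) simp
    qed
    finally have *: "has_bochner_integral \<nu> (\<lambda>z. (2 * (fst z powi a *
        snd z powi b) - fst z powi a * snd z powi (b + 1) - fst z powi a * snd z powi (b - 1)) / 4)
       (\<phi> (0, K - a, K + a, 0, J - b, J + b))" .
    have "AE z in \<nu>. (2 * (fst z powi a * snd z powi b) - fst z powi a * snd z powi (b +
        1) - fst z powi a * snd z powi (b - 1)) / 4
        = poisson (snd z) *\<^sub>R (fst z powi a * snd z powi b)"
      using AE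
    proof eventually_elim
      case (elim z)
      then have "snd z \<noteq> 0" by auto
      then show ?case
        unfolding scaleR_conv_of_real of_real_poisson[OF conjunct2[OF elim]]
          diff_conv_add_uminus[of _ 1] power_int_add[OF disjI1, OF \<open>snd z \<noteq> 0\<close>] power_int_1_right
        by (simp add: left_diff_distrib right_diff_distrib mult_ac)
    qed
    then show "has_bochner_integral \<nu> (\<lambda>z. poisson (snd z) *\<^sub>R (fst z powi a * snd z powi b))
        (\<phi> (0, K - a, K + a, 0, J - b, J + b))"
      by (rule has_bochner_integral_AE_eq[OF *]) (unfold ms, measurable)
    show "(\<lambda>z. fst z powi a * snd z powi b) \<in> borel_measurable \<nu>"
      unfolding ms by measurable
    show "(\<lambda>z. poisson (snd z)) \<in> borel_measurable \<nu>"
      unfolding ms by measurable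
  qed simp
  then show ?thesis
    using AE unfolding represents_def by (auto simp: AE_density ms sets elim: eventually_mono)
qed

lemma represents_density:
  assumes "represents (int K) (int J) \<nu>"
  shows "represents 0 0 (density \<nu> (\<lambda>z. ennreal (poisson (fst z) ^ K * poisson (snd z) ^ J)))"
  using assms
proof (induction K arbitrary: \<nu>)
  case 0
  then show ?case
  proof (induction J arbitrary: \<nu>)
    case 0
    then show ?case by (simp add: density_1)
  next
    case (Suc J)
    have sets: "sets \<nu> = sets borel"
      using Suc.prems by (simp add: represents_def)
    note ms = measurable_cong_sets[OF sets refl]
    have "represents (int 0) (int J) (density \<nu> (\<lambda>z. ennreal (poisson (snd z))))"
      using represents_density2[of 0 "int J" \<nu>] Suc.prems by (simp add: algebra_simps)
    from Suc.IH[OF this] show ?case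
      by (subst (asm) density_density_eq) (auto simp: ennreal_mult' ms)
  qed
next
  case (Suc K)
  have sets: "sets \<nu> = sets borel"
    using Suc.prems by (simp add: represents_def)
  note ms = measurable_cong_sets[OF sets refl]
  have "represents (int K) (int J) (density \<nu> (\<lambda>z. ennreal (poisson (fst z))))"
    using represents_density1[of "int K" "int J" \<nu>] Suc.prems by (simp add: algebra_simps)
  from Suc.IH[OF this] show ?case
    by (subst (asm) density_density_eq) (auto simp: ennreal_mult' mult.assoc ms)
qed

text \<open>A measure with the density \<open>poisson\<close> does not charge \<open>z = 1\<close>, the image of infinity.\<close>

lemma represents_AE:
  assumes "represents K J \<nu>"
  shows "AE z in \<nu>. cmod (fst z) = 1 \<and> cmod (snd z) = 1 \<and> fst z \<noteq> 1 \<and> snd z \<noteq> 1"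
proof -
  obtain \<nu>1 \<nu>2 where \<nu>: "represents (K + 1) J \<nu>1" "represents K (J + 1) \<nu>2"
    using represents_exists by metis
  then have "sets \<nu>1 = sets borel" "sets \<nu>2 = sets borel"
    by (auto simp: represents_def)
  note ms = measurable_cong_sets[OF this(1) refl] and ms' = measurable_cong_sets[OF this(2) refl]
  have "AE z in density \<nu>1 (\<lambda>z. ennreal (poisson (fst z))). fst z \<noteq> 1"
    by (subst AE_density) (auto simp: less_le ms ms')
  then have 1: "AE z in \<nu>. fst z \<noteq> 1"
    by (simp only: represents_unique[OF represents_density1[OF \<nu>(1)] assms])
  have "AE z in density \<nu>2 (\<lambda>z. ennreal (poisson (snd z))). snd z \<noteq> 1"
    by (subst AE_density) (auto simp: less_le ms ms')
  then have 2: "AE z in \<nu>. snd z \<noteq> 1"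
    by (simp only: represents_unique[OF represents_density2[OF \<nu>(2)] assms])
  have "AE z in \<nu>. cmod (fst z) = 1 \<and> cmod (snd z) = 1"
    using assms by (simp add: represents_def)
  with 1 2 show ?thesis
    by eventually_elim auto
qed

text \<open>By uniqueness the measure for exponents 0, 0 is the one for \<open>K\<close>,
  \<open>J\<close> with powers of \<open>poisson\<close> as density. Cancelling these powers against
  the growth of \<open>chi\<close> yields the moments with \<open>k + l = 2 * K\<close> and
  \<open>r + t = 2 * J\<close>. Differences lower the exponent sums, and x = (x + i) - i supplies
  the powers of x.\<close>

theorem rational_solution_exists: "\<exists>\<mu>. \<mu> \<in> rational_solutions \<phi>"
proof -
  obtain \<nu> where \<nu>: "represents 0 0 \<nu>"
    using represents_exists by blast
  then have sets: "sets \<nu> = sets borel"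
    by (simp add: represents_def)
  note ms = measurable_cong_sets[OF sets refl]
  define \<mu> where "\<mu> = distr \<nu> borel torus_to_plane"
  define good where "good x \<longleftrightarrow> has_bochner_integral \<mu> (chi x) (\<phi> x)" for x
  have base: "good (0, int K - a, int K + a, 0, int J - b, int J + b)" for K J a b
  proof -
    let ?x = "(0, int K - a, int K + a, 0, int J - b, int J + b) :: index"
    obtain \<nu>' where \<nu>': "represents (int K) (int J) \<nu>'"
      using represents_exists by blast
    then have "sets \<nu>' = sets borel"
      by (simp add: represents_def)
    note ms' = measurable_cong_sets[OF this refl]
    have eq: "\<nu> = density \<nu>' (\<lambda>z. ennreal (poisson (fst z) ^ K * poisson (snd z) ^ J))"
      by (rule represents_unique[OF \<nu> represents_density[OF \<nu>']])
    have A: "AE z in \<nu>'. fst z powi a * snd z powi b = (poisson (fst z) ^ K *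
        poisson (snd z) ^ J) *\<^sub>R chi ?x (torus_to_plane z)"
      using represents_AE[OF \<nu>']
    proof eventually_elim
      case (elim z)
      then show ?case
        unfolding ratio_inv_cayley[of "fst z" K a, symmetric,
            OF conjunct1[OF elim] conjunct1[OF conjunct2[OF conjunct2[OF elim]]]]
          ratio_inv_cayley[of "snd z" J b, symmetric,
              OF conjunct1[OF conjunct2[OF elim]] conjunct2[OF conjunct2[OF conjunct2[OF elim]]]]
        by (simp add: chi_def torus_to_plane_def scaleR_conv_of_real mult_ac)
    qed
    have B: "has_bochner_integral \<nu>' (\<lambda>z. fst z powi a * snd z powi b) (\<phi> ?x)"
      using \<nu>' by (simp add: represents_def)
    have C: "(\<lambda>z. (poisson (fst z) ^ K * poisson (snd z) ^ J) *\<^sub>R chi ?x (torus_to_plane z))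
        \<in> borel_measurable \<nu>'"
      unfolding ms' by measurable
    have "has_bochner_integral \<nu>' (\<lambda>z. (poisson (fst z) ^ K *
        poisson (snd z) ^ J) *\<^sub>R chi ?x (torus_to_plane z)) (\<phi> ?x)"
      by (rule has_bochner_integral_AE_eq[OF B A C])
    then have "has_bochner_integral \<nu> (\<lambda>z. chi ?x (torus_to_plane z)) (\<phi> ?x)"
      unfolding eq by (intro has_bochner_integral_density) (auto simp: ms')
    then show ?thesis
      unfolding good_def \<mu>_def by (intro has_bochner_integral_distr) (auto simp: ms)
  qed
  have down1: "good (m, k, l, n, r, t)" if "good (m, k + 1, l, n, r, t)" "good (m, k, l + 1, n, r,
      t)" for m k l n r t
  proof -
    have "has_bochner_integral \<mu> (\<lambda>p. (chi (m, k + 1, l, n, r, t) p - chi (m, k, l + 1, n, r,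
        t) p) / (2 * \<i>))
      ((\<phi> (m, k + 1, l, n, r, t) - \<phi> (m, k, l + 1, n, r, t)) / (2 * \<i>))"
      using that unfolding good_def
      by (intro has_bochner_integral_divide_zero has_bochner_integral_diff)
    moreover have "(chi (m, k + 1, l, n, r, t) p - chi (m, k, l + 1, n, r, t) p) / (2 * \<i>) =
        chi (m, k, l, n, r, t) p" for p
      by (rule chi_differences)
    ultimately show ?thesis
      unfolding phi_difference1 good_def by simp
  qed
  have down2: "good (m, k, l, n, r, t)" if "good (m, k, l, n, r + 1, t)" "good (m, k, l, n, r, t +
      1)" for m k l n r t
  proof -
    have "has_bochner_integral \<mu> (\<lambda>p. (chi (m, k, l, n, r + 1, t) p - chi (m, k, l, n, r, t +
        1) p) / (2 * \<i>))
      ((\<phi> (m, k, l, n, r + 1, t) - \<phi> (m, k, l, n, r, t + 1)) / (2 * \<i>))"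
      using that unfolding good_def
      by (intro has_bochner_integral_divide_zero has_bochner_integral_diff)
    moreover have "(chi (m, k, l, n, r + 1, t) p - chi (m, k, l, n, r, t + 1) p) / (2 * \<i>) =
        chi (m, k, l, n, r, t) p" for p
      by (rule chi_differences)
    ultimately show ?thesis
      unfolding phi_difference2 good_def by simp
  qed
  have all1: "good (0, k, l, 0, int J - b, int J + b)" for k l J b
  proof -
    \<comment> \<open>Induction on the deficit \<open>d\<close>: each use of \<open>down1\<close>
      asks for two functions whose exponent sum is larger by one, until the even sum
      \<open>2 * K\<close> is reached.\<close>
    have "good (0, k, l, 0, int J - b, int J + b)" if "k + l = 2 * int K - int d" for d K k l
      using that
    proof (induction d arbitrary: k l)
      case 0
      then have "int K - (int K - k) = k" "int K + (int K - k) = l" by simp_all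
      then show ?case
        using base[of K "int K - k" J b] by simp
    next
      case (Suc d)
      show ?case
        by (rule down1; rule Suc.IH) (use Suc.prems in auto)
    qed
    moreover have "k + l = 2 * int (nat \<bar>k + l\<bar>) - int (nat (2 * \<bar>k + l\<bar> - (k + l)))"
      by (cases "k + l \<ge> 0") auto
    ultimately show ?thesis .
  qed
  have all2: "good (0, k, l, 0, r, t)" for k l r t
  proof -
    have "good (0, k, l, 0, r, t)" if "r + t = 2 * int J - int d" for d J r t
      using that
    proof (induction d arbitrary: r t)
      case 0
      then have "int J - (int J - r) = r" "int J + (int J - r) = t" by simp_all
      then show ?case
        using all1[of k l J "int J - r"] by simp
    next
      case (Suc d)
      show ?case
        by (rule down2; rule Suc.IH) (use Suc.prems in auto)
    qed
    moreover have "r + t = 2 * int (nat \<bar>r + t\<bar>) - int (nat (2 * \<bar>r + t\<bar> - (r + t)))"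
      by (cases "r + t \<ge> 0") auto
    ultimately show ?thesis .
  qed
  have all3: "good (m, k, l, 0, r, t)" for m k l r t
  \<comment> \<open>One power of x is (x + i) - i, which raises \<open>k\<close>; hence the
    generalisation.\<close>
  proof (induction m arbitrary: k)
    case (Suc m)
    have "has_bochner_integral \<mu> (\<lambda>p. chi (m, k + 1, l, 0, r, t) p - \<i> * chi (m, k, l, 0, r, t) p)
      (\<phi> (m, k + 1, l, 0, r, t) - \<i> * \<phi> (m, k, l, 0, r, t))"
      using Suc unfolding good_def
      by (intro has_bochner_integral_diff has_bochner_integral_mult_right)
    moreover have "chi (m, k + 1, l, 0, r, t) p - \<i> * chi (m, k, l, 0, r, t) p = chi (Suc m, k, l,
        0, r, t) p" for p
      unfolding chi_relations [symmetric] by simp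
    ultimately show ?case
      unfolding good_def phi_relations(1)[symmetric] by simp
  qed (rule all2)
  have all4: "good (m, k, l, n, r, t)" for m k l n r t
  proof (induction n arbitrary: r)
    case (Suc n)
    have "has_bochner_integral \<mu> (\<lambda>p. chi (m, k, l, n, r + 1, t) p - \<i> * chi (m, k, l, n, r, t) p)
      (\<phi> (m, k, l, n, r + 1, t) - \<i> * \<phi> (m, k, l, n, r, t))"
      using Suc unfolding good_def
      by (intro has_bochner_integral_diff has_bochner_integral_mult_right)
    moreover have "chi (m, k, l, n, r + 1, t) p - \<i> * chi (m, k, l, n, r, t) p = chi (m, k, l,
        Suc n, r, t) p" for p
      unfolding chi_relations [symmetric] by simp
    ultimately show ?case
      unfolding good_def phi_relations(3)[symmetric] by simp
  qed (rule all3)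
  have "\<mu> \<in> rational_solutions \<phi>"
    unfolding rational_solutions_altdef using all4 by (auto simp: good_def \<mu>_def)
  then show ?thesis ..
qed

end

section \<open>Orthonormal expansions and Gram-Schmidt bases\<close>

lemma cspan_closure_orthogonal:
  fixes x :: "'h::complex_hilbert_space"
  assumes "\<And>y. y \<in> B \<Longrightarrow> cinner x y = 0" "z \<in> closure (cspan B)"
  shows "cinner x z = 0"
proof -
  have "cinner x y = 0" if "y \<in> cspan B" for y
    using that
    by (induction rule: cvec.span_induct_alt) (simp_all add: assms(1) cinner_add_right
        cinner_scaleC_right)
  then have "cspan B \<subseteq> {y. cinner x y = 0}"
    by blast
  moreover have "closed {y. cinner x y = 0}"
    by (intro closed_Collect_eq continuous_on_const linear_continuous_on
        bounded_linear_cinner_right)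
  ultimately show ?thesis
    using assms(2) closure_minimal by blast
qed

lemma
  fixes B :: "'h::complex_hilbert_space set"
  shows closure_cspan_zero: "0 \<in> closure (cspan B)"
    and closure_cspan_add: "x \<in> closure (cspan B) \<Longrightarrow> y \<in> closure (cspan B) \<Longrightarrow> x +
        y \<in> closure (cspan B)"
    and closure_cspan_scale: "x \<in> closure (cspan B) \<Longrightarrow> c *\<^sub>C x \<in> closure (cspan B)"
proof -
  show "0 \<in> closure (cspan B)"
    using closure_subset cvec.span_zero by blast
next
  assume "x \<in> closure (cspan B)" "y \<in> closure (cspan B)"
  then obtain X Y where "\<And>n. X n \<in> cspan B" "X \<longlonglongrightarrow> x" "\<And>n. Y n \<in> cspan B" "Y \<longlonglongrightarrow> y"
    unfolding closure_sequential by blast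
  then have "(\<forall>n. X n + Y n \<in> cspan B) \<and> (\<lambda>n. X n + Y n) \<longlonglongrightarrow> x + y"
    by (auto intro: cvec.span_add tendsto_add)
  then show "x + y \<in> closure (cspan B)"
    unfolding closure_sequential by (intro exI[of _ "\<lambda>n. X n + Y n"]) simp
next
  assume "x \<in> closure (cspan B)"
  then obtain X where "\<And>n. X n \<in> cspan B" "X \<longlonglongrightarrow> x"
    unfolding closure_sequential by blast
  then have "(\<forall>n. c *\<^sub>C X n \<in> cspan B) \<and> (\<lambda>n. c *\<^sub>C X n) \<longlonglongrightarrow> c *\<^sub>C x"
    by (auto intro: cvec.span_scale bounded_linear.tendsto[OF bounded_linear_scaleC])
  then show "c *\<^sub>C x \<in> closure (cspan B)"
    unfolding closure_sequential by (intro exI[of _ "\<lambda>n. c *\<^sub>C X n"]) simp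
qed

lemma closure_cspan_diff:
  fixes B :: "'h::complex_hilbert_space set"
  assumes "x \<in> closure (cspan B)" "y \<in> closure (cspan B)"
  shows "x - y \<in> closure (cspan B)"
  using closure_cspan_add[OF assms(1) closure_cspan_scale[OF assms(2), of "-1"]]
  by (simp add: cvec.scale_minus_left)

lemma closure_cspan_base: "x \<in> B \<Longrightarrow> x \<in> closure (cspan B)"
  using closure_subset cvec.span_base by blast

lemma norm_sum_orthonormal:
  fixes g :: "nat \<Rightarrow> 'h::complex_hilbert_space"
  assumes "\<And>i j. i \<in> F \<Longrightarrow> j \<in> F \<Longrightarrow> cinner (g i) (g j) = (if i = j then 1 else 0)" "finite F"
  shows "(norm (\<Sum>i\<in>F. \<alpha> i *\<^sub>C g i))\<^sup>2 = (\<Sum>i\<in>F. (cmod (\<alpha> i))\<^sup>2)"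
proof -
  have "complex_of_real ((norm (\<Sum>i\<in>F. \<alpha> i *\<^sub>C g i))\<^sup>2) = (\<Sum>i\<in>F. \<Sum>j\<in>F. \<alpha> i * (cnj (\<alpha> j) *
      cinner (g i) (g j)))"
    unfolding cinner_self [symmetric] cinner_sum_left
    by (simp add: cinner_sum_right cinner_scaleC_left cinner_scaleC_right sum_distrib_left mult_ac)
  also have "\<dots> = (\<Sum>i\<in>F. \<Sum>j\<in>F. if j = i then \<alpha> i * cnj (\<alpha> i) else 0)"
    by (intro sum.cong refl) (auto simp: assms(1))
  also have "\<dots> = of_real (\<Sum>i\<in>F. (cmod (\<alpha> i))\<^sup>2)"
    unfolding of_real_sum complex_norm_square using assms(2) by simp
  finally show ?thesis
    by (simp only: of_real_eq_iff)
qed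

locale orthonormal =
  fixes g :: "nat \<Rightarrow> 'h::complex_hilbert_space" and I :: "nat set"
  assumes ortho: "\<And>i j. i \<in> I \<Longrightarrow> j \<in> I \<Longrightarrow> cinner (g i) (g j) = (if i = j then 1 else 0)"
begin

lemma cinner_partial_sum:
  assumes "F \<subseteq> I" "finite F" "m \<in> I"
  shows "cinner (\<Sum>i\<in>F. \<alpha> i *\<^sub>C g i) (g m) = (if m \<in> F then \<alpha> m else 0)"
proof -
  have "cinner (\<Sum>i\<in>F. \<alpha> i *\<^sub>C g i) (g m) = (\<Sum>i\<in>F. if i = m then \<alpha> m else 0)"
    unfolding cinner_sum_left cinner_scaleC_left
    by (intro sum.cong refl) (use assms ortho in auto)
  then show ?thesis
    using assms by simp
qed

lemma norm_diff_partial_sum: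
  assumes "F \<subseteq> I" "finite F"
  shows "(norm (v - (\<Sum>i\<in>F. cinner v (g i) *\<^sub>C g i)))\<^sup>2 =
      (norm v)\<^sup>2 - (\<Sum>i\<in>F. (cmod (cinner v (g i)))\<^sup>2)"
proof -
  let ?s = "\<Sum>i\<in>F. cinner v (g i) *\<^sub>C g i"
  have s: "(norm ?s)\<^sup>2 = (\<Sum>i\<in>F. (cmod (cinner v (g i)))\<^sup>2)"
    by (rule norm_sum_orthonormal) (use assms in \<open>auto simp: ortho subset_iff\<close>)
  have "cinner v ?s = of_real (\<Sum>i\<in>F. (cmod (cinner v (g i)))\<^sup>2)"
    unfolding of_real_sum complex_norm_square
    by (simp add: cinner_sum_right cinner_scaleC_right mult.commute)
  then have "inner v ?s = (norm ?s)\<^sup>2"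
    by (simp add: inner_cinner s)
  then show ?thesis
    unfolding s [symmetric] by (simp add: power2_norm_eq_inner inner_diff_left inner_diff_right
        inner_commute)
qed

lemma bessel:
  assumes "F \<subseteq> I" "finite F"
  shows "(\<Sum>i\<in>F. (cmod (cinner v (g i)))\<^sup>2) \<le> (norm v)\<^sup>2"
proof -
  have "0 \<le> (norm v)\<^sup>2 - (\<Sum>i\<in>F. (cmod (cinner v (g i)))\<^sup>2)"
    unfolding norm_diff_partial_sum[OF assms, symmetric] by simp
  then show ?thesis by simp
qed

lemma bessel_summable: "(\<lambda>i. (cmod (cinner v (g i)))\<^sup>2) summable_on I"
  by (rule nonneg_bdd_above_summable_on) (auto intro!: bdd_aboveI2 bessel)

text \<open>The squared distance of \<open>v\<close> to a partial sum is the squared norm of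
  \<open>v\<close> minus a partial sum of squares, so Parseval's identity is the same as
  convergence.\<close>

lemma has_sumI:
  assumes \<alpha>: "\<And>i. i \<in> I \<Longrightarrow> cinner v (g i) = \<alpha> i"
    and norm: "((\<lambda>i. (cmod (\<alpha> i))\<^sup>2) has_sum (norm v)\<^sup>2) I"
  shows "((\<lambda>i. \<alpha> i *\<^sub>C g i) has_sum v) I"
proof -
  have "((\<lambda>F. (norm v)\<^sup>2 - (\<Sum>i\<in>F. (cmod (\<alpha> i))\<^sup>2))
      \<longlongrightarrow> (norm v)\<^sup>2 - (norm v)\<^sup>2) (finite_subsets_at_top I)"
    using norm by (intro tendsto_intros) (simp add: has_sum_def)
  moreover have "eventually (\<lambda>F. (norm v)\<^sup>2 - (\<Sum>i\<in>F. (cmod (\<alpha> i))\<^sup>2) =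
      (norm (v - (\<Sum>i\<in>F. \<alpha> i *\<^sub>C g i)))\<^sup>2) (finite_subsets_at_top I)"
  proof (rule eventually_finite_subsets_at_top_weakI)
    fix F assume F: "finite F" "F \<subseteq> I"
    have "(\<Sum>i\<in>F. (cmod (\<alpha> i))\<^sup>2) = (\<Sum>i\<in>F. (cmod (cinner v (g i)))\<^sup>2)"
      "(\<Sum>i\<in>F. \<alpha> i *\<^sub>C g i) = (\<Sum>i\<in>F. cinner v (g i) *\<^sub>C g i)"
      by (rule sum.cong; use F \<alpha> in force)+
    then show "(norm v)\<^sup>2 - (\<Sum>i\<in>F. (cmod (\<alpha> i))\<^sup>2) = (norm (v - (\<Sum>i\<in>F. \<alpha> i *\<^sub>C g i)))\<^sup>2"
      using norm_diff_partial_sum[OF F(2,1)] by simp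
  qed
  ultimately have "((\<lambda>F. (norm (v - (\<Sum>i\<in>F. \<alpha> i *\<^sub>C g i)))\<^sup>2) \<longlongrightarrow> 0) (finite_subsets_at_top I)"
    by (simp add: tendsto_cong)
  then have "((\<lambda>F. sqrt ((norm (v - (\<Sum>i\<in>F. \<alpha> i *\<^sub>C g i)))\<^sup>2)) \<longlongrightarrow> sqrt 0) (finite_subsets_at_top I)"
    by (rule tendsto_real_sqrt)
  then have "((\<lambda>F. norm ((\<Sum>i\<in>F. \<alpha> i *\<^sub>C g i) - v)) \<longlongrightarrow> 0) (finite_subsets_at_top I)"
    by (simp add: norm_minus_commute)
  then show ?thesis
    unfolding has_sum_def using Lim_null tendsto_norm_zero_iff by blast
qed

text \<open>Sums over initial segments are Cauchy, their squared distances being differences of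
  partial sums of squares. Completeness gives \<open>v\<close>, and \<open>has_sumI\<close> upgrades
  to unordered convergence.\<close>

lemma riesz_fischer:
  assumes "(\<lambda>i. (cmod (\<alpha> i))\<^sup>2) summable_on I"
  obtains v where "v \<in> closure (cspan (g ` I))" "\<And>i. i \<in> I \<Longrightarrow> cinner v (g i) = \<alpha> i"
    "((\<lambda>i. (cmod (\<alpha> i))\<^sup>2) has_sum (norm v)\<^sup>2) I" "((\<lambda>i. \<alpha> i *\<^sub>C g i) has_sum v) I"
proof -
  define J where "J n = I \<inter> {..<n}" for n :: nat
  have J: "finite (J n)" "J n \<subseteq> I" for n
    by (auto simp: J_def)
  define T where "T n = (\<Sum>i\<in>J n. (cmod (\<alpha> i))\<^sup>2)" for n
  define S where "S n = (\<Sum>i\<in>J n. \<alpha> i *\<^sub>C g i)" for n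
  \<comment> \<open>Initial segments are cofinal among the finite subsets of \<open>I\<close>, so
    the unordered sum of squares is a sequential limit.\<close>
  have "filterlim J (finite_subsets_at_top I) sequentially"
    unfolding filterlim_def le_filter_def eventually_filtermap eventually_finite_subsets_at_top
  proof (intro allI impI)
    fix P assume "\<exists>X. finite X \<and> X \<subseteq> I \<and> (\<forall>Y. finite Y \<and> X \<subseteq> Y \<and> Y \<subseteq> I \<longrightarrow> P Y)"
    then obtain X where X: "finite X" "X \<subseteq> I" "\<forall>Y. finite Y \<and> X \<subseteq> Y \<and> Y \<subseteq> I \<longrightarrow> P Y"
      by (elim exE conjE)
    obtain N where "X \<subseteq> {..<N}"
      using finite_nat_bounded[OF X(1)] by blast
    then have "P (J n)" if "n \<ge> N" for n
      using that X(2) by (intro X(3)[rule_format]) (auto simp: J_def)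
    then show "eventually (\<lambda>n. P (J n)) sequentially"
      by (auto simp: eventually_sequentially)
  qed
  moreover obtain t where t: "((\<lambda>i. (cmod (\<alpha> i))\<^sup>2) has_sum t) I"
    using assms by (auto simp: summable_on_def)
  ultimately have T: "T \<longlonglongrightarrow> t"
    unfolding T_def has_sum_def by (rule filterlim_compose[rotated])
  have dist_S: "(norm (S n - S m))\<^sup>2 = T n - T m" if "m \<le> n" for m n
  proof -
    have sub: "J m \<subseteq> J n"
      using that by (auto simp: J_def)
    have "S n - S m = (\<Sum>i\<in>J n - J m. \<alpha> i *\<^sub>C g i)"
      unfolding S_def using J sub by (simp add: sum_diff)
    moreover have "(norm (\<Sum>i\<in>J n - J m. \<alpha> i *\<^sub>C g i))\<^sup>2 = (\<Sum>i\<in>J n - J m. (cmod (\<alpha> i))\<^sup>2)"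
      using J by (intro norm_sum_orthonormal) (auto simp: ortho subset_iff)
    ultimately have "(norm (S n - S m))\<^sup>2 = (\<Sum>i\<in>J n - J m. (cmod (\<alpha> i))\<^sup>2)"
      by simp
    also have "\<dots> = T n - T m"
      unfolding T_def using J sub by (simp add: sum_diff)
    finally show ?thesis .
  qed
  have "Cauchy S"
  proof (rule metric_CauchyI)
    fix e :: real assume "e > 0"
    then obtain M where M: "\<And>m n. m \<ge> M \<Longrightarrow> n \<ge> M \<Longrightarrow> dist (T m) (T n) < e\<^sup>2"
      using metric_CauchyD[OF LIMSEQ_imp_Cauchy[OF T], of "e\<^sup>2"] by auto
    have "norm (S n - S m) < e" if "M \<le> m" "m \<le> n" for m n
    proof -
      have "(norm (S n - S m))\<^sup>2 < e\<^sup>2"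
        unfolding dist_S[OF that(2)] using M[of n m] that by (simp add: dist_real_def)
      then show ?thesis
        by (rule power_less_imp_less_base) (use \<open>e > 0\<close> in simp)
    qed
    note close = this
    have "dist (S m) (S n) < e" if "M \<le> m" "M \<le> n" for m n
      using close[of m n] close[of n m] that norm_minus_commute[of "S m" "S n"]
      by (cases m n rule: le_cases) (auto simp: dist_norm)
    then show "\<exists>M. \<forall>m\<ge>M. \<forall>n\<ge>M. dist (S m) (S n) < e"
      by blast
  qed
  then obtain v where v: "S \<longlonglongrightarrow> v"
    using Cauchy_convergent_iff convergent_def by blast
  have coeff: "cinner v (g i) = \<alpha> i" if "i \<in> I" for i
  proof (rule LIMSEQ_unique)
    show "(\<lambda>n. cinner (S n) (g i)) \<longlonglongrightarrow> cinner v (g i)"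
      by (rule bounded_linear.tendsto[OF bounded_linear_cinner_left v])
    have "eventually (\<lambda>n. cinner (S n) (g i) = \<alpha> i) sequentially"
      using eventually_gt_at_top[of i]
      by eventually_elim (use that J in \<open>simp add: S_def cinner_partial_sum J_def\<close>)
    then show "(\<lambda>n. cinner (S n) (g i)) \<longlonglongrightarrow> \<alpha> i"
      by (rule tendsto_eventually)
  qed
  have "(\<lambda>n. (norm (S n))\<^sup>2) \<longlonglongrightarrow> (norm v)\<^sup>2"
    by (intro tendsto_intros v)
  moreover have "(norm (S n))\<^sup>2 = T n" for n
    unfolding S_def T_def using J by (intro norm_sum_orthonormal) (auto simp: ortho subset_iff)
  ultimately have "t = (norm v)\<^sup>2"
    using LIMSEQ_unique[OF T] by simp
  then have norm: "((\<lambda>i. (cmod (\<alpha> i))\<^sup>2) has_sum (norm v)\<^sup>2) I"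
    using t by simp
  have "S n \<in> cspan (g ` I)" for n
    unfolding S_def using J by (intro cvec.span_sum cvec.span_scale cvec.span_base) auto
  then have "v \<in> closure (cspan (g ` I))"
    using v closure_sequential by blast
  then show ?thesis
    using that coeff norm has_sumI[OF coeff norm] by blast
qed

text \<open>The vector rebuilt from the coefficients differs from \<open>v\<close> by an element of
  the closed span that is orthogonal to this span.\<close>

lemma expansion:
  assumes "v \<in> closure (cspan (g ` I))"
  shows "((\<lambda>i. cinner v (g i) *\<^sub>C g i) has_sum v) I"
    and "((\<lambda>i. (cmod (cinner v (g i)))\<^sup>2) has_sum (norm v)\<^sup>2) I"
proof -
  obtain w where w: "w \<in> closure (cspan (g ` I))" "\<And>i. i \<in> I \<Longrightarrow> cinner w (g i) = cinner v (g i)"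
    "((\<lambda>i. (cmod (cinner v (g i)))\<^sup>2) has_sum (norm w)\<^sup>2) I" "((\<lambda>i. cinner v (g i) *\<^sub>C g i)
        has_sum w) I"
    using riesz_fischer[OF bessel_summable[of v]] by blast
  have "cinner (v - w) (v - w) = 0"
  proof (rule cspan_closure_orthogonal)
    show "v - w \<in> closure (cspan (g ` I))"
      by (rule closure_cspan_diff[OF assms w(1)])
    show "cinner (v - w) y = 0" if "y \<in> g ` I" for y
      using that w(2) by (auto simp: cinner_diff_left)
  qed
  then have "w = v" by simp
  with w show "((\<lambda>i. cinner v (g i) *\<^sub>C g i) has_sum v) I"
    "((\<lambda>i. (cmod (cinner v (g i)))\<^sup>2) has_sum (norm v)\<^sup>2) I"
    by simp_all
qed

end

text \<open>Proportionality both ways, in a form that includes the degenerate case in which both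
  vectors vanish.\<close>

lemma gs_scaleC:
  "\<exists>c. gs x n = c *\<^sub>C (x n - (\<Sum>k<n. cinner (x n) (gs x k) *\<^sub>C gs x k)) \<and>
       x n - (\<Sum>k<n. cinner (x n) (gs x k) *\<^sub>C gs x k) \<in> range (\<lambda>d. d *\<^sub>C gs x n)"
proof -
  define y where "y = x n - (\<Sum>k<n. cinner (x n) (gs x k) *\<^sub>C gs x k)"
  have gs: "gs x n = complex_of_real (inverse (norm y)) *\<^sub>C y"
    unfolding y_def by (subst gs.simps) (simp only: sgn_div_norm scaleR_scaleC)
  have "y = complex_of_real (norm y) *\<^sub>C gs x n"
    by (cases "y = 0") (simp_all add: gs scaleC_scaleC)
  with gs show ?thesis
    unfolding y_def by blast
qed

lemma gs_orthonormal:
  "cinner (gs x i) (gs x j) = (if i = j \<and> gs x i \<noteq> 0 then 1 else 0)"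
proof -
  have norm: "cinner (gs x n) (gs x n) = (if gs x n \<noteq> 0 then 1 else 0)" for n
  proof (cases "gs x n = 0")
    case False
    then have "norm (gs x n) = 1"
      by (subst gs.simps, subst (asm) gs.simps) (simp add: norm_sgn sgn_zero_iff)
    then show ?thesis
      using False by (simp add: cinner_self)
  qed simp
  have less: "cinner (gs x n) (gs x j) = 0" if "j < n" for j n
    using that
  proof (induction n arbitrary: j rule: less_induct)
    case (less n)
    have orth: "cinner (gs x k) (gs x j) = 0" if "k < n" "k \<noteq> j" for k
    proof (cases "k < j")
      case True
      then have "cinner (gs x j) (gs x k) = 0"
        using less by blast
      then show ?thesis
        by (metis cinner_commute complex_cnj_zero)
    qed (use less that in auto)
    have "cinner (\<Sum>k<n. cinner (x n) (gs x k) *\<^sub>C gs x k) (gs x j) =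
        (\<Sum>k<n. if k = j then cinner (x n) (gs x j) * cinner (gs x j) (gs x j) else 0)"
      unfolding cinner_sum_left cinner_scaleC_left
      by (intro sum.cong refl) (auto simp: orth)
    also have "\<dots> = cinner (x n) (gs x j)"
      using less.prems by (simp add: norm)
    finally have "cinner (x n - (\<Sum>k<n. cinner (x n) (gs x k) *\<^sub>C gs x k)) (gs x j) = 0"
      by (simp add: cinner_diff_left)
    moreover obtain c where "gs x n = c *\<^sub>C (x n - (\<Sum>k<n. cinner (x n) (gs x k) *\<^sub>C gs x k))"
      using gs_scaleC[of x n] by blast
    ultimately show ?case
      by (simp only: cinner_scaleC_left mult_zero_right)
  qed
  show ?thesis
  proof (cases i j rule: linorder_cases)
    case less
    then show ?thesis
      using \<open>\<And>n j. j < n \<Longrightarrow> cinner (gs x n) (gs x j) =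
          0\<close>[of i j] by (metis cinner_commute complex_cnj_zero less_irrefl)
  qed (use norm less in auto)
qed

lemma cspan_gs: "cspan (range (gs x)) = cspan (range x)"
proof (intro subset_antisym cvec.span_minimal cvec.subspace_span)
  show "range x \<subseteq> cspan (range (gs x))"
  proof clarify
    fix n
    obtain d where "x n - (\<Sum>k<n. cinner (x n) (gs x k) *\<^sub>C gs x k) = d *\<^sub>C gs x n"
      using gs_scaleC[of x n] by blast
    then have "x n = d *\<^sub>C gs x n + (\<Sum>k<n. cinner (x n) (gs x k) *\<^sub>C gs x k)"
      by (simp add: diff_eq_eq)
    also have "\<dots> \<in> cspan (range (gs x))"
      by (intro cvec.span_add cvec.span_sum cvec.span_scale cvec.span_base) auto
    finally show "x n \<in> cspan (range (gs x))" .
  qed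
  show "range (gs x) \<subseteq> cspan (range x)"
  proof clarify
    fix n
    show "gs x n \<in> cspan (range x)"
    proof (induction n rule: less_induct)
      case (less n)
      obtain c where "gs x n = c *\<^sub>C (x n - (\<Sum>k<n. cinner (x n) (gs x k) *\<^sub>C gs x k))"
        using gs_scaleC[of x n] by blast
      also have "\<dots> \<in> cspan (range x)"
        by (intro cvec.span_scale cvec.span_diff cvec.span_sum) (auto intro: cvec.span_base less)
      finally show ?case .
    qed
  qed
qed

lemma gs_basis_bij: "bij_betw (enumerate {k. gs x k \<noteq> 0}) (gs_index x) {k. gs x k \<noteq> 0}"
proof (cases "finite {k. gs x k \<noteq> 0}")
  case True
  then show ?thesis
    using finite_bij_enumerate[OF True] by (simp add: gs_index_def lessThan_def)
next
  case False
  then show ?thesis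
    using bij_enumerate by (simp add: gs_index_def)
qed

global_interpretation gs: orthonormal "gs_basis x" "gs_index x" for x :: "nat \<Rightarrow>
    'h::complex_hilbert_space"
proof
  fix i j assume ij: "i \<in> gs_index x" "j \<in> gs_index x"
  have "enumerate {k. gs x k \<noteq> 0} i = enumerate {k. gs x k \<noteq> 0} j \<longleftrightarrow> i = j"
    using gs_basis_bij[of x] ij by (auto simp: bij_betw_def inj_on_def)
  moreover have "enumerate {k. gs x k \<noteq> 0} i \<in> {k. gs x k \<noteq> 0}"
    using gs_basis_bij[of x] ij by (auto dest: bij_betwE)
  ultimately show "cinner (gs_basis x i) (gs_basis x j) = (if i = j then 1 else 0)"
    by (simp add: gs_basis_def gs_orthonormal)
qed

lemma cspan_gs_basis: "cspan (gs_basis x ` gs_index x) = cspan (range x)"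
proof -
  have "gs_basis x ` gs_index x = gs x ` (enumerate {k. gs x k \<noteq> 0} ` gs_index x)"
    by (simp add: gs_basis_def image_image)
  also have "\<dots> = gs x ` {k. gs x k \<noteq> 0}"
    using gs_basis_bij[of x] by (simp add: bij_betw_def)
  also have "\<dots> = range (gs x) - {0}"
    by auto
  finally show ?thesis
    by (metis cvec.span_delete_0 cspan_gs)
qed

section \<open>The algorithm\<close>

text \<open>This locality allows the formal products with the unknown \<open>d\<close> to be
  exchanged for true scalar products on the indices that occur.\<close>

lemma eq_holds_cong:
  assumes "\<And>x y. x \<in> involved E \<Longrightarrow> y \<in> involved E \<Longrightarrow> p x y = p' x y"
  shows "eq_holds p E \<longleftrightarrow> eq_holds p' E"
proof -
  have "ip_value p xs = ip_value p' xs" if "set xs \<subseteq> set (fst E) \<union> set (snd E)" for xs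
  proof -
    have "p x y = p' x y" if "(c, x, y) \<in> set xs" for c x y
    proof (rule assms)
      have "(c, x, y) \<in> set (fst E) \<union> set (snd E)"
        using that \<open>set xs \<subseteq> _\<close> by blast
      then show "x \<in> involved E" "y \<in> involved E"
        by (force simp: involved_def)+
    qed
    then show ?thesis
      unfolding ip_value_def by (intro arg_cong[where f = sum_list] map_cong refl) auto
  qed
  then show ?thesis
    by (simp add: eq_holds_def)
qed

lemma eq_holds_transfer:
  "eq_holds p E \<Longrightarrow> (\<And>x y. x \<in> involved E \<Longrightarrow> y \<in> involved E \<Longrightarrow> p x y = p' x y) \<Longrightarrow> eq_holds p' E"
  using eq_holds_cong[of E p p'] by simp

lemma finite_involved: "finite (involved E)"
  by (auto simp: involved_def)

lemma eq_holds_rational: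
  "eq_holds p ([(1, x1, y1), (c, x2, y2)], [(1, x3, y3)]) \<longleftrightarrow> p x1 y1 + c * p x2 y2 = p x3 y3"
  by (simp add: eq_holds_def ip_value_def)

lemma eq_holds_ip_eq: "eq_holds p (ip_eq x y x' y') \<longleftrightarrow> p x y = p x' y'"
  by (simp add: eq_holds_def ip_value_def ip_eq_def)

section \<open>The content of the full system of equations\<close>

definition all_equations :: "(index \<Rightarrow> 'h::complex_hilbert_space) \<Rightarrow> bool" where
  "all_equations f \<longleftrightarrow> (\<forall>E\<in>equations. eq_holds (\<lambda>x y. cinner (f x) (f y)) E)"

text \<open>(E1)-(E4) state the relations only after pairing with members of the family. The
  difference of both sides lies in the span of the family, hence is orthogonal to itself.\<close>

lemma all_equations_rational_family:
  assumes "all_equations f"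
  shows "rational_family f"
proof -
  have zero: "x = z" if "\<And>y. cinner x (f y) = cinner z (f y)" "x - z \<in> cspan (range f)" for x z
  proof -
    have "cinner (x - z) (x - z) = 0"
      by (rule cspan_closure_orthogonal[where B = "range f"])
        (use that closure_subset[of "cspan (range f)"] in \<open>auto simp: cinner_diff_left\<close>)
    then show ?thesis by simp
  qed
  have rel: "f x1 + c *\<^sub>C f x2 = f x3"
    if "\<And>y. ([(1, x1, y), (c, x2, y)], [(1, x3, y)]) \<in> equations" for x1 x2 x3 c
  proof (rule zero)
    show "cinner (f x1 + c *\<^sub>C f x2) (f y) = cinner (f x3) (f y)" for y
      using assms that[of y] unfolding all_equations_def
      by (auto simp: eq_holds_rational cinner_add_left cinner_scaleC_left)
    show "f x1 + c *\<^sub>C f x2 - f x3 \<in> cspan (range f)"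
      by (intro cvec.span_diff cvec.span_add cvec.span_scale cvec.span_base) auto
  qed
  have neg: "f x1 - \<i> *\<^sub>C f x2 = f x1 + (-\<i>) *\<^sub>C f x2" for x1 x2
    by (simp add: cvec.scale_minus_left)
  show ?thesis
    unfolding rational_family_def neg
    by (intro allI conjI rel equations.intros(1-4))
qed

text \<open>Each of (E5)-(E10) moves one component of the second index to the first, with k paired
  to l' and r to t'. After six moves the second index is zero.\<close>

lemma all_equations_gram:
  assumes "all_equations f"
  shows "gram_function f (\<lambda>x. cinner (f x) (f (0, 0, 0, 0, 0, 0)))"
  unfolding gram_function_def
proof (intro allI)
  fix m k l n r t m' k' l' n' r' t'
  have eq: "cinner (f x) (f y) = cinner (f x') (f y')" if "ip_eq x y x' y' \<in> equations" for x y x'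
      y'
    using assms that unfolding all_equations_def by (auto simp: eq_holds_ip_eq)
  have "cinner (f (m, k, l, n, r, t)) (f (m', k', l', n', r', t')) =
      cinner (f (m + m', k, l, n, r, t)) (f (0, k', l', n', r', t'))"
    by (intro eq equations.E5) simp
  also have "\<dots> = cinner (f (m + m', k + l', l, n, r, t)) (f (0, k', 0, n', r', t'))"
    by (intro eq equations.E6) simp
  also have "\<dots> = cinner (f (m + m', k + l', l + k', n, r, t)) (f (0, 0, 0, n', r', t'))"
    by (intro eq equations.E7) simp
  also have "\<dots> = cinner (f (m + m', k + l', l + k', n + n', r, t)) (f (0, 0, 0, 0, r', t'))"
    by (intro eq equations.E8) simp
  also have "\<dots> = cinner (f (m + m', k + l', l + k', n + n', r + t', t)) (f (0, 0, 0, 0, r', 0))"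
    by (intro eq equations.E9) simp
  also have "\<dots> = cinner (f (m + m', k + l', l + k', n + n', r + t', t + r')) (f (0, 0, 0, 0, 0, 0))"
    by (intro eq equations.E10) simp
  finally show "cinner (f (m, k, l, n, r, t)) (f (m', k', l', n', r', t')) =
      cinner (f (m + m', k + l', l + k', n + n', r + t', t + r')) (f (0, 0, 0, 0, 0, 0))" .
qed

text \<open>In Gram form (E5)-(E10) compare \<open>\<phi>\<close> at equal arguments, and (E1)-(E4)
  are the relations of \<open>\<phi>\<close> at a shifted index.\<close>

lemma gram_all_equations:
  assumes gram: "gram_function f \<phi>"
    and rel: "\<And>m k l n r t. \<phi> (Suc m, k, l, n, r, t) + \<i> * \<phi> (m, k, l, n, r, t) = \<phi> (m, k + 1, l,
        n, r, t)"
      "\<And>m k l n r t. \<phi> (Suc m, k, l, n, r, t) - \<i> * \<phi> (m, k, l, n, r, t) = \<phi> (m, k, l + 1, n, r, t)"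
      "\<And>m k l n r t. \<phi> (m, k, l, Suc n, r, t) + \<i> * \<phi> (m, k, l, n, r, t) = \<phi> (m, k, l, n, r + 1, t)"
      "\<And>m k l n r t. \<phi> (m, k, l, Suc n, r, t) - \<i> * \<phi> (m, k, l, n, r, t) = \<phi> (m, k, l, n, r, t + 1)"
  shows "all_equations f"
  unfolding all_equations_def
proof
  have g: "cinner (f (m, k, l, n, r, t)) (f (m', k', l', n', r', t')) =
     \<phi> (m + m', k + l', l + k', n + n', r + t', t + r')" for m k l n r t m' k' l' n' r' t'
    using gram by (simp add: gram_function_def)
  fix E assume "E \<in> equations"
  then show "eq_holds (\<lambda>x y. cinner (f x) (f y)) E"
  proof cases
    case (E1 m k l n r t y)
    then show ?thesis
      using rel(1) by (cases y) (simp add: eq_holds_rational g add.assoc add.left_commute[of _ 1]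
          add.commute[of 1])
  next
    case (E2 m k l n r t y)
    then show ?thesis
      using rel(2) by (cases y) (simp add: eq_holds_rational g add.assoc add.left_commute[of _ 1]
          add.commute[of 1])
  next
    case (E3 m k l n r t y)
    then show ?thesis
      using rel(3) by (cases y) (simp add: eq_holds_rational g add.assoc add.left_commute[of _ 1]
          add.commute[of 1])
  next
    case (E4 m k l n r t y)
    then show ?thesis
      using rel(4) by (cases y) (simp add: eq_holds_rational g add.assoc add.left_commute[of _ 1]
          add.commute[of 1])
  qed (simp_all add: eq_holds_ip_eq g)
qed

section \<open>Levels of the model space and single steps of the algorithm\<close>

locale algorithm =
  fixes s :: "nat \<Rightarrow> nat \<Rightarrow> complex" and h :: "nat \<Rightarrow> nat \<Rightarrow> 'h::complex_hilbert_space" and e :: "nat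
      \<Rightarrow> 'h"
    and w :: "nat \<Rightarrow> index" and u :: "nat \<Rightarrow> nat \<times> nat"
  assumes model: "model_space s h e" and w: "bij_betw w UNIV (- Omega0)" and u: "bij u"
begin

abbreviation "I \<equiv> gs_index (sequence_of h u)"
abbreviation "g \<equiv> gs_basis (sequence_of h u)"

text \<open>The part of the space available before \<open>w q\<close> is treated:
  \<open>H0 h\<close> and the directions \<open>e j\<close> with \<open>j < q\<close>. The vector
  with index \<open>w q\<close> itself belongs to \<open>levels (Suc q)\<close>.\<close>

definition levels :: "nat \<Rightarrow> 'h set" where
  "levels q = {x + y | x y. x \<in> H0 h \<and> y \<in> cspan (e ` {..<q})}"

lemma e_ortho: "cinner (e i) (e j) = (if i = j then 1 else 0)"
  using model by (simp add: model_space_def)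

sublocale E: orthonormal e UNIV
  by standard (simp add: e_ortho)

lemma H0_altdef: "H0 h = closure (cspan (g ` I))"
proof -
  have "range (sequence_of h u) = range (\<lambda>(m, n). h m n)"
  proof -
    have "sequence_of h u = (\<lambda>(m, n). h m n) \<circ> u"
      by (auto simp: sequence_of_def case_prod_unfold)
    then show ?thesis
      using u by (metis bij_is_surj fun.set_map)
  qed
  then show ?thesis
    by (simp add: H0_def cspan_gs_basis)
qed

lemma h_in_H0: "h m n \<in> H0 h"
  unfolding H0_def by (intro closure_cspan_base) auto

lemma H0_e:
  assumes "x \<in> H0 h"
  shows "cinner x (e j) = 0"
proof -
  have "cinner (e j) x = 0"
  proof (rule cspan_closure_orthogonal)
    show "x \<in> closure (cspan (range (\<lambda>(m, n). h m n)))"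
      using assms by (simp add: H0_def)
    show "cinner (e j) y = 0" if "y \<in> range (\<lambda>(m, n). h m n)" for y
    proof -
      have "cinner y (e j) = 0"
        using that model by (auto simp: model_space_def)
      then show ?thesis
        by (metis cinner_commute complex_cnj_zero)
    qed
  qed
  then show ?thesis
    by (metis cinner_commute complex_cnj_zero)
qed

lemma cspan_e:
  assumes "y \<in> cspan (e ` {..<q})"
  shows "y = (\<Sum>j<q. cinner y (e j) *\<^sub>C e j)"
  using assms
proof (induction rule: cvec.span_induct_alt)
  case base
  then show ?case by simp
next
  case (step c x y)
  then obtain i where i: "i < q" "x = e i"
    by blast
  have "(\<Sum>j<q. cinner (c *\<^sub>C x + y) (e j) *\<^sub>C e j) =
      (\<Sum>j<q. (if j = i then c *\<^sub>C e i else 0) + cinner y (e j) *\<^sub>C e j)"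
    unfolding i(2) by (intro sum.cong refl)
      (auto simp: cinner_add_left cinner_scaleC_left e_ortho scaleC_add_left)
  also have "\<dots> = c *\<^sub>C x + y"
    using i step(2) by (simp add: sum.distrib)
  finally show ?case ..
qed

lemma levels_decompose:
  assumes "v \<in> levels q"
  obtains x where "x \<in> H0 h" "v = x + (\<Sum>j<q. cinner v (e j) *\<^sub>C e j)"
proof -
  obtain x y where xy: "x \<in> H0 h" "y \<in> cspan (e ` {..<q})" "v = x + y"
    using assms by (auto simp: levels_def)
  then have "cinner y (e j) = cinner v (e j)" for j
    by (simp add: cinner_add_left H0_e)
  then show ?thesis
    using that[OF xy(1)] cspan_e[OF xy(2)] xy(3) by simp
qed

lemma levels_I: "x \<in> H0 h \<Longrightarrow> x + (\<Sum>j<q. \<beta> j *\<^sub>C e j) \<in> levels q"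
  unfolding levels_def
  by (intro CollectI exI conjI refl) (auto intro: cvec.span_sum cvec.span_scale cvec.span_base)

lemma levels_orthogonal:
  assumes "v \<in> levels q" "q \<le> j"
  shows "cinner v (e j) = 0"
proof -
  obtain x where x: "x \<in> H0 h" "v = x + (\<Sum>i<q. cinner v (e i) *\<^sub>C e i)"
    using levels_decompose[OF assms(1)] .
  have "cinner (\<Sum>i<q. cinner v (e i) *\<^sub>C e i) (e j) = 0"
    using E.cinner_partial_sum[of "{..<q}" j] assms(2) by simp
  then show ?thesis
    by (subst x(2)) (simp add: cinner_add_left H0_e x(1))
qed

lemma levels_mono: "p \<le> q \<Longrightarrow> levels p \<subseteq> levels q"
proof -
  assume "p \<le> q"
  then have "cspan (e ` {..<p}) \<subseteq> cspan (e ` {..<q})"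
    by (intro cvec.span_mono) auto
  then show ?thesis
    by (auto simp: levels_def)
qed

lemma H0_subset_levels: "H0 h \<subseteq> levels q"
  using levels_I[of _ "\<lambda>_. 0" q] by auto

lemma levels_Suc:
  assumes "v \<in> levels (Suc q)"
  shows "v - cinner v (e q) *\<^sub>C e q \<in> levels q"
proof -
  obtain x where x: "x \<in> H0 h" "v = x + (\<Sum>j<Suc q. cinner v (e j) *\<^sub>C e j)"
    using levels_decompose[OF assms] .
  then have "v - cinner v (e q) *\<^sub>C e q = x + (\<Sum>j<q. cinner v (e j) *\<^sub>C e j)"
    by (simp add: algebra_simps)
  then show ?thesis
    using levels_I[OF x(1)] by simp
qed

lemma levels_add_e: "z \<in> levels q \<Longrightarrow> z + c *\<^sub>C e q \<in> levels (Suc q)"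
proof -
  assume "z \<in> levels q"
  then obtain x where x: "x \<in> H0 h" "z = x + (\<Sum>j<q. cinner z (e j) *\<^sub>C e j)"
    using levels_decompose by blast
  have eq: "z + c *\<^sub>C e q = x + (\<Sum>j<Suc q. (if j = q then c else cinner z (e j)) *\<^sub>C e j)"
    by (subst x(2)) (simp add: add.assoc)
  show ?thesis
    unfolding eq by (rule levels_I[OF x(1)])
qed

lemma norm_add_e:
  assumes "z \<in> levels q"
  shows "(norm (z + c *\<^sub>C e q))\<^sup>2 = (norm z)\<^sup>2 + (cmod c)\<^sup>2"
proof -
  have "cinner z (e q) = 0" "cinner (e q) z = 0"
    using levels_orthogonal[OF assms] by (auto intro: trans[OF cinner_commute])
  then have "complex_of_real ((norm (z + c *\<^sub>C e q))\<^sup>2) = of_real ((norm z)\<^sup>2) + c * cnj c"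
    unfolding cinner_self [symmetric]
    by (simp add: cinner_add_left cinner_add_right cinner_scaleC_left cinner_scaleC_right e_ortho)
  also have "\<dots> = of_real ((norm z)\<^sup>2 + (cmod c)\<^sup>2)"
    unfolding complex_norm_square [symmetric] by simp
  finally show ?thesis
    by (simp only: of_real_eq_iff)
qed

lemma norm_H0_add_sum:
  assumes "x \<in> H0 h"
  shows "(norm (x + (\<Sum>j<q. \<beta> j *\<^sub>C e j)))\<^sup>2 = (norm x)\<^sup>2 + (\<Sum>j<q. (cmod (\<beta> j))\<^sup>2)"
proof (induction q)
  case (Suc q)
  have "(norm (x + (\<Sum>j<Suc q. \<beta> j *\<^sub>C e j)))\<^sup>2 = (norm ((x + (\<Sum>j<q. \<beta> j *\<^sub>C e j)) + \<beta> q *\<^sub>C e q))\<^sup>2"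
    by (simp add: add.assoc)
  then show ?case
    using norm_add_e[OF levels_I[OF assms, of \<beta> q], of "\<beta> q"] Suc by simp
qed simp

text \<open>Riesz-Fischer makes the series a vector of \<open>H0 h\<close>, and Pythagoras
  identifies \<open>coeff_sum\<close>. Thus \<open>d - coeff_sum\<close> is the squared length left
  for the direction \<open>e q\<close>.\<close>

lemma partial_vector:
  assumes "(\<lambda>n. (cmod (\<alpha> n))\<^sup>2) summable_on I"
  shows "partial_vector h e u q \<alpha> \<beta> \<in> levels q"
    and "coeff_sum h u q \<alpha> \<beta> = (norm (partial_vector h e u q \<alpha> \<beta>))\<^sup>2"
proof -
  obtain x where x: "x \<in> closure (cspan (g ` I))"
    "((\<lambda>i. (cmod (\<alpha> i))\<^sup>2) has_sum (norm x)\<^sup>2) I" "((\<lambda>i. \<alpha> i *\<^sub>C g i) has_sum x) I"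
    using gs.riesz_fischer[OF assms] by blast
  have pv: "partial_vector h e u q \<alpha> \<beta> = x + (\<Sum>j<q. \<beta> j *\<^sub>C e j)"
    unfolding partial_vector_def infsumI[OF x(3)] ..
  show "partial_vector h e u q \<alpha> \<beta> \<in> levels q"
    unfolding pv using x(1) by (intro levels_I) (simp add: H0_altdef)
  show "coeff_sum h u q \<alpha> \<beta> = (norm (partial_vector h e u q \<alpha> \<beta>))\<^sup>2"
    unfolding pv coeff_sum_def infsumI[OF x(2)] using x(1) by (subst norm_H0_add_sum) (simp_all
        add: H0_altdef)
qed

text \<open>The \<open>e j\<close> are orthogonal to all \<open>g n\<close>, so the coefficients
  along \<open>g\<close> see only the part in \<open>H0 h\<close>. \<open>restrict\<close> makes the
  coefficient functions extensional, as \<open>S_set\<close> requires.\<close>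

lemma levels_partial_vector:
  assumes "z \<in> levels q"
  defines "\<alpha> \<equiv> restrict (\<lambda>n. cinner z (g n)) I" and "\<beta> \<equiv> restrict (\<lambda>j. cinner z (e j)) {..<q}"
  shows "(\<lambda>n. (cmod (\<alpha> n))\<^sup>2) summable_on I" "partial_vector h e u q \<alpha> \<beta> = z"
proof -
  show "(\<lambda>n. (cmod (\<alpha> n))\<^sup>2) summable_on I"
    using gs.bessel_summable[where x = "sequence_of h u" and v = z]
    by (rule summable_on_cong[THEN iffD1, rotated]) (simp add: \<alpha>_def)
  obtain x where x: "x \<in> H0 h" "z = x + (\<Sum>j<q. cinner z (e j) *\<^sub>C e j)"
    using levels_decompose[OF assms(1)] .
  have "cinner z (g n) = cinner x (g n)" if "n \<in> I" for n
  proof -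
    have "g n \<in> H0 h"
      unfolding H0_altdef using that by (intro closure_cspan_base) auto
    then have "cinner (e j) (g n) = 0" for j
      using H0_e by (metis cinner_commute complex_cnj_zero)
    then show ?thesis
      by (subst x(2)) (simp add: cinner_add_left cinner_sum_left cinner_scaleC_left)
  qed
  then have "(\<Sum>\<^sub>\<infinity>n\<in>I. \<alpha> n *\<^sub>C g n) = (\<Sum>\<^sub>\<infinity>n\<in>I. cinner x (g n) *\<^sub>C g n)"
    by (intro infsum_cong) (simp add: \<alpha>_def)
  also have "\<dots> = x"
    using x(1) by (intro infsumI gs.expansion(1)) (simp add: H0_altdef)
  finally have sum_g: "(\<Sum>\<^sub>\<infinity>n\<in>I. \<alpha> n *\<^sub>C g n) = x" .
  have sum_e: "(\<Sum>j<q. \<beta> j *\<^sub>C e j) = (\<Sum>j<q. cinner z (e j) *\<^sub>C e j)"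
    by (intro sum.cong) (auto simp: \<beta>_def)
  show "partial_vector h e u q \<alpha> \<beta> = z"
    unfolding partial_vector_def sum_g sum_e by (rule x(2)[symmetric])
qed

lemma w_notin_Omega0: "w q \<notin> Omega0"
  using w by (auto dest: bij_betwE)

lemma w_cases:
  obtains "x \<in> Omega0" | q where "x = w q"
  using w by (cases "x \<in> Omega0") (auto simp: bij_betw_def)

lemma family_Omega0: "family h w v (m, 0, 0, n, 0, 0) = h m n"
  by (simp add: family_def Omega0_def)

lemma family_w: "family h w v (w q) = v q"
proof -
  have "inv w (w q) = q"
    using w by (intro inv_f_f) (auto simp: bij_betw_def)
  then show ?thesis
    using w_notin_Omega0[of q] by (cases "w q") (auto simp: family_def)
qed

lemma family_in_levels:
  assumes "x \<in> Omega0 \<union> w ` {..<q}" "\<And>p. p < q \<Longrightarrow> v p \<in> levels (Suc p)"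
  shows "family h w v x \<in> levels q"
proof (cases "x \<in> Omega0")
  case True
  then obtain m n where "x = (m, 0, 0, n, 0, 0)"
    by (auto simp: Omega0_def)
  then show ?thesis
    using h_in_H0 H0_subset_levels by (auto simp: family_Omega0)
next
  case False
  then obtain p where "p < q" "x = w p"
    using assms(1) by blast
  then show ?thesis
    using assms(2) levels_mono[of "Suc p" q] by (auto simp: family_w)
qed

text \<open>All earlier vectors and \<open>z\<close> lie in \<open>levels q\<close>, which is
  orthogonal to \<open>e q\<close>. Dropping \<open>c *\<^sub>C e q\<close> thus changes only the
  product of the new vector with itself, and there \<open>d\<close> stands in.\<close>

lemma step_products_eq:
  assumes v: "\<And>p. p < q \<Longrightarrow> v p \<in> levels (Suc p)" and z: "z \<in> levels q" and vq: "v q = z + c *\<^sub>C e q"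
    and d: "d = (norm (v q))\<^sup>2"
    and x: "x \<in> Omega0 \<union> w ` {..q}" and y: "y \<in> Omega0 \<union> w ` {..q}"
  shows "step_products h w q (map v [0..<q]) z d x y = cinner (family h w v x) (family h w v y)"
proof -
  define v' where "v' = (\<lambda>p. if p < q then map v [0..<q] ! p else z)"
  have split: "x \<in> Omega0 \<union> w ` {..<q} \<or> x = w q" if "x \<in> Omega0 \<union> w ` {..q}" for x
    using that by (auto simp: le_less)
  have same: "family h w v' x = family h w v x" if "x \<in> Omega0 \<union> w ` {..<q}" for x
  proof (cases "x \<in> Omega0")
    case True
    then obtain m n where "x = (m, 0, 0, n, 0, 0)"
      by (auto simp: Omega0_def)
    then show ?thesis
      by (auto simp: family_Omega0)
  next
    case False
    then show ?thesis
      using that by (auto simp: family_w v'_def)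
  qed
  have vq': "family h w v' (w q) = z" "family h w v (w q) = z + c *\<^sub>C e q"
    by (simp_all add: family_w v'_def vq)
  have orth: "cinner (family h w v x) (e q) = 0" "cinner (e q) (family h w v x) = 0"
    if "x \<in> Omega0 \<union> w ` {..<q}" for x
    using levels_orthogonal[OF family_in_levels[OF that v]] by (auto intro: trans[OF
        cinner_commute])
  have "cinner (family h w v' x) (family h w v' y) = cinner (family h w v x) (family h w v y)"
    if "\<not> (x = w q \<and> y = w q)"
    using split[OF x] split[OF y] that
    by (elim disjE) (simp_all add: same vq' cinner_add_left cinner_add_right cinner_scaleC_left
        cinner_scaleC_right orth del: Un_iff)
  then show ?thesis
    unfolding step_products_def v'_def [symmetric] by (auto simp: d cinner_self family_w)
qed

text \<open>An equation involves finitely many indices. Either all lie in \<open>Omega0\<close>, or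
  the largest \<open>q\<close> with \<open>w q\<close> involved is the step that checks it.\<close>

lemma all_equationsI:
  assumes "step_zero_holds h"
    and "\<And>q E. E \<in> step_equations w q \<Longrightarrow> eq_holds (\<lambda>x y. cinner (family h w v x) (family h w v y)) E"
  shows "all_equations (family h w v)"
  unfolding all_equations_def
proof
  fix E assume E: "E \<in> equations"
  show "eq_holds (\<lambda>x y. cinner (family h w v x) (family h w v y)) E"
  proof (cases "involved E \<subseteq> Omega0")
    case True
    then have "eq_holds (\<lambda>(m, k, l, n, r, t) (m', k', l', n', r', t'). cinner (h m n) (h m' n')) E"
      using assms(1) E by (auto simp: step_zero_holds_def)
    moreover have "(\<lambda>(m, k, l, n, r, t) (m', k', l', n', r', t'). cinner (h m n) (h m' n')) x y =
        cinner (family h w v x) (family h w v y)" if "x \<in> involved E" "y \<in> involved E" for x y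
    proof -
      have "x \<in> Omega0" "y \<in> Omega0"
        using that True by auto
      then obtain m n m' n' where "x = (m, 0, 0, n, 0, 0)" "y = (m', 0, 0, n', 0, 0)"
        by (auto simp: Omega0_def)
      then show ?thesis
        by (simp add: family_Omega0)
    qed
    ultimately show ?thesis
      by (rule eq_holds_transfer)
  next
    case False
    define Q where "Q = {q. w q \<in> involved E}"
    have "finite Q"
      unfolding Q_def using finite_involved[of E] w
      by (intro finite_vimageI[unfolded vimage_def]) (auto simp: bij_betw_def)
    moreover have "Q \<noteq> {}"
    proof -
      obtain x where "x \<in> involved E" "x \<notin> Omega0"
        using False by blast
      then show ?thesis
        by (cases x rule: w_cases) (auto simp: Q_def)
    qed
    ultimately have Max: "Max Q \<in> Q" "\<And>q. q \<in> Q \<Longrightarrow> q \<le> Max Q"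
      by auto
    have "E \<in> step_equations w (Max Q)"
      unfolding step_equations_def
    proof (intro CollectI conjI subsetI)
      show "w (Max Q) \<in> involved E"
        using Max(1) by (simp add: Q_def)
      fix x assume "x \<in> involved E"
      then show "x \<in> Omega0 \<union> w ` {..Max Q}"
        using Max(2) by (cases x rule: w_cases) (auto simp: Q_def)
    qed (rule E)
    then show ?thesis
      by (rule assms(2))
  qed
qed

text \<open>Membership in the set number \<open>Suc q\<close> exhibits the coefficients behind
  \<open>v q\<close>. By Pythagoras the unknown \<open>d\<close> is then the squared norm of
  \<open>v q\<close>.\<close>

lemma bold_G_step:
  assumes v: "v \<in> bold_G h e w u M"
  obtains z \<gamma> where "z \<in> levels q" "\<gamma> \<ge> 0" "v q = z + complex_of_real \<gamma> *\<^sub>C e q"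
    "\<And>E. E \<in> step_equations w q \<Longrightarrow> eq_holds (step_products h w q (map v [0..<q]) z ((norm (v
        q))\<^sup>2)) E"
proof -
  have "v \<in> bold_Gq h e w u M (Suc q)"
    using v by (simp add: bold_G_def)
  then have "map v [0..<Suc q] \<in> G_set h e w u M (Suc q)"
    unfolding bold_Gq_def by blast
  then obtain \<alpha> \<beta> d hs where eq: "map v [0..<Suc q] = hs @ [partial_vector h e u q \<alpha> \<beta> +
            complex_of_real (sqrt (d - coeff_sum h u q \<alpha> \<beta>)) *\<^sub>C e q]"
    and S: "(\<alpha>, \<beta>, d, hs) \<in> S_hat h e w u M q (G_set h e w u M q)"
    unfolding G_set.simps by blast
  have hs: "hs = map v [0..<q]" and vq: "v q = partial_vector h e u q \<alpha> \<beta> +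
            complex_of_real (sqrt (d - coeff_sum h u q \<alpha> \<beta>)) *\<^sub>C e q"
    using eq by auto
  have \<alpha>: "(\<lambda>n. (cmod (\<alpha> n))\<^sup>2) summable_on I" and le: "coeff_sum h u q \<alpha> \<beta> \<le> d"
    and eqs: "\<forall>E\<in>step_equations w q. eq_holds (step_products h w q hs (partial_vector h e u q \<alpha> \<beta>)
        d) E"
    using S by (auto simp: S_hat_def S_set_def)
  have "(norm (v q))\<^sup>2 = d"
    unfolding vq norm_add_e[OF partial_vector(1)[OF \<alpha>]] partial_vector(2)[OF \<alpha>, symmetric]
    using le by simp
  then show ?thesis
    using that[OF partial_vector(1)[OF \<alpha>] _ vq] le eqs by (simp add: hs)
qed

lemma bold_G_levels:
  assumes "v \<in> bold_G h e w u M"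
  shows "v q \<in> levels (Suc q)"
  using bold_G_step[OF assms, of q] levels_add_e by metis

lemma bold_G_all_equations:
  assumes "step_zero_holds h" "v \<in> bold_G h e w u M"
  shows "all_equations (family h w v)"
proof (rule all_equationsI[OF assms(1)])
  fix q E assume E: "E \<in> step_equations w q"
  obtain z \<gamma> where z: "z \<in> levels q" "v q = z + complex_of_real \<gamma> *\<^sub>C e q"
    "\<And>E. E \<in> step_equations w q \<Longrightarrow> eq_holds (step_products h w q (map v [0..<q]) z ((norm (v
        q))\<^sup>2)) E"
    using bold_G_step[OF assms(2), of q] by metis
  have "eq_holds (step_products h w q (map v [0..<q]) z ((norm (v q))\<^sup>2)) E"
    by (rule z(3)[OF E])
  moreover have "step_products h w q (map v [0..<q]) z ((norm (v q))\<^sup>2) x y =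
      cinner (family h w v x) (family h w v y)" if "x \<in> involved E" "y \<in> involved E" for x y
    using E that by (intro step_products_eq[OF bold_G_levels[OF assms(2)] z(1,2) refl]) (auto
        simp: step_equations_def)
  ultimately show "eq_holds (\<lambda>x y. cinner (family h w v x) (family h w v y)) E"
    by (rule eq_holds_transfer)
qed

lemma bold_G_X_set:
  assumes "step_zero_holds h" "v \<in> bold_G h e w u M"
  shows "family h w v \<in> X_set h e w"
proof -
  have all: "all_equations (family h w v)"
    by (rule bold_G_all_equations[OF assms])
  \<comment> \<open>The witness for \<open>\<Lambda>\<close> is the set of all indices.\<close>
  have "v q \<in> {x + y | x y. x \<in> H0 h \<and> y \<in> cspan (e ` {j\<in>UNIV. j \<le> q})} \<and> 0 \<le>
      cinner (v q) (e q)" for q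
  proof
    show "v q \<in> {x + y | x y. x \<in> H0 h \<and> y \<in> cspan (e ` {j\<in>UNIV. j \<le> q})}"
      using bold_G_levels[OF assms(2), of q] by (simp add: levels_def lessThan_Suc_atMost
          atMost_def)
    obtain z \<gamma> where "z \<in> levels q" "\<gamma> \<ge> 0" "v q = z + complex_of_real \<gamma> *\<^sub>C e q"
      using bold_G_step[OF assms(2), of q] by metis
    then show "0 \<le> cinner (v q) (e q)"
      by (simp add: cinner_add_left cinner_scaleC_left levels_orthogonal e_ortho
          less_eq_complex_def)
  qed
  then have "\<exists>\<Lambda>. \<forall>q. family h w v (w q) \<in> {x + y | x y. x \<in> H0 h \<and> y \<in> cspan (e ` {j\<in>\<Lambda>. j \<le> q})} \<and>
              0 \<le> cinner (family h w v (w q)) (e q)"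
    unfolding family_w by blast
  then show ?thesis
    unfolding X_set_def using all_equations_rational_family[OF all] all_equations_gram[OF all]
    unfolding rational_family_def by (intro CollectI conjI) (auto simp: family_Omega0)
qed

text \<open>The step is run backwards: \<open>\<gamma>\<close> is the coefficient along
  \<open>e q\<close>, the remainder \<open>z\<close> supplies \<open>\<alpha>\<close> and
  \<open>\<beta>\<close>, and \<open>d\<close> is the squared norm, so that the square root gives
  back \<open>\<gamma>\<close> because it is nonnegative.\<close>

lemma bold_GI:
  assumes all: "all_equations (family h w v)"
    and v: "\<And>q. v q \<in> levels (Suc q)" "\<And>q. 0 \<le> cinner (v q) (e q)"
    and norm: "\<And>q. (norm (v q))\<^sup>2 \<le> M q" and M: "\<And>q. M q > 0"
  shows "v \<in> bold_G h e w u M"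
proof -
  have G: "map v [0..<q] \<in> G_set h e w u M q" for q
  proof (induction q)
    case (Suc q)
    define \<gamma> where "\<gamma> = Re (cinner (v q) (e q))"
    have \<gamma>: "cinner (v q) (e q) = of_real \<gamma>" "\<gamma> \<ge> 0"
      using v(2)[of q] by (auto simp: \<gamma>_def complex_eq_iff less_eq_complex_def)
    define z where "z = v q - of_real \<gamma> *\<^sub>C e q"
    have z: "z \<in> levels q" "v q = z + complex_of_real \<gamma> *\<^sub>C e q"
      using levels_Suc[OF v(1), of q] by (auto simp: z_def \<gamma>)
    define \<alpha> where "\<alpha> = restrict (\<lambda>n. cinner z (g n)) I"
    define \<beta> where "\<beta> = restrict (\<lambda>j. cinner z (e j)) {..<q}"
    have \<alpha>: "(\<lambda>n. (cmod (\<alpha> n))\<^sup>2) summable_on I" and pv: "partial_vector h e u q \<alpha> \<beta> = z"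
      unfolding \<alpha>_def \<beta>_def using levels_partial_vector[OF z(1)] by simp_all
    have cs: "coeff_sum h u q \<alpha> \<beta> = (norm z)\<^sup>2"
      using partial_vector(2)[OF \<alpha>, of q \<beta>] by (simp add: pv)
    have nv: "(norm (v q))\<^sup>2 = (norm z)\<^sup>2 + \<gamma>\<^sup>2"
      unfolding z(2) norm_add_e[OF z(1)] by simp
    have "eq_holds (step_products h w q (map v [0..<q]) z ((norm (v q))\<^sup>2))
        E" if E: "E \<in> step_equations w q" for E
    proof -
      have "eq_holds (\<lambda>x y. cinner (family h w v x) (family h w v y)) E"
        using all E by (auto simp: all_equations_def step_equations_def)
      moreover have "step_products h w q (map v [0..<q]) z ((norm (v q))\<^sup>2) x y =
          cinner (family h w v x) (family h w v y)" if "x \<in> involved E" "y \<in> involved E" for x y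
        using E that by (intro step_products_eq[OF v(1) z refl]) (auto simp: step_equations_def)
      ultimately show ?thesis
        by (rule eq_holds_transfer[OF _ sym])
    qed
    then have "(\<alpha>, \<beta>, (norm (v q))\<^sup>2, map v [0..<q]) \<in> S_hat h e w u M q (G_set h e w u M q)"
      using Suc \<alpha> norm[of q] nv unfolding S_hat_def S_set_def
      by (auto simp: pv cs) (auto simp: \<alpha>_def \<beta>_def)
    moreover have "map v [0..<Suc q] = map v [0..<q] @ [partial_vector h e u q \<alpha> \<beta> +
            complex_of_real (sqrt ((norm (v q))\<^sup>2 - coeff_sum h u q \<alpha> \<beta>)) *\<^sub>C e q]"
    proof -
      have root: "sqrt ((norm (v q))\<^sup>2 - coeff_sum h u q \<alpha> \<beta>) = \<gamma>"
        using \<gamma>(2) by (simp add: cs nv)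
      show ?thesis
        unfolding root pv z(2) [symmetric] by simp
    qed
    ultimately show ?case
      unfolding G_set.simps by blast
  qed simp
  have le: "norm (v q) \<le> sqrt (M q)" for q
    using norm[of q] by (rule real_le_rsqrt)
  then have "norm (v q) / sqrt (M q) \<le> 1" for q
    using M[of q] by simp
  then have "v \<in> bold_H M"
    unfolding bold_H_def by (auto intro!: bdd_aboveI2)
  then show ?thesis
    using G le by (auto simp: bold_G_def bold_Gq_def)
qed

end

section \<open>From a solution to the algorithm\<close>

text \<open>The index of the product of one rational function with the conjugate of another;
  conjugation exchanges x + i and x - i, hence the crossed components.\<close>

definition star_mult :: "index \<Rightarrow> index \<Rightarrow> index" where
  "star_mult = (\<lambda>(m, k, l, n, r, t) (m', k', l', n', r', t'). (m + m', k + l', l + k', n + n', r +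
      t', t + r'))"

lemma gram_function_star: "gram_function f \<phi> \<longleftrightarrow> (\<forall>x y. cinner (f x) (f y) = \<phi> (star_mult x y))"
  by (simp add: gram_function_def star_mult_def)

lemma ratio_mult_cnj: "ratio m k l x * cnj (ratio m' k' l' x) = ratio (m + m') (k + l') (l + k') x"
  unfolding ratio_def power_int_add[OF disjI1, OF real_plus_i_neq_0]
    power_int_add[OF disjI1, OF real_minus_i_neq_0] power_add
  by simp

lemma chi_mult_cnj: "chi x p * cnj (chi y p) = chi (star_mult x y) p"
proof -
  obtain m k l n r t where x: "x = (m, k, l, n, r, t)" by (cases x)
  obtain m' k' l' n' r' t' where y: "y = (m', k', l', n', r', t')" by (cases y)
  obtain p1 p2 where p: "p = (p1, p2)" by (cases p)
  have "chi x p * cnj (chi y p) = (ratio m k l p1 * cnj (ratio m' k' l' p1)) * (ratio n r t p2 *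
      cnj (ratio n' r' t' p2))"
    by (simp add: x y p chi_def)
  then show ?thesis
    by (simp add: ratio_mult_cnj x y p chi_def star_mult_def)
qed

lemma norm_power_int_le:
  fixes z :: complex
  assumes "1 \<le> b" "cmod z \<le> b" "inverse (cmod z) \<le> b"
  shows "cmod (z powi k) \<le> b ^ nat \<bar>k\<bar>"
proof (cases "k \<ge> 0")
  case True
  then have "cmod (z powi k) = cmod z ^ nat \<bar>k\<bar>"
    by (simp add: power_int_def norm_power)
  then show ?thesis
    using power_mono[OF assms(2)] by simp
next
  case False
  then have "cmod (z powi k) = inverse (cmod z) ^ nat \<bar>k\<bar>"
    by (simp add: power_int_def norm_power norm_inverse)
  then show ?thesis
    using power_mono[OF assms(3)] by simp
qed

text \<open>Both x + i and x - i have modulus sqrt(1 + x^2), which like its inverse and the modulus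
  of x is at most 1 + x^2. Powers of 1 + x^2 expand into monomials.\<close>

lemma cmod_ratio_le: "cmod (ratio m k l x) \<le> (1 + x\<^sup>2) ^ (m + nat \<bar>k\<bar> + nat \<bar>l\<bar>)"
proof -
  have sq: "cmod (of_real x + \<i>) = sqrt (1 + x\<^sup>2)" "cmod (of_real x - \<i>) = sqrt (1 + x\<^sup>2)"
    by (simp_all add: cmod_def add.commute)
  have ge: "sqrt (1 + x\<^sup>2) \<ge> 1"
    by simp
  have le: "sqrt (1 + x\<^sup>2) \<le> 1 + x\<^sup>2"
    using mult_left_mono[OF ge, of "sqrt (1 + x\<^sup>2)"] by simp
  have inv: "inverse (sqrt (1 + x\<^sup>2)) \<le> 1 + x\<^sup>2"
    using ge le by (intro order_trans[OF le_imp_inverse_le[OF ge]]) auto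
  have "\<bar>x\<bar> \<le> sqrt (1 + x\<^sup>2)"
    by (intro real_le_rsqrt) auto
  then have "\<bar>x\<bar> \<le> 1 + x\<^sup>2"
    using le by linarith
  then have "cmod (of_real x ^ m) \<le> (1 + x\<^sup>2) ^ m"
    by (simp add: norm_power power_mono)
  moreover have "cmod ((of_real x + \<i>) powi k) \<le> (1 + x\<^sup>2) ^ nat \<bar>k\<bar>"
    "cmod ((of_real x - \<i>) powi l) \<le> (1 + x\<^sup>2) ^ nat \<bar>l\<bar>"
    by (intro norm_power_int_le; use le inv in \<open>simp add: sq\<close>)+
  ultimately show ?thesis
    unfolding ratio_def norm_mult power_add by (intro mult_mono) auto
qed

text \<open>The function is dominated by a polynomial, which is integrable because all monomials
  are.\<close>

lemma chi_integrable:
  assumes "\<mu> \<in> real_solutions s"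
  shows "integrable \<mu> (chi x)"
proof -
  obtain m k l n r t where x: "x = (m, k, l, n, r, t)" by (cases x)
  define N where "N = m + nat \<bar>k\<bar> + nat \<bar>l\<bar>"
  define N' where "N' = n + nat \<bar>r\<bar> + nat \<bar>t\<bar>"
  have sets: "sets \<mu> = sets borel"
    using assms by (simp add: real_solutions_def)
  note ms = measurable_cong_sets[OF sets refl]
  have mono: "integrable \<mu> (\<lambda>p. fst p ^ i * snd p ^ j :: real)" for i j
  proof -
    have "integrable \<mu> (\<lambda>(x1, x2). complex_of_real (x1 ^ i * x2 ^ j))"
      using assms by (auto simp: real_solutions_def has_bochner_integral_iff)
    then have "integrable \<mu> (\<lambda>p. complex_of_real (fst p ^ i * snd p ^ j))"
      by (simp only: case_prod_unfold)
    from integrable_Re[OF this] show ?thesis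
      by (simp only: Re_complex_of_real)
  qed
  have poly: "(1 + (fst p)\<^sup>2) ^ N * (1 + (snd p)\<^sup>2) ^ N' =
     (\<Sum>i\<le>N. \<Sum>j\<le>N'. (of_nat (N choose i) * of_nat (N' choose j)) * (fst p ^ (2 * i) * snd p ^ (2 *
         j)))"
    for p :: "real \<times> real"
  proof -
    have b: "(1 + y\<^sup>2) ^ K = (\<Sum>i\<le>K. of_nat (K choose i) * y ^ (2 * i))" for y :: real and K
      by (subst add.commute, subst binomial_ring) (simp add: power_mult)
    show ?thesis
      unfolding b sum_product by (intro sum.cong refl) (simp add: mult_ac)
  qed
  have bound: "integrable \<mu> (\<lambda>p. (1 + (fst p)\<^sup>2) ^ N * (1 + (snd p)\<^sup>2) ^ N')"
    unfolding poly by (intro Bochner_Integration.integrable_sum integrable_mult_right mono)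
  have meas: "chi x \<in> borel_measurable \<mu>"
    unfolding ms by (rule chi_measurable)
  have "norm (chi x p) \<le> norm ((1 + (fst p)\<^sup>2) ^ N * (1 + (snd p)\<^sup>2) ^ N')" for p
  proof -
    have "norm (chi x p) \<le> (1 + (fst p)\<^sup>2) ^ N * (1 + (snd p)\<^sup>2) ^ N'"
      unfolding x chi_def N_def N'_def
      by (cases p) (auto simp: norm_mult intro!: mult_mono cmod_ratio_le)
    then show ?thesis
      by (rule order_trans) simp
  qed
  then show ?thesis
    by (intro Bochner_Integration.integrable_bound[OF bound meas] AE_I2)
qed

section \<open>Transport between the rational functions in L2 and the Hilbert space\<close>

locale moment_measure =
  fixes \<mu> :: "(real \<times> real) measure"
  assumes sets_mu: "sets \<mu> = sets borel" and chi_int: "\<And>x. integrable \<mu> (chi x)"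
begin

definition kernel :: "index \<Rightarrow> index \<Rightarrow> complex" where
  "kernel x y = integral\<^sup>L \<mu> (\<lambda>p. chi x p * cnj (chi y p))"

lemma has_kernel: "has_bochner_integral \<mu> (\<lambda>p. chi x p * cnj (chi y p)) (kernel x y)"
  unfolding kernel_def by (intro has_bochner_integral_integrable) (simp add: chi_mult_cnj chi_int)

lemma kernel_star: "kernel x y = integral\<^sup>L \<mu> (chi (star_mult x y))"
  by (simp add: kernel_def chi_mult_cnj)

lemma has_bochner_integral_cnj:
  "has_bochner_integral \<mu> F c \<Longrightarrow> has_bochner_integral \<mu> (\<lambda>p. cnj (F p)) (cnj c)"
  by (rule has_bochner_integral_bounded_linear[OF bounded_linear_cnj])

lemma kernel_commute: "kernel x y = cnj (kernel y x)"
  by (rule has_bochner_integral_eq[OF has_kernel]) (use has_bochner_integral_cnj[OF has_kernel[of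
      y x]] in \<open>simp add: mult.commute\<close>)

text \<open>The graph of the isometry from the span of the \<open>f x\<close> into \<open>L2(\<mu>)\<close>
  that takes \<open>f x\<close> to \<open>chi x\<close>.\<close>

inductive isometric :: "(index \<Rightarrow> 'h::complex_hilbert_space) \<Rightarrow> index set \<Rightarrow> 'h \<Rightarrow> (real \<times> real \<Rightarrow>
    complex) \<Rightarrow> bool"
  for f A where
  zero: "isometric f A 0 (\<lambda>_. 0)"
| step: "x \<in> A \<Longrightarrow> isometric f A v G \<Longrightarrow> isometric f A (c *\<^sub>C f x + v) (\<lambda>p. c * chi x p + G p)"

lemma isometric_add:
  assumes "isometric f A v G" "isometric f A v' G'"
  shows "isometric f A (v + v') (\<lambda>p. G p + G' p)"
  using assms(1)
proof induction
  case zero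
  then show ?case using assms(2) by simp
next
  case (step x v G c)
  then show ?case
    using isometric.step[OF step.hyps(1) step.IH, of c] by (simp add: add.assoc)
qed

lemma isometric_scale:
  assumes "isometric f A v G"
  shows "isometric f A (a *\<^sub>C v) (\<lambda>p. a * G p)"
  using assms
proof induction
  case zero
  then show ?case using isometric.zero by simp
next
  case (step x v G c)
  then show ?case
    using isometric.step[OF step.hyps(1) step.IH, of "a * c"]
    by (simp add: scaleC_add_right scaleC_scaleC distrib_left mult.assoc)
qed

lemma isometric_base: "x \<in> A \<Longrightarrow> isometric f A (f x) (chi x)"
  by (drule isometric.step[OF _ isometric.zero, where c = 1 and f = f]) simp

lemma isometric_sum:
  assumes "\<And>i. i \<in> F \<Longrightarrow> isometric f A (v i) (G i)"
  shows "isometric f A (\<Sum>i\<in>F. v i) (\<lambda>p. \<Sum>i\<in>F. G i p)"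
  using assms
  by (induction F rule: infinite_finite_induct) (auto intro: isometric.zero isometric_add)

lemma isometric_exists:
  assumes "v \<in> cspan (f ` A)"
  shows "\<exists>G. isometric f A v G"
  using assms
proof (induction rule: cvec.span_induct_alt)
  case base
  then show ?case using isometric.zero by blast
next
  case (step c x y)
  then show ?case using isometric.step by blast
qed

lemma isometric_chi:
  assumes "isometric f A v G"
  shows "integrable \<mu> (\<lambda>p. G p * cnj (chi y p))"
  using assms
proof induction
  case (step x v G c)
  have "integrable \<mu> (\<lambda>p. c * (chi x p * cnj (chi y p)) + G p * cnj (chi y p))"
    using step.IH has_kernel[of x y] by (intro Bochner_Integration.integrable_add
        integrable_mult_right)
      (auto simp: has_bochner_integral_iff)
  then show ?case
    by (simp add: distrib_right mult.assoc)
qed simp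

text \<open>Induction over both graphs reduces to pairs of generators. Applied to a function that
  represents 0, it shows that this function vanishes almost everywhere, so the graph is
  single-valued up to null sets.\<close>

lemma isometric_inner:
  assumes gram: "\<And>x y. x \<in> A \<Longrightarrow> y \<in> A \<Longrightarrow> cinner (f x) (f y) = kernel x y"
    and "isometric f A v G" "isometric f A v' G'"
  shows "has_bochner_integral \<mu> (\<lambda>p. G p * cnj (G' p)) (cinner v v')"
  using assms(2)
proof induction
  case zero
  show ?case by (simp add: has_bochner_integral_zero)
next
  case (step x v G c)
  have "has_bochner_integral \<mu> (\<lambda>p. chi x p * cnj (G' p)) (cinner (f x) v')"
    using assms(3)
  proof induction
    case zero
    show ?case by (simp add: has_bochner_integral_zero)
  next
    case (step y v' G' d)
    have "has_bochner_integral \<mu> (\<lambda>p. cnj d * (chi x p * cnj (chi y p)) + chi x p * cnj (G' p))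
        (cnj d * kernel x y + cinner (f x) v')"
      using step.IH has_kernel by (intro has_bochner_integral_add has_bochner_integral_mult_right)
    then show ?case
      using gram[OF \<open>x \<in> A\<close> step.hyps(1)]
      by (simp add: cinner_add_right cinner_scaleC_right distrib_left mult_ac)
  qed
  then have "has_bochner_integral \<mu> (\<lambda>p. c * (chi x p * cnj (G' p)) + G p * cnj (G' p)) (c *
      cinner (f x) v' + cinner v v')"
    using step.IH by (intro has_bochner_integral_add has_bochner_integral_mult_right)
  then show ?case
    by (simp only: cinner_add_left cinner_scaleC_left distrib_right mult.assoc)
qed

text \<open>The orthogonal projection of \<open>chi a\<close> onto the closed span of the \<open>chi x\<close> with \<open>x \<in> A\<close>,
  transported to the Hilbert space.\<close>

lemma extend_gram:
  fixes f :: "index \<Rightarrow> 'h::complex_hilbert_space"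
  assumes gram: "\<And>x y. x \<in> A \<Longrightarrow> y \<in> A \<Longrightarrow> cinner (f x) (f y) = kernel x y"
    and A: "A \<noteq> {}"
  obtains v where "v \<in> closure (cspan (f ` A))" "\<And>x. x \<in> A \<Longrightarrow> cinner v (f x) = kernel a x"
    "(norm v)\<^sup>2 \<le> Re (kernel a a)"
proof -
  have cA: "countable A" by simp
  \<comment> \<open>Repetitions in this enumeration do no harm: Gram-Schmidt discards dependent
    entries.\<close>
  define y where "y n = f (from_nat_into A n)" for n
  have y: "range y = f ` A"
    using range_from_nat_into[OF A cA] by (metis (no_types, lifting) y_def image_cong image_image)
  let ?b = "gs_basis y" and ?I = "gs_index y"
  have span: "cspan (?b ` ?I) = cspan (f ` A)"
    by (simp add: cspan_gs_basis y)
  have "\<exists>G. isometric f A (?b n) G" if "n \<in> ?I" for n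
  proof (rule isometric_exists)
    show "?b n \<in> cspan (f ` A)"
      unfolding span [symmetric] using that by (intro cvec.span_base) auto
  qed
  then obtain G where G: "\<And>n. n \<in> ?I \<Longrightarrow> isometric f A (?b n) (G n)"
    by metis
  \<comment> \<open>The Fourier coefficient of \<open>chi a\<close> along \<open>G n\<close>,
    written with the conjugation outside.\<close>
  define \<alpha> where "\<alpha> n = cnj (integral\<^sup>L \<mu> (\<lambda>p. G n p * cnj (chi a p)))" for n
  have \<alpha>: "has_bochner_integral \<mu> (\<lambda>p. G n p * cnj (chi a p)) (cnj (\<alpha> n))" if "n \<in> ?I" for n
    using isometric_chi[OF G[OF that], of a] by (simp add: \<alpha>_def has_bochner_integral_iff)
  \<comment> \<open>Bessel's inequality in L2: the squared modulus of \<open>chi a - H\<close> has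
    nonnegative integral.\<close>
  have bessel: "(\<Sum>n\<in>F. (cmod (\<alpha> n))\<^sup>2) \<le> Re (kernel a a)" if F: "finite F" "F \<subseteq> ?I" for F
  proof -
    define H where "H p = (\<Sum>n\<in>F. \<alpha> n * G n p)" for p
    have H: "isometric f A (\<Sum>n\<in>F. \<alpha> n *\<^sub>C ?b n) H"
      unfolding H_def [abs_def] using F G by (intro isometric_sum isometric_scale) auto
    have "cinner (\<Sum>n\<in>F. \<alpha> n *\<^sub>C ?b n) (\<Sum>n\<in>F. \<alpha> n *\<^sub>C ?b n) = of_real (\<Sum>n\<in>F. (cmod (\<alpha> n))\<^sup>2)"
      unfolding cinner_self using F by (subst norm_sum_orthonormal) (auto simp: gs.ortho subset_iff)
    then have HH: "has_bochner_integral \<mu> (\<lambda>p. H p * cnj (H p)) (of_real (\<Sum>n\<in>F. (cmod (\<alpha> n))\<^sup>2))"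
      using isometric_inner[OF gram H H] by simp
    have "has_bochner_integral \<mu> (\<lambda>p. \<Sum>n\<in>F. \<alpha> n * (G n p * cnj (chi a p))) (\<Sum>n\<in>F. \<alpha> n * cnj (\<alpha> n))"
      using F \<alpha> by (intro has_bochner_integral_sum has_bochner_integral_mult_right) auto
    then have Ha: "has_bochner_integral \<mu> (\<lambda>p. H p * cnj (chi a p))
        (of_real (\<Sum>n\<in>F. (cmod (\<alpha> n))\<^sup>2))"
      unfolding of_real_sum complex_norm_square by (simp add: H_def sum_distrib_right mult.assoc)
    have "has_bochner_integral \<mu> (\<lambda>p. chi a p * cnj (chi a p) - H p * cnj (chi a p) - cnj (H p *
        cnj (chi a p)) + H p * cnj (H p))
        (kernel a a - of_real (\<Sum>n\<in>F. (cmod (\<alpha> n))\<^sup>2) - cnj (of_real (\<Sum>n\<in>F. (cmod (\<alpha> n))\<^sup>2)) +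
            of_real (\<Sum>n\<in>F. (cmod (\<alpha> n))\<^sup>2))"
      by (intro has_bochner_integral_add has_bochner_integral_diff has_kernel Ha HH
          has_bochner_integral_cnj)
    moreover have "chi a p * cnj (chi a p) - H p * cnj (chi a p) - cnj (H p * cnj (chi a p)) +
        H p * cnj (H p) =
        of_real ((cmod (chi a p - H p))\<^sup>2)" for p
      unfolding complex_norm_square by (simp add: algebra_simps)
    ultimately have "has_bochner_integral \<mu> (\<lambda>p. complex_of_real ((cmod (chi a p - H p))\<^sup>2))
        (kernel a a - of_real (\<Sum>n\<in>F. (cmod (\<alpha> n))\<^sup>2))"
      by simp
    then have "has_bochner_integral \<mu> (\<lambda>p. (cmod (chi a p - H p))\<^sup>2) (Re (kernel a a) - (\<Sum>n\<in>F.
        (cmod (\<alpha> n))\<^sup>2))"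
      by (auto dest: has_bochner_integral_Re)
    then have "Re (kernel a a) - (\<Sum>n\<in>F. (cmod (\<alpha> n))\<^sup>2) =
        integral\<^sup>L \<mu> (\<lambda>p. (cmod (chi a p - H p))\<^sup>2)"
      by (simp add: has_bochner_integral_iff)
    also have "\<dots> \<ge> 0"
      by (rule Bochner_Integration.integral_nonneg) simp
    finally have "0 \<le> Re (kernel a a) - (\<Sum>n\<in>F. (cmod (\<alpha> n))\<^sup>2)" .
    then show ?thesis by simp
  qed
  have "(\<lambda>n. (cmod (\<alpha> n))\<^sup>2) summable_on ?I"
    by (rule nonneg_bdd_above_summable_on) (auto intro!: bdd_aboveI2 bessel)
  then obtain v where v: "v \<in> closure (cspan (?b ` ?I))" "\<And>n. n \<in> ?I \<Longrightarrow> cinner v (?b n) = \<alpha> n"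
    "((\<lambda>n. (cmod (\<alpha> n))\<^sup>2) has_sum (norm v)\<^sup>2) ?I"
    using gs.riesz_fischer by blast
  have "cinner v (f x) = kernel a x" if x: "x \<in> A" for x
  proof -
    have "f x \<in> cspan (?b ` ?I)"
      unfolding span using x by (intro cvec.span_base) auto
    then obtain T d where T: "finite T" "T \<subseteq> ?b ` ?I" "f x = (\<Sum>z\<in>T. d z *\<^sub>C z)"
      unfolding cvec.span_explicit by blast
    then obtain F where F: "F \<subseteq> ?I" "T = ?b ` F" "inj_on ?b F"
      using subset_image_inj[of T ?b ?I] by blast
    have finF: "finite F"
      using T(1) F finite_imageD by blast
    have fx: "f x = (\<Sum>n\<in>F. d (?b n) *\<^sub>C ?b n)"
      using T(3) F by (simp add: sum.reindex)
    define H where "H p = (\<Sum>n\<in>F. d (?b n) * G n p)" for p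
    have H: "isometric f A (f x) H"
      unfolding fx H_def [abs_def] using F G by (intro isometric_sum isometric_scale) auto
    \<comment> \<open>\<open>D\<close> represents the zero vector and so vanishes almost everywhere;
      the finite sum \<open>H\<close> may then replace \<open>chi x\<close> under the
      integral.\<close>
    define D where "D p = H p + (-1) * chi x p" for p
    have D: "isometric f A 0 D"
      using isometric_add[OF H isometric_scale[OF isometric_base[OF x, of f], of "-1"]]
      by (simp add: D_def [abs_def] cvec.scale_minus_left)
    have "has_bochner_integral \<mu> (\<lambda>p. complex_of_real ((cmod (D p))\<^sup>2)) 0"
      using isometric_inner[OF gram D D] unfolding complex_norm_square by simp
    then have "has_bochner_integral \<mu> (\<lambda>p. (cmod (D p))\<^sup>2) 0"
      using has_bochner_integral_Re by fastforce
    then have "AE p in \<mu>. (cmod (D p))\<^sup>2 = 0"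
      using integral_nonneg_eq_0_iff_AE[of \<mu> "\<lambda>p. (cmod (D p))\<^sup>2"] by (auto simp:
          has_bochner_integral_iff)
    then have ae: "AE p in \<mu>. H p * cnj (chi a p) = chi x p * cnj (chi a p)"
      by eventually_elim (simp add: D_def)
    have Ha: "has_bochner_integral \<mu> (\<lambda>p. H p * cnj (chi a p)) (\<Sum>n\<in>F. d (?b n) * cnj (\<alpha> n))"
    proof -
      have "has_bochner_integral \<mu> (\<lambda>p. \<Sum>n\<in>F. d (?b n) * (G n p * cnj (chi a p)))
          (\<Sum>n\<in>F. d (?b n) * cnj (\<alpha> n))"
        using F \<alpha> by (intro has_bochner_integral_sum has_bochner_integral_mult_right) auto
      then show ?thesis
        by (simp add: H_def sum_distrib_right mult.assoc)
    qed
    have "has_bochner_integral \<mu> (\<lambda>p. chi x p * cnj (chi a p)) (\<Sum>n\<in>F. d (?b n) * cnj (\<alpha> n))"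
      by (rule has_bochner_integral_AE_eq[OF Ha ae borel_measurable_has_bochner_integral[OF
          has_kernel]])
    then have "kernel x a = (\<Sum>n\<in>F. d (?b n) * cnj (\<alpha> n))"
      using has_bochner_integral_eq[OF has_kernel] by blast
    moreover have "cinner v (f x) = (\<Sum>n\<in>F. cnj (d (?b n)) * \<alpha> n)"
      unfolding fx cinner_sum_right cinner_scaleC_right using F v(2) by (intro sum.cong) auto
    ultimately show ?thesis
      using kernel_commute[of a x] by simp
  qed
  moreover have "(norm v)\<^sup>2 \<le> Re (kernel a a)"
    unfolding infsumI[OF v(3), symmetric]
    using v(3) bessel by (intro infsum_le_finite_sums) (auto simp: summable_on_def)
  ultimately show ?thesis
    using that v(1) span by simp
qed

end

section \<open>Realizing a solution step by step in the model space\<close>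

context algorithm
begin

text \<open>Exhibits a level as the preimage of the closed subspace \<open>H0 h\<close> under a
  continuous linear map. Hence levels are closed subspaces and contain the transported
  projections.\<close>

lemma levels_altdef: "levels q = {v. v - (\<Sum>j<q. cinner v (e j) *\<^sub>C e j) \<in> H0 h}"
proof (intro set_eqI iffI CollectI)
  fix v assume v: "v \<in> levels q"
  then obtain x where x: "x \<in> H0 h" "v = x + (\<Sum>j<q. cinner v (e j) *\<^sub>C e j)"
    using levels_decompose by blast
  then have "v - (\<Sum>j<q. cinner v (e j) *\<^sub>C e j) = x"
    by (simp add: diff_eq_eq)
  then show "v - (\<Sum>j<q. cinner v (e j) *\<^sub>C e j) \<in> H0 h"
    using x(1) by simp
next
  fix v assume "v \<in> {v. v - (\<Sum>j<q. cinner v (e j) *\<^sub>C e j) \<in> H0 h}"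
  then show "v \<in> levels q"
    using levels_I[of "v - (\<Sum>j<q. cinner v (e j) *\<^sub>C e j)" "\<lambda>j. cinner v (e j)" q] by simp
qed

lemma closed_levels: "closed (levels q)"
proof -
  have "continuous_on UNIV (\<lambda>v. v - (\<Sum>j<q. cinner v (e j) *\<^sub>C e j))"
  proof (intro continuous_on_diff continuous_on_id continuous_on_sum)
    fix j
    have "bounded_linear (\<lambda>c. c *\<^sub>C e j)"
      by (rule bounded_linear_intro[of _ "norm (e j)"])
        (simp_all add: scaleC_add_left scaleR_scaleC scaleC_scaleC norm_scaleC scaleR_conv_of_real)
    then have "bounded_linear (\<lambda>v. cinner v (e j) *\<^sub>C e j)"
      using bounded_linear_compose[OF _ bounded_linear_cinner_left] by blast
    then show "continuous_on UNIV (\<lambda>v. cinner v (e j) *\<^sub>C e j)"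
      by (rule linear_continuous_on)
  qed
  moreover have "closed (H0 h)"
    by (simp add: H0_def)
  ultimately show ?thesis
    unfolding levels_altdef using continuous_closed_vimage[of "H0 h" "\<lambda>v. v - (\<Sum>j<q. cinner v (e
        j) *\<^sub>C e j)"]
    by (simp add: vimage_def continuous_on_eq_continuous_at)
qed

lemma closure_cspan_levels:
  assumes "B \<subseteq> levels q"
  shows "closure (cspan B) \<subseteq> levels q"
proof (intro closure_minimal closed_levels cvec.span_minimal assms)
  show "cvec.subspace (levels q)"
  proof (rule cvec.subspaceI)
    show "0 \<in> levels q"
      using H0_subset_levels closure_cspan_zero by (auto simp: H0_def)
    fix v v' assume "v \<in> levels q" "v' \<in> levels q"
    then have "(v - (\<Sum>j<q. cinner v (e j) *\<^sub>C e j)) + (v' - (\<Sum>j<q. cinner v' (e j) *\<^sub>C e j)) \<in> H0 h"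
      unfolding levels_altdef H0_def by (intro closure_cspan_add) auto
    then show "v + v' \<in> levels q"
      unfolding levels_altdef
      by (simp add: cinner_add_left scaleC_add_left sum.distrib algebra_simps)
  next
    fix c v assume "v \<in> levels q"
    then have "c *\<^sub>C (v - (\<Sum>j<q. cinner v (e j) *\<^sub>C e j)) \<in> H0 h"
      unfolding levels_altdef H0_def by (intro closure_cspan_scale) auto
    then show "c *\<^sub>C v \<in> levels q"
      unfolding levels_altdef
      by (simp add: cinner_scaleC_left scaleC_scaleC cvec.scale_right_diff_distrib
          cvec.scale_sum_right)
  qed
qed

text \<open>The invariant of the construction. Entries of \<open>v\<close> from \<open>q\<close> on
  are unconstrained, so it survives changing them.\<close>

definition realizes :: "(real \<times> real) measure \<Rightarrow> nat \<Rightarrow> (nat \<Rightarrow> 'h) \<Rightarrow> bool" where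
  "realizes \<mu> q v \<longleftrightarrow> (\<forall>p<q. v p \<in> levels (Suc p) \<and> 0 \<le> cinner (v p) (e p)) \<and>
     (\<forall>x\<in>Omega0 \<union> w ` {..<q}. \<forall>y\<in>Omega0 \<union> w ` {..<q}.
        cinner (family h w v x) (family h w v y) = integral\<^sup>L \<mu> (chi (star_mult x y)))"

lemma family_cong:
  assumes "\<And>p. p < q \<Longrightarrow> v p = v' p" "x \<in> Omega0 \<union> w ` {..<q}"
  shows "family h w v x = family h w v' x"
proof (cases "x \<in> Omega0")
  case True
  then obtain m n where "x = (m, 0, 0, n, 0, 0)"
    by (auto simp: Omega0_def)
  then show ?thesis
    by (simp add: family_Omega0)
next
  case False
  then show ?thesis
    using assms by (auto simp: family_w)
qed

lemma realizes_cong: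
  assumes "\<And>p. p < q \<Longrightarrow> v p = v' p" "realizes \<mu> q v"
  shows "realizes \<mu> q v'"
  using assms(2) unfolding realizes_def
  using family_cong[of q v v', OF assms(1)] assms(1) by metis

lemma realizes_0:
  assumes "\<mu> \<in> real_solutions s"
  shows "realizes \<mu> 0 v"
proof -
  have "integral\<^sup>L \<mu> (chi (m, 0, 0, n, 0, 0)) = s m n" for m n
  proof -
    have "chi (m, 0, 0, n, 0, 0) = (\<lambda>(x1, x2). complex_of_real (x1 ^ m * x2 ^ n))"
      by (auto simp: chi_def ratio_def)
    then show ?thesis
      using assms by (simp add: real_solutions_def has_bochner_integral_iff)
  qed
  then show ?thesis
    using model by (auto simp: realizes_def model_space_def Omega0_def star_mult_def family_Omega0)
qed

text \<open>The transported projection \<open>y\<close> of \<open>chi (w q)\<close> already has the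
  right products with all earlier vectors, but may be too short. The missing length
  \<open>\<gamma>\<close> goes into the fresh direction \<open>e q\<close>, which is orthogonal to
  everything before.\<close>

lemma realizes_Suc:
  assumes "\<mu> \<in> real_solutions s" and v: "realizes \<mu> q v"
  obtains z where "realizes \<mu> (Suc q) (v(q := z))"
proof -
  interpret moment_measure \<mu>
    using assms(1) chi_integrable by unfold_locales (auto simp: real_solutions_def)
  let ?A = "Omega0 \<union> w ` {..<q}"
  let ?f = "family h w v"
  have gram: "cinner (?f x) (?f y) = kernel x y" if "x \<in> ?A" "y \<in> ?A" for x y
    using v that by (simp add: realizes_def kernel_star)
  have "(0, 0, 0, 0, 0, 0) \<in> Omega0"
    by (simp add: Omega0_def)
  then have "?A \<noteq> {}" by blast
  then obtain y where y: "y \<in> closure (cspan (?f ` ?A))" "\<And>x. x \<in> ?A \<Longrightarrow> cinner y (?f x) =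
      kernel (w q) x"
    "(norm y)\<^sup>2 \<le> Re (kernel (w q) (w q))"
    using extend_gram[where A = ?A and f = ?f and a = "w q", OF gram] by blast
  have f_levels: "?f x \<in> levels q" if "x \<in> ?A" for x
    using v by (intro family_in_levels[OF that]) (simp add: realizes_def)
  then have y_levels: "y \<in> levels q"
    using closure_cspan_levels[of "?f ` ?A" q] y(1) by blast
  define \<gamma> where "\<gamma> = sqrt (Re (kernel (w q) (w q)) - (norm y)\<^sup>2)"
  define z where "z = y + complex_of_real \<gamma> *\<^sub>C e q"
  have z_f: "cinner z (?f x) = kernel (w q) x" if "x \<in> ?A" for x
  proof -
    have "cinner (e q) (?f x) = 0"
      using levels_orthogonal[OF f_levels[OF that]] by (auto intro: trans[OF cinner_commute])
    then show ?thesis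
      by (simp add: z_def cinner_add_left cinner_scaleC_left y(2)[OF that])
  qed
  have f_z: "cinner (?f x) z = kernel x (w q)" if "x \<in> ?A" for x
    using z_f[OF that] cinner_commute[of "?f x" z] kernel_commute[of x "w q"] by simp
  have z_z: "cinner z z = kernel (w q) (w q)"
  proof -
    have "(norm z)\<^sup>2 = Re (kernel (w q) (w q))"
      unfolding z_def norm_add_e[OF y_levels] using y(3) by (simp add: \<gamma>_def)
    moreover have "Im (kernel (w q) (w q)) = 0"
      using arg_cong[OF kernel_commute[of "w q" "w q"], of Im] by simp
    ultimately show ?thesis
      by (simp add: cinner_self complex_eq_iff)
  qed
  have same: "family h w (v(q := z)) x = ?f x" if "x \<in> ?A" for x
    by (rule family_cong[OF _ that]) simp
  have new: "family h w (v(q := z)) (w q) = z"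
    by (simp add: family_w)
  have "cinner (family h w (v(q := z)) x) (family h w (v(q := z)) x') =
      integral\<^sup>L \<mu> (chi (star_mult x x'))"
    if "x \<in> Omega0 \<union> w ` {..<Suc q}" "x' \<in> Omega0 \<union> w ` {..<Suc q}" for x x'
  proof -
    have "x \<in> ?A \<or> x = w q" "x' \<in> ?A \<or> x' = w q"
      using that by (auto simp: less_Suc_eq)
    then show ?thesis
      unfolding kernel_star [symmetric]
      by (elim disjE) (simp_all only: same new gram z_f f_z z_z)
  qed
  moreover have "z \<in> levels (Suc q)"
    unfolding z_def by (rule levels_add_e[OF y_levels])
  moreover have "0 \<le> cinner z (e q)"
    using y(3) levels_orthogonal[OF y_levels order_refl]
    by (simp add: z_def cinner_add_left cinner_scaleC_left e_ortho \<gamma>_def less_eq_complex_def)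
  ultimately have "realizes \<mu> (Suc q) (v(q := z))"
    using v unfolding realizes_def by (auto simp: less_Suc_eq)
  then show ?thesis by (rule that)
qed

text \<open>Stage \<open>q\<close> alters only entry \<open>q\<close>, so entry \<open>p\<close> is
  final from stage \<open>Suc p\<close> on and the diagonal satisfies every invariant.\<close>

lemma realizes_all:
  assumes "\<mu> \<in> real_solutions s"
  obtains v where "\<And>q. realizes \<mu> q v"
proof -
  have "\<exists>F. \<forall>q. realizes \<mu> q (F q) \<and> (\<exists>z. F (Suc q) = (F q)(q := z))"
  proof (rule dependent_nat_choice)
    show "\<exists>v. realizes \<mu> 0 v"
      using realizes_0[OF assms] by blast
    show "\<exists>v'. realizes \<mu> (Suc q) v' \<and> (\<exists>z. v' = v(q := z))" if "realizes \<mu> q v" for v q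
      using realizes_Suc[OF assms that] by metis
  qed
  then obtain F where F: "\<And>q. realizes \<mu> q (F q)" "\<And>q. \<exists>z. F (Suc q) = (F q)(q := z)"
    by blast
  have stable: "F q p = F (Suc p) p" if "p < q" for p q
    using that
  proof (induction q)
    case (Suc q)
    then show ?case
      using F(2)[of q] by (cases "p = q") auto
  qed simp
  have "realizes \<mu> q (\<lambda>p. F (Suc p) p)" for q
    by (rule realizes_cong[OF _ F(1)[of q]]) (rule stable)
  then show ?thesis by (rule that)
qed

text \<open>The pointwise relations of \<open>chi\<close> integrate to the equations. The squared
  norm of \<open>v q\<close> is the integral of the squared modulus of \<open>chi (w q)\<close>,
  precisely the quantity that \<open>M q\<close> bounds.\<close>

theorem solution_to_bold_G:
  assumes \<mu>: "\<mu> \<in> real_solutions s" and M: "moment_bounds s w M"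
  obtains v where "v \<in> bold_G h e w u M" "gram_function (family h w v) (\<lambda>x. integral\<^sup>L \<mu> (chi x))"
    "\<mu> \<in> rational_solutions (\<lambda>x. integral\<^sup>L \<mu> (chi x))"
proof -
  interpret moment_measure \<mu>
    using \<mu> chi_integrable by unfold_locales (auto simp: real_solutions_def)
  define \<phi> where "\<phi> x = integral\<^sup>L \<mu> (chi x)" for x
  obtain v where v: "\<And>q. realizes \<mu> q v"
    using realizes_all[OF \<mu>] by blast
  have gram: "gram_function (family h w v) \<phi>"
    unfolding gram_function_star
  proof (intro allI)
    fix x y
    have "\<exists>q. x \<in> Omega0 \<union> w ` {..<q}" for x
    proof (cases x rule: w_cases)
      case (2 q)
      then have "x \<in> Omega0 \<union> w ` {..<Suc q}" by simp
      then show ?thesis by blast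
    qed blast
    then obtain q q' where "x \<in> Omega0 \<union> w ` {..<q}" "y \<in> Omega0 \<union> w ` {..<q'}"
      by meson
    then have "x \<in> Omega0 \<union> w ` {..<max q q'}" "y \<in> Omega0 \<union> w ` {..<max q q'}"
      by auto
    then show "cinner (family h w v x) (family h w v y) = \<phi> (star_mult x y)"
      using v[of "max q q'"] unfolding realizes_def \<phi>_def by blast
  qed
  have \<phi>: "has_bochner_integral \<mu> (chi x) (\<phi> x)" for x
    unfolding \<phi>_def by (rule has_bochner_integral_integrable[OF chi_int])
  have plus: "\<phi> x + \<i> * \<phi> y = \<phi> z" if "\<And>p. chi x p + \<i> * chi y p = chi z p" for x y z
    using has_bochner_integral_add[OF \<phi>[of x] has_bochner_integral_mult_right[OF \<phi>[of y], of \<i>]]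
    unfolding that by (auto simp: \<phi>_def has_bochner_integral_iff)
  have minus: "\<phi> x - \<i> * \<phi> y = \<phi> z" if "\<And>p. chi x p - \<i> * chi y p = chi z p" for x y z
    using has_bochner_integral_diff[OF \<phi>[of x] has_bochner_integral_mult_right[OF \<phi>[of y], of \<i>]]
    unfolding that by (auto simp: \<phi>_def has_bochner_integral_iff)
  have all: "all_equations (family h w v)"
    by (rule gram_all_equations[OF gram]) (intro plus minus chi_relations)+
  have "v \<in> bold_G h e w u M"
  proof (rule bold_GI[OF all])
    fix q
    show "v q \<in> levels (Suc q)" "0 \<le> cinner (v q) (e q)"
      using v[of "Suc q"] by (auto simp: realizes_def)
    show "M q > 0"
      using M by (simp add: moment_bounds_def)
    obtain m k l n r t where wq: "w q = (m, k, l, n, r, t)"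
      by (cases "w q")
    have norm_v: "of_real ((norm (v q))\<^sup>2) = \<phi> (star_mult (w q) (w q))"
      using gram[unfolded gram_function_star, rule_format, of "w q" "w q"]
      by (simp only: family_w cinner_self)
    have "has_bochner_integral \<mu> (\<lambda>p. complex_of_real ((cmod (chi (w q) p))\<^sup>2))
        (of_real ((norm (v q))\<^sup>2))"
      unfolding norm_v complex_norm_square chi_mult_cnj by (rule \<phi>)
    then have int: "has_bochner_integral \<mu> (\<lambda>p. (cmod (chi (w q) p))\<^sup>2) ((norm (v q))\<^sup>2)"
      by (auto dest: has_bochner_integral_Re)
    have sq: "(cmod (ratio m k l x))\<^sup>2 = x ^ (2 * m) * (x\<^sup>2 + 1) powi (k + l)" for m k l x
    proof -
      have "complex_of_real ((cmod (ratio m k l x))\<^sup>2) = ratio (m + m) (k + l) (l + k) x"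
        unfolding complex_norm_square by (rule ratio_mult_cnj)
      also have "\<dots> = of_real x ^ (2 * m) * ((of_real x + \<i>) * (of_real x - \<i>)) powi (k + l)"
        by (simp add: ratio_def power_int_mult_distrib mult_2 add.commute)
      also have "(of_real x + \<i>) * (of_real x - \<i>) = complex_of_real (x\<^sup>2 + 1)"
        by (simp add: power2_eq_square algebra_simps)
      also have "of_real x ^ (2 * m) * complex_of_real (x\<^sup>2 + 1) powi (k + l) = of_real (x ^ (2 *
          m) * (x\<^sup>2 + 1) powi (k + l))"
        by simp
      finally show ?thesis
        by (simp only: of_real_eq_iff)
    qed
    have "ennreal ((norm (v q))\<^sup>2) = (\<integral>\<^sup>+p. ennreal ((cmod (chi (w q) p))\<^sup>2) \<partial>\<mu>)"
      using int by (simp add: nn_integral_eq_integral has_bochner_integral_iff)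
    also have "\<dots> = (\<integral>\<^sup>+(x1, x2). ennreal (x1 ^ (2 * m) * (x1\<^sup>2 + 1) powi (k + l) *
                          x2 ^ (2 * n) * (x2\<^sup>2 + 1) powi (r + t)) \<partial>\<mu>)"
      by (intro nn_integral_cong) (auto simp: wq chi_def norm_mult power_mult_distrib sq mult.assoc)
    also have "\<dots> \<le> ennreal (M q)"
      using M[unfolded moment_bounds_def, rule_format, of q, THEN conjunct2, rule_format,
          OF \<mu>] by (simp add: wq)
    finally show "(norm (v q))\<^sup>2 \<le> M q"
      using \<open>M q > 0\<close> by (simp add: ennreal_le_iff)
  qed
  moreover have "\<mu> \<in> rational_solutions \<phi>"
    unfolding rational_solutions_altdef using \<phi> sets_mu by simp
  ultimately show ?thesis
    using that gram by (simp add: \<phi>_def [abs_def])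
qed

end

section \<open>The complex moment problem\<close>

lemma complex_power_expansion:
  "(of_real x + \<i> * of_real y) ^ m * (of_real x - \<i> * of_real y) ^ n =
     (\<Sum>r\<le>m. \<Sum>l\<le>n. of_nat (m choose r) * of_nat (n choose l) * (-1) ^ (n - l) *
         \<i> ^ ((m - r) + (n - l)) * complex_of_real (x ^ (r + l) * y ^ ((m - r) + (n - l))))"
proof -
  have eq: "of_real x - \<i> * of_real y = of_real x + (- 1) * (\<i> * complex_of_real y)"
    by simp
  show ?thesis
    unfolding eq binomial_ring sum_product
    by (simp only: power_mult_distrib power_add of_real_mult of_real_power mult_ac)
qed

lemma real_power_expansion:
  "complex_of_real (Re z ^ m * Im z ^ n) = 1 / (2 ^ m * (2 * \<i>) ^ n) *
     (\<Sum>k\<le>m. \<Sum>j\<le>n. (-1) ^ (n - j) * of_nat (m choose k) * of_nat (n choose j) *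
        (z ^ (k + j) * cnj z ^ ((m - k) + (n - j))))"
proof -
  have "complex_of_real (Re z) = (z + cnj z) / 2" "complex_of_real (Im z) = (z + (-1) *
      cnj z) / (2 * \<i>)"
    by (simp_all add: complex_eq_iff)
  then have "complex_of_real (Re z ^ m * Im z ^ n) = ((z + cnj z) / 2) ^ m * ((z + (-1) *
      cnj z) / (2 * \<i>)) ^ n"
    by (simp only: of_real_mult of_real_power)
  also have "\<dots> = 1 / (2 ^ m * (2 * \<i>) ^ n) * ((z + cnj z) ^ m * (z + (-1) * cnj z) ^ n)"
    by (simp only: power_divide times_divide_times_eq) (simp only: times_divide_eq_left mult_1_left)
  also have "(z + cnj z) ^ m * (z + (-1) * cnj z) ^ n = (\<Sum>k\<le>m. \<Sum>j\<le>n. (-1) ^ (n - j) *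
      of_nat (m choose k) * of_nat (n choose j) *
        (z ^ (k + j) * cnj z ^ ((m - k) + (n - j))))"
    unfolding binomial_ring sum_product
    by (simp only: power_mult_distrib power_add mult_ac)
  finally show ?thesis .
qed

lemma measurable_Complex: "(\<lambda>(x1, x2). Complex x1 x2) \<in> borel_measurable borel"
proof -
  have "(\<lambda>(x1, x2). Complex x1 x2) = (\<lambda>p. of_real (fst p) + \<i> * of_real (snd p))"
    by (auto simp: complex_eq_iff)
  also have "\<dots> \<in> borel_measurable borel"
    by (intro borel_measurable_continuous_onI continuous_intros)
  finally show ?thesis .
qed

lemma measurable_Re_Im: "(\<lambda>z. (Re z, Im z)) \<in> borel_measurable borel"
  by (intro borel_measurable_continuous_onI continuous_intros)

text \<open>Integrating the binomial expansion of the monomials in z = x1 + i x2 and its conjugate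
  gives the right-hand side of \<open>inversion\<close>.\<close>

lemma to_complex_measure_solution:
  assumes \<mu>: "\<mu> \<in> real_solutions s"
    and inversion: "\<And>m n. a m n =
      (\<Sum>r\<le>m. \<Sum>l\<le>n. of_nat (m choose r) * of_nat (n choose l) * (-1) ^ (n - l) *
         \<i> ^ ((m - r) + (n - l)) * s (r + l) ((m - r) + (n - l)))"
  shows "to_complex_measure \<mu> \<in> complex_solutions a"
proof -
  have ms: "measurable \<mu> borel = measurable borel borel"
    using \<mu> by (intro measurable_cong_sets) (auto simp: real_solutions_def)
  have "has_bochner_integral (to_complex_measure \<mu>) (\<lambda>z. z ^ m * cnj z ^ n) (a m n)" for m n
    unfolding to_complex_measure_def
  proof (rule has_bochner_integral_distr)
    show "(\<lambda>z. z ^ m * cnj z ^ n) \<in> borel_measurable borel"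
      by (intro borel_measurable_continuous_onI continuous_intros)
    show "(\<lambda>(x1, x2). Complex x1 x2) \<in> \<mu> \<rightarrow>\<^sub>M borel"
      using measurable_Complex by (simp add: ms)
    have s: "has_bochner_integral \<mu> (\<lambda>p. complex_of_real (fst p ^ i * snd p ^ j)) (s i j)" for i j
      using \<mu> by (simp add: real_solutions_def case_prod_unfold)
    have "has_bochner_integral \<mu> (\<lambda>p. \<Sum>r\<le>m. \<Sum>l\<le>n. of_nat (m choose r) * of_nat (n choose l) *
        (-1) ^ (n - l) *
         \<i> ^ ((m - r) + (n - l)) * complex_of_real (fst p ^ (r + l) * snd p ^ ((m - r) +
             (n - l)))) (a m n)"
      unfolding inversion by (intro has_bochner_integral_sum has_bochner_integral_mult_right s)
    moreover have "(case p of (x1, x2) \<Rightarrow> Complex x1 x2) ^ m * cnj (case p of (x1,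
        x2) \<Rightarrow> Complex x1 x2) ^ n =
      (\<Sum>r\<le>m. \<Sum>l\<le>n. of_nat (m choose r) * of_nat (n choose l) * (-1) ^ (n - l) *
         \<i> ^ ((m - r) + (n - l)) * complex_of_real (fst p ^ (r + l) * snd p ^ ((m - r) +
             (n - l))))" for p
      unfolding complex_power_expansion [symmetric] by (simp add: case_prod_unfold Complex_eq)
    ultimately show "has_bochner_integral \<mu>
      (\<lambda>p. (case p of (x1, x2) \<Rightarrow> Complex x1 x2) ^ m * cnj (case p of (x1,
          x2) \<Rightarrow> Complex x1 x2) ^ n) (a m n)"
      by simp
  qed
  then show ?thesis
    by (simp add: complex_solutions_def to_complex_measure_def)
qed

text \<open>The preimage is the distribution of (Re z, Im z). Expanding powers of (z + cnj z)/2 and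
  (z - cnj z)/(2i) turns its moments into the formula for \<open>s\<close>.\<close>

lemma complex_solution_exists:
  assumes \<sigma>: "\<sigma> \<in> complex_solutions a"
    and s_def: "\<And>m n. s m n = 1 / (2 ^ m * (2 * \<i>) ^ n) *
      (\<Sum>k\<le>m. \<Sum>j\<le>n. (-1) ^ (n - j) * of_nat (m choose k) * of_nat (n choose j) *
         a (k + j) ((m - k) + (n - j)))"
  shows "\<sigma> \<in> to_complex_measure ` real_solutions s"
proof
  let ?R = "\<lambda>z. (Re z, Im z)"
  have sets: "sets \<sigma> = sets borel"
    using \<sigma> by (simp add: complex_solutions_def)
  have ms: "measurable \<sigma> borel = measurable borel borel"
    by (intro measurable_cong_sets sets refl)
  have meas: "?R \<in> \<sigma> \<rightarrow>\<^sub>M borel"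
    using measurable_Re_Im by (simp add: ms)
  have "has_bochner_integral (distr \<sigma> borel ?R) (\<lambda>(x1, x2). complex_of_real (x1 ^ m * x2 ^ n))
      (s m n)" for m n
  proof (rule has_bochner_integral_distr)
    show "(\<lambda>(x1, x2). complex_of_real (x1 ^ m * x2 ^ n)) \<in> borel_measurable borel"
      unfolding case_prod_unfold by (intro borel_measurable_continuous_onI continuous_intros)
    show "?R \<in> \<sigma> \<rightarrow>\<^sub>M borel" by (rule meas)
    have "has_bochner_integral \<sigma> (\<lambda>z. 1 / (2 ^ m * (2 * \<i>) ^ n) *
     (\<Sum>k\<le>m. \<Sum>j\<le>n. (-1) ^ (n - j) * of_nat (m choose k) * of_nat (n choose j) *
        (z ^ (k + j) * cnj z ^ ((m - k) + (n - j))))) (s m n)"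
      unfolding s_def using \<sigma>
      by (intro has_bochner_integral_sum has_bochner_integral_mult_right) (auto simp:
          complex_solutions_def)
    then show "has_bochner_integral \<sigma> (\<lambda>z. case (Re z, Im z) of (x1,
        x2) \<Rightarrow> complex_of_real (x1 ^ m * x2 ^ n)) (s m n)"
      by (simp only: case_prod_conv real_power_expansion)
  qed
  then show "distr \<sigma> borel ?R \<in> real_solutions s"
    by (simp add: real_solutions_def)
  have "(\<lambda>(x1, x2). Complex x1 x2) \<circ> ?R = (\<lambda>z. z)"
    by auto
  moreover have "distr \<sigma> borel (\<lambda>z. z) = \<sigma>"
    by (rule distr_id2) (simp add: sets)
  ultimately show "\<sigma> = to_complex_measure (distr \<sigma> borel ?R)"
    unfolding to_complex_measure_def by (subst distr_distr) (simp_all add: measurable_Complex meas)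
qed

lemma rational_solution_is_real_solution:
  assumes "gram_function f \<phi>" "\<mu> \<in> rational_solutions \<phi>"
    and "\<And>m n. f (m, 0, 0, n, 0, 0) = h m n" "\<And>m n m' n'. cinner (h m n) (h m' n') = s (m +
        m') (n + n')"
  shows "\<mu> \<in> real_solutions s"
proof -
  have "\<phi> (m, 0, 0, n, 0, 0) = s m n" for m n
    using assms(4)[of m n 0 0] by (simp add: gram_function_eq[OF assms(1)] assms(3))
  moreover have "has_bochner_integral \<mu> (chi (m, 0, 0, n, 0, 0)) (\<phi> (m, 0, 0, n, 0, 0))" for m n
    using assms(2) by (simp add: rational_solutions_altdef)
  moreover have "chi (m, 0, 0, n, 0, 0) = (\<lambda>(x1, x2). complex_of_real (x1 ^ m * x2 ^ n))" for m n
    by (auto simp: chi_def ratio_def)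
  ultimately show ?thesis
    using assms(2) by (simp add: real_solutions_def rational_solutions_def)
qed

theorem theorem4p2:
  fixes a s :: "nat \<Rightarrow> nat \<Rightarrow> complex"
    and h :: "nat \<Rightarrow> nat \<Rightarrow> 'h::complex_hilbert_space"
    and e :: "nat \<Rightarrow> 'h"
    and w :: "nat \<Rightarrow> index"
    and u :: "nat \<Rightarrow> nat \<times> nat"
    and M :: "nat \<Rightarrow> real"
  assumes s_def: "\<And>m n. s m n = 1 / (2 ^ m * (2 * \<i>) ^ n) *
      (\<Sum>k\<le>m. \<Sum>j\<le>n. (-1) ^ (n - j) * of_nat (m choose k) * of_nat (n choose j) *
         a (k + j) ((m - k) + (n - j)))"
    and positive: "\<And>\<alpha> :: nat \<times> nat \<Rightarrow> complex. finite {p. \<alpha> p \<noteq> 0} \<Longrightarrow>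
      0 \<le> (\<Sum>(m, n)\<in>{p. \<alpha> p \<noteq> 0}. \<Sum>(m', n')\<in>{p. \<alpha> p \<noteq> 0}.
             \<alpha> (m, n) * cnj (\<alpha> (m', n')) * s (m + m') (n + n'))"
    and model: "model_space s h e"
    and w: "bij_betw w UNIV (- Omega0)"
    and u: "bij u"
    and M: "moment_bounds s w M"
    and step0: "step_zero_holds h"
    and nonempty: "bold_G h e w u M \<noteq> {}"
    and inversion: "\<And>m n. a m n =
      (\<Sum>r\<le>m. \<Sum>l\<le>n. of_nat (m choose r) * of_nat (n choose l) * (-1) ^ (n - l) *
         \<i> ^ ((m - r) + (n - l)) * s (r + l) ((m - r) + (n - l)))"
  shows "complex_solutions a = to_complex_measure ` real_solutions s \<and>
    (\<forall>v\<in>bold_G h e w u M.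
       family h w v \<in> X_set h e w \<and>
       (\<exists>!\<phi>. gram_function (family h w v) \<phi>) \<and>
       (\<forall>\<phi>. gram_function (family h w v) \<phi> \<longrightarrow>
          (\<exists>!\<mu>. \<mu> \<in> rational_solutions \<phi>) \<and>
          (\<forall>\<mu>\<in>rational_solutions \<phi>.
             \<mu> \<in> real_solutions s \<and> to_complex_measure \<mu> \<in> complex_solutions a))) \<and>
    (\<forall>\<sigma>\<in>complex_solutions a. \<exists>v\<in>bold_G h e w u M. \<exists>\<phi>. \<exists>\<mu>\<in>rational_solutions \<phi>.
       gram_function (family h w v) \<phi> \<and> \<sigma> = to_complex_measure \<mu>)"
proof (intro conjI ballI)
  interpret algorithm s h e w u
    using model w u by unfold_locales
  show eq: "complex_solutions a = to_complex_measure ` real_solutions s"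
    using complex_solution_exists[OF _ s_def] to_complex_measure_solution[OF _ inversion] by blast
  {
    fix v assume v: "v \<in> bold_G h e w u M"
    let ?f = "family h w v"
    have all: "all_equations ?f"
      by (rule bold_G_all_equations[OF step0 v])
    show "?f \<in> X_set h e w"
      by (rule bold_G_X_set[OF step0 v])
    show "\<exists>!\<phi>. gram_function ?f \<phi>"
    proof (rule ex1I)
      show "gram_function ?f (\<lambda>x. cinner (?f x) (?f (0, 0, 0, 0, 0, 0)))"
        by (rule all_equations_gram[OF all])
      show "\<phi> = (\<lambda>x. cinner (?f x) (?f (0, 0, 0, 0, 0, 0)))" if "gram_function ?f \<phi>" for \<phi>
        using gram_function_eq[OF that] by blast
    qed
    show "\<forall>\<phi>. gram_function ?f \<phi> \<longrightarrow> (\<exists>!\<mu>. \<mu> \<in> rational_solutions \<phi>) \<and>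
          (\<forall>\<mu>\<in>rational_solutions \<phi>. \<mu> \<in> real_solutions s \<and> to_complex_measure \<mu> \<in> complex_solutions a)"
    proof (intro allI impI conjI ballI)
      fix \<phi> assume gram: "gram_function ?f \<phi>"
      interpret rational_gram ?f \<phi>
        using gram all_equations_rational_family[OF all] by unfold_locales
      show "\<exists>!\<mu>. \<mu> \<in> rational_solutions \<phi>"
        using rational_solution_exists rational_solutions_unique by blast
      fix \<mu> assume "\<mu> \<in> rational_solutions \<phi>"
      then show "\<mu> \<in> real_solutions s"
        using model by (intro rational_solution_is_real_solution[OF gram, where h = h])
          (auto simp: family_Omega0 model_space_def)
      then show "to_complex_measure \<mu> \<in> complex_solutions a"
        unfolding eq by blast
    qed
  }
  fix \<sigma> assume "\<sigma> \<in> complex_solutions a"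
  then obtain \<mu> where \<mu>: "\<mu> \<in> real_solutions s" "\<sigma> = to_complex_measure \<mu>"
    unfolding eq by blast
  \<comment> \<open>\<open>\<phi>\<close> consists of the rational moments of \<open>\<mu>\<close>
    itself; the gain is a point of \<open>bold_G\<close> with this Gram function.\<close>
  obtain v where "v \<in> bold_G h e w u M" "gram_function (family h w v) (\<lambda>x. integral\<^sup>L \<mu> (chi x))"
    "\<mu> \<in> rational_solutions (\<lambda>x. integral\<^sup>L \<mu> (chi x))"
    using solution_to_bold_G[OF \<mu>(1) M] .
  with \<mu>(2) show "\<exists>v\<in>bold_G h e w u M. \<exists>\<phi>. \<exists>\<mu>\<in>rational_solutions \<phi>.
       gram_function (family h w v) \<phi> \<and> \<sigma> = to_complex_measure \<mu>"
    by blast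
qed

end
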